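(* Let $F_1$ and $F_2$ be free groups of finite ranks $n$ and $m$ respectively, let $t_1\in F_1$ and $t_2\in F_2$ be nontrivial elements, and let $G=F_1*_{\langle t\rangle}F_2$ be the amalgamated free product identifying $t_1$ with $t_2$ (denoted $t$). If $t$ is indivisible in at least one of $F_1,F_2$ and $G$ has corank $n+m-1$, then $G$ is free.
   Context: An element $g$ of a group is indivisible if $h^k=g$ implies $k=\pm1$. The corank of a finitely generated group is the maximal rank of a free group onto which it surjects. *)

theory Defs
  imports "HOL-Algebra.Algebra"
begin

text \<open>Words over an alphabet: a letter is a pair (generator, flag); flag True means the inverse.\<close>

fun reduced_word :: "('a \<times> bool) list \<Rightarrow> bool" where
  "reduced_word (x # y # w) = (\<not> (fst x = fst y \<and> snd x \<noteq> snd y) \<and> reduced_word (y # w))"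
| "reduced_word _ = True"

definition letter_val :: "('a, 'm) monoid_scheme \<Rightarrow> 'a \<times> bool \<Rightarrow> 'a" where
  "letter_val G l = (if snd l then inv\<^bsub>G\<^esub> (fst l) else fst l)"

definition word_val :: "('a, 'm) monoid_scheme \<Rightarrow> ('a \<times> bool) list \<Rightarrow> 'a" where
  "word_val G w = foldr (\<lambda>l acc. letter_val G l \<otimes>\<^bsub>G\<^esub> acc) w \<one>\<^bsub>G\<^esub>"

definition free_basis :: "('a, 'm) monoid_scheme \<Rightarrow> 'a set \<Rightarrow> bool" where
  "free_basis G B \<longleftrightarrow> B \<subseteq> carrier G \<and> generate G B = carrier G \<and>
     (\<forall>w. w \<noteq> [] \<and> reduced_word w \<and> fst ` set w \<subseteq> B \<longrightarrow> word_val G w \<noteq> one G)"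

definition is_free_group :: "('a, 'm) monoid_scheme \<Rightarrow> bool" where
  "is_free_group G \<longleftrightarrow> group G \<and> (\<exists>B. free_basis G B)"

definition free_of_rank :: "('a, 'm) monoid_scheme \<Rightarrow> nat \<Rightarrow> bool" where
  "free_of_rank G n \<longleftrightarrow> group G \<and> (\<exists>B. free_basis G B \<and> finite B \<and> card B = n)"

definition indivisible :: "('a, 'm) monoid_scheme \<Rightarrow> 'a \<Rightarrow> bool" where
  "indivisible G g \<longleftrightarrow> (\<forall>h\<in>carrier G. \<forall>k::int. h [^]\<^bsub>G\<^esub> k = g \<longrightarrow> k = 1 \<or> k = -1)"

text \<open>G surjects onto a free group of rank r. Free groups of finite rank are countable,
  so it suffices to consider target groups whose elements are natural numbers.\<close>
definition surjects_onto_free :: "('a, 'm) monoid_scheme \<Rightarrow> nat \<Rightarrow> bool" where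
  "surjects_onto_free G r \<longleftrightarrow>
     (\<exists>(H :: nat monoid) h. free_of_rank H r \<and> h \<in> hom G H \<and> h ` carrier G = carrier H)"

definition has_corank :: "('a, 'm) monoid_scheme \<Rightarrow> nat \<Rightarrow> bool" where
  "has_corank G k \<longleftrightarrow> surjects_onto_free G k \<and> (\<forall>r. surjects_onto_free G r \<longrightarrow> r \<le> k)"

text \<open>G (with i1, i2) is the amalgamated free product F1 *_{t1 = t2} F2: the pushout of
  the cyclic amalgamation. The universal property is tested against groups on nat
  (sufficient since all groups involved are countable), and generation by the factors
  (a consequence of the universal property) is recorded explicitly.\<close>
definition amalgamated_product ::
  "('a, 'm1) monoid_scheme \<Rightarrow> ('b, 'm2) monoid_scheme \<Rightarrow> 'a \<Rightarrow> 'b \<Rightarrow>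
   ('c, 'm3) monoid_scheme \<Rightarrow> ('a \<Rightarrow> 'c) \<Rightarrow> ('b \<Rightarrow> 'c) \<Rightarrow> bool" where
  "amalgamated_product F1 F2 t1 t2 G i1 i2 \<longleftrightarrow>
     group G \<and> i1 \<in> hom F1 G \<and> i2 \<in> hom F2 G \<and> i1 t1 = i2 t2 \<and>
     generate G (i1 ` carrier F1 \<union> i2 ` carrier F2) = carrier G \<and>
     (\<forall>(H :: nat monoid) f1 f2. group H \<and> f1 \<in> hom F1 H \<and> f2 \<in> hom F2 H \<and> f1 t1 = f2 t2 \<longrightarrow>
        (\<exists>\<phi>\<in>hom G H. (\<forall>x\<in>carrier F1. \<phi> (i1 x) = f1 x) \<and> (\<forall>x\<in>carrier F2. \<phi> (i2 x) = f2 x)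
           \<and> (\<forall>\<psi>\<in>hom G H. (\<forall>x\<in>carrier F1. \<psi> (i1 x) = f1 x) \<and> (\<forall>x\<in>carrier F2. \<psi> (i2 x) = f2 x)
                \<longrightarrow> (\<forall>g\<in>carrier G. \<psi> g = \<phi> g))))"

end

theory Submission
  imports Defs "HOL-Library.Z2" "HOL-Library.Function_Algebras" "HOL-Library.Product_Plus"
begin

text \<open>
  Let \<open>G\<close> map onto a free group \<open>H\<close> of rank \<open>n + m - 1\<close>, let \<open>K1\<close> and \<open>K2\<close> be the images of the
  factors, and let \<open>c\<close> be the image of \<open>t\<close>, cyclically reduced after a conjugation. In the Schreier
  graphs of \<open>K1\<close> and \<open>K2\<close> take finite connected subgraphs carrying the generators and the closed
  path \<open>c\<close>; counting homomorphisms to finite groups bounds their edges minus vertices by \<open>n - 1\<close> and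
  \<open>m - 1\<close>, strictly if a factor does not embed. Lying over one vertex of the rose is the bipartite graph
  whose edges are the positions on \<open>c\<close>, joining the vertices that the two copies of \<open>c\<close> visit there;
  lying over an edge \<open>x\<close> of the rose is the subgraph of the positions at which \<open>c\<close> runs along \<open>x\<close>.
  Comparing Euler characteristics, the graphic ranks of the latter add up to at most the rank of the
  former. Each position lies in exactly two of the subgraphs (one for each of the directions \<open>x\<close>,
  \<open>x\<^sup>-\<^sup>1\<close>), so submodularity gives the opposite inequality; hence both factors embed, and
  equality makes every subgraph a separator of the graphic matroid. Transporting separators along \<open>c\<close>
  shows that two inseparable positions read the same periodic word, and as \<open>t\<close> is not a proper power
  in one factor, there are no such positions. So the bipartite graphs are forests, and a leaf is an
  edge of one of the two Schreier graphs that \<open>c\<close> crosses exactly once. Cutting there shows that \<open>t\<close>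
  and \<open>n - 1\<close> (or \<open>m - 1\<close>) further elements generate that factor, so \<open>G\<close> is generated by
  \<open>n + m - 1\<close> elements. Since it maps onto a free group of this rank, it is free on them: a generating
  set of that size carries as many homomorphisms to each finite group as a basis does.
\<close>

section \<open>Words in free groups\<close>

text \<open>The value n + m - 1 is what leaves no slack. Glue the two Schreier graphs along
  \<open>c\<close>. As \<open>K1\<close> and \<open>K2\<close> generate \<open>H\<close>, the mod 2
  cohomology of the rose embeds in that of the glued graph, whose first Betti number is therefore at
  least n + m - 1; before gluing, the graphs have at most (n - 1) + (m - 1) more edges than
  vertices. The ranks measure what gluing identifies, and so how the two counts can be reconciled.
  The obstacle is that \<open>c\<close> may run over every edge many times, and nothing local yields
  an edge crossed once. It comes from rigidity: inseparable positions never part when moved along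
  the circle. Moving in opposite directions they would meet, against reducedness; moving in the same
  direction from a common vertex they exhibit a root of \<open>t\<close>. Ranks occur only as
  logarithms of cardinalities, of function spaces over the field with two elements or of sets of
  homomorphisms to finite groups. Inequalities between sums of ranks therefore read as inequalities
  between products.\<close>

definition linv :: "'a \<times> bool \<Rightarrow> 'a \<times> bool" where
  "linv l = (fst l, \<not> snd l)"

definition winv :: "('a \<times> bool) list \<Rightarrow> ('a \<times> bool) list" where
  "winv w = map linv (rev w)"

abbreviation words_over :: "'a set \<Rightarrow> ('a \<times> bool) list set" where
  "words_over B \<equiv> {w. fst ` set w \<subseteq> B}"

lemma fst_linv [simp]: "fst (linv l) = fst l"
  and snd_linv [simp]: "snd (linv l) = (\<not> snd l)"
  and linv_linv [simp]: "linv (linv l) = l"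
  by (simp_all add: linv_def)

lemma linv_neq [simp]: "linv l \<noteq> l" "l \<noteq> linv l"
  by (auto simp: linv_def prod_eq_iff)

lemma eq_linv_iff: "l' = linv l \<longleftrightarrow> fst l = fst l' \<and> snd l \<noteq> snd l'"
  by (auto simp: linv_def prod_eq_iff)

lemma winv_words [simp]: "fst ` set (winv w) = fst ` set w"
  by (force simp: winv_def image_image)

lemma reduced_word_Cons2: "reduced_word (x # y # w) \<longleftrightarrow> y \<noteq> linv x \<and> reduced_word (y # w)"
  by (auto simp: eq_linv_iff)

lemma not_reduced_word:
  "\<not> reduced_word w \<Longrightarrow> \<exists>u l v. w = u @ l # linv l # v"
proof (induction w rule: reduced_word.induct)
  case (1 x y w)
  show ?case
  proof (cases "y = linv x")
    case True then show ?thesis by (metis append_Nil)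
  next
    case False
    then have "\<not> reduced_word (y # w)" using 1(2) unfolding reduced_word_Cons2 by blast
    then obtain u l v where "y # w = u @ l # linv l # v" using 1(1) False by (auto simp: eq_linv_iff)
    then show ?thesis by (metis append_Cons)
  qed
qed auto

lemma reduced_word_nth:
  "reduced_word w \<Longrightarrow> Suc i < length w \<Longrightarrow> w ! Suc i \<noteq> linv (w ! i)"
proof (induction w arbitrary: i rule: reduced_word.induct)
  case (1 x y w)
  then show ?case by (cases i) (auto simp: reduced_word_Cons2 eq_linv_iff)
qed auto

lemma map_apfst_cong:
  "(\<And>x. x \<in> fst ` set w \<Longrightarrow> f x = g x) \<Longrightarrow> map (apfst f) w = map (apfst g) w"
  by (induction w) (auto simp: prod_eq_iff)

section \<open>Evaluation of words, and functions on a free group defined through words\<close>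

context group
begin

lemma letter_val_closed: "fst l \<in> carrier G \<Longrightarrow> letter_val G l \<in> carrier G"
  by (simp add: letter_val_def)

lemma letter_val_linv: "fst l \<in> carrier G \<Longrightarrow> letter_val G (linv l) = inv (letter_val G l)"
  by (simp add: letter_val_def)

lemma word_val_Nil [simp]: "word_val G [] = \<one>"
  by (simp add: word_val_def)

lemma word_val_Cons [simp]: "word_val G (l # w) = letter_val G l \<otimes> word_val G w"
  by (simp add: word_val_def)

lemma word_val_closed: "fst ` set w \<subseteq> carrier G \<Longrightarrow> word_val G w \<in> carrier G"
  by (induction w) (auto intro!: letter_val_closed m_closed)

lemma word_val_append:
  "fst ` set u \<subseteq> carrier G \<Longrightarrow> fst ` set v \<subseteq> carrier G \<Longrightarrow>
   word_val G (u @ v) = word_val G u \<otimes> word_val G v"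
  by (induction u) (auto simp: word_val_closed letter_val_closed m_assoc)

lemma word_val_winv:
  "fst ` set w \<subseteq> carrier G \<Longrightarrow> word_val G (winv w) = inv (word_val G w)"
proof (induction w)
  case (Cons l w)
  have "word_val G (winv (l # w)) = word_val G (winv w @ [linv l])" by (simp add: winv_def)
  also have "\<dots> = word_val G (winv w) \<otimes> word_val G [linv l]"
    using Cons.prems by (intro word_val_append) auto
  also have "\<dots> = inv (word_val G w) \<otimes> inv (letter_val G l)"
    using Cons by (simp add: letter_val_linv letter_val_closed)
  also have "\<dots> = inv (word_val G (l # w))"
    using Cons.prems by (simp add: inv_mult_group letter_val_closed word_val_closed)
  finally show ?case .
qed (simp add: winv_def)

lemma word_val_cancel:
  assumes "fst ` set u \<subseteq> carrier G" "fst ` set v \<subseteq> carrier G" "fst l \<in> carrier G"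
  shows "word_val G (u @ l # linv l # v) = word_val G (u @ v)"
proof -
  have "letter_val G l \<otimes> (inv letter_val G l \<otimes> word_val G v) = word_val G v"
    using assms by (simp add: letter_val_closed word_val_closed flip: m_assoc)
  then show ?thesis using assms by (simp add: word_val_append letter_val_linv)
qed

lemma word_val_in_subgroup:
  assumes "subgroup K G" "fst ` set w \<subseteq> K" shows "word_val G w \<in> K"
  using assms(2)
proof (induction w)
  case Nil show ?case using assms(1) by (simp add: subgroup.one_closed)
next
  case (Cons l w)
  then have "letter_val G l \<in> K" using assms(1) by (auto simp: letter_val_def subgroup.m_inv_closed)
  then show ?case using Cons assms(1) by (auto intro: subgroup.m_closed)
qed

lemma generate_eq_words:
  assumes "B \<subseteq> carrier G" shows "generate G B = word_val G ` words_over B"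
proof (intro equalityI subsetI)
  fix g assume "g \<in> generate G B"
  then show "g \<in> word_val G ` words_over B"
  proof (induction rule: generate.induct)
    case one show ?case by (rule image_eqI[of _ _ "[]"]) auto
  next
    case (incl h)
    then show ?case using assms by (intro image_eqI[of _ _ "[(h, False)]"]) (auto simp: letter_val_def)
  next
    case (inv h)
    then show ?case using assms by (intro image_eqI[of _ _ "[(h, True)]"]) (auto simp: letter_val_def)
  next
    case (eng h1 h2)
    then obtain w1 w2 where "h1 = word_val G w1" "h2 = word_val G w2" "w1 \<in> words_over B" "w2 \<in> words_over B"
      by auto
    then show ?case using assms by (intro image_eqI[of _ _ "w1 @ w2"]) (auto simp: word_val_append)
  qed
next
  fix g assume "g \<in> word_val G ` words_over B"
  then show "g \<in> generate G B"
    using word_val_in_subgroup[OF generate_is_subgroup[OF assms]] generate.incl[of _ B G] by blast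
qed

lemma hom_word_val:
  assumes "h \<in> hom G K" "group K" "fst ` set w \<subseteq> carrier G"
  shows "h (word_val G w) = word_val K (map (apfst h) w)"
proof -
  interpret K: group K by fact
  interpret h: group_hom G K h using assms(1) by unfold_locales
  show ?thesis using assms(3)
    by (induction w) (auto simp: letter_val_closed word_val_closed letter_val_def)
qed

lemma reduced_word_exists:
  assumes "B \<subseteq> carrier G" "w \<in> words_over B"
  shows "\<exists>w' \<in> words_over B. reduced_word w' \<and> word_val G w' = word_val G w"
  using assms(2)
proof (induction "length w" arbitrary: w rule: less_induct)
  case less
  show ?case
  proof (cases "reduced_word w")
    case False
    then obtain u l v where w: "w = u @ l # linv l # v" using not_reduced_word by blast
    have c: "fst ` set u \<subseteq> carrier G" "fst ` set v \<subseteq> carrier G" "fst l \<in> carrier G"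
      using less.prems assms(1) w by auto
    have "word_val G (u @ v) = word_val G w"
      unfolding w using c by (rule word_val_cancel[symmetric])
    then show ?thesis using less(1)[of "u @ v"] less.prems by (auto simp: w)
  qed (use less.prems in auto)
qed

text \<open>A nonempty word over a free basis with value \<open>\<one>\<close> is not reduced, so it
  contains a cancelling pair, and deleting the pair leaves a shorter such word. The context
  \<open>u\<close>, \<open>v\<close> allows the deletion at either end of another word.\<close>

lemma free_basis_cancel:
  assumes B: "free_basis G B"
    and F: "\<And>u l v. u \<in> words_over B \<Longrightarrow> fst l \<in> B \<Longrightarrow> v \<in> words_over B \<Longrightarrow>
              F (u @ l # linv l # v) = F (u @ v)"
    and "u \<in> words_over B" "v \<in> words_over B" "z \<in> words_over B" "word_val G z = \<one>"
  shows "F (u @ z @ v) = F (u @ v)"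
  using assms(5,6)
proof (induction "length z" arbitrary: z rule: less_induct)
  case less
  have BG: "B \<subseteq> carrier G" using B by (simp add: free_basis_def)
  show ?case
  proof (cases "z = []")
    case False
    then have "\<not> reduced_word z" using less.prems B by (auto simp: free_basis_def)
    then obtain u' l v' where z: "z = u' @ l # linv l # v'" using not_reduced_word by blast
    have c: "fst ` set u' \<subseteq> carrier G" "fst ` set v' \<subseteq> carrier G" "fst l \<in> carrier G"
      using less.prems BG z by auto
    have "word_val G (u' @ v') = word_val G z"
      unfolding z using c by (rule word_val_cancel[symmetric])
    then have "F (u @ (u' @ v') @ v) = F (u @ v)" using less(1)[of "u' @ v'"] less.prems by (auto simp: z)
    moreover have "F ((u @ u') @ l # linv l # (v' @ v)) = F ((u @ u') @ (v' @ v))"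
      using assms(3,4) less.prems by (intro F) (auto simp: z)
    ultimately show ?thesis by (simp add: z)
  qed simp
qed

text \<open>The word \<open>w' @ winv w' @ w\<close> collapses to \<open>w\<close> at one end and to
  \<open>w'\<close> at the other. Every invariant of cancellation thus becomes a function of the
  group element without normal forms; the invariants in question are homomorphisms and
  holonomies.\<close>

lemma free_basis_cong:
  assumes B: "free_basis G B"
    and F: "\<And>u l v. u \<in> words_over B \<Longrightarrow> fst l \<in> B \<Longrightarrow> v \<in> words_over B \<Longrightarrow>
              F (u @ l # linv l # v) = F (u @ v)"
    and w: "w \<in> words_over B" "w' \<in> words_over B" "word_val G w = word_val G w'"
  shows "F w = F w'"
proof -
  have BG: "B \<subseteq> carrier G" using B by (simp add: free_basis_def)
  then have c: "fst ` set w \<subseteq> carrier G" "fst ` set w' \<subseteq> carrier G" using w by auto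
  have "F ([] @ (w' @ winv w') @ w) = F ([] @ w)"
    using c w by (intro free_basis_cancel[where F = F, OF B F]) (simp_all add: word_val_append word_val_winv word_val_closed image_Un)
  moreover have "F (w' @ (winv w' @ w) @ []) = F (w' @ [])"
    using c w by (intro free_basis_cancel[where F = F, OF B F]) (simp_all add: word_val_append word_val_winv word_val_closed image_Un)
  ultimately show ?thesis by simp
qed

lemma free_basis_hom:
  assumes B: "free_basis G B" and K: "group K" and \<phi>: "\<phi> \<in> B \<rightarrow> carrier K"
  shows "\<exists>\<psi>\<in>hom G K. \<forall>x\<in>B. \<psi> x = \<phi> x"
proof -
  interpret K: group K by fact
  have BG: "B \<subseteq> carrier G" and gen: "carrier G = word_val G ` words_over B"
    using B generate_eq_words[of B] by (auto simp: free_basis_def)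
  define F where "F w = word_val K (map (apfst \<phi>) w)" for w
  have c: "fst ` set (map (apfst \<phi>) w) \<subseteq> carrier K" if "w \<in> words_over B" for w
    using that \<phi> by (auto simp: image_subset_iff)
  have F: "F (u @ l # linv l # v) = F (u @ v)"
    if "u \<in> words_over B" "fst l \<in> B" "v \<in> words_over B" for u l v
  proof -
    have l: "\<phi> (fst l) \<in> carrier K" using that \<phi> by auto
    have "apfst \<phi> (linv l) = linv (apfst \<phi> l)" by (simp add: prod_eq_iff)
    then show ?thesis using K.word_val_cancel[OF c[OF that(1)] c[OF that(3)], of "apfst \<phi> l"] l
      by (simp add: F_def)
  qed
  \<comment> \<open>Any word for \<open>g\<close> will do, because \<open>free_basis_cong\<close>
    makes \<open>F\<close> independent of the choice.\<close>
  define \<psi> where "\<psi> g = F (SOME w. w \<in> words_over B \<and> word_val G w = g)" for g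
  have \<psi>: "\<psi> (word_val G w) = F w" if "w \<in> words_over B" for w
  proof -
    have "\<exists>w'. w' \<in> words_over B \<and> word_val G w' = word_val G w" using that by blast
    from someI_ex[OF this] show ?thesis unfolding \<psi>_def using that free_basis_cong[where F = F, OF B F] by blast
  qed
  show ?thesis
  proof (intro bexI ballI)
    fix x assume x: "x \<in> B"
    then have "\<psi> (word_val G [(x, False)]) = F [(x, False)]" by (intro \<psi>) auto
    moreover have "word_val G [(x, False)] = x" using x BG by (auto simp: letter_val_def)
    moreover have "F [(x, False)] = \<phi> x" using funcset_mem[OF \<phi> x] by (simp add: F_def letter_val_def)
    ultimately show "\<psi> x = \<phi> x" by simp
  next
    show "\<psi> \<in> hom G K"
    proof (rule homI)
      fix g assume "g \<in> carrier G"
      then obtain w where w: "w \<in> words_over B" "g = word_val G w" using gen by auto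
      then show "\<psi> g \<in> carrier K" using \<psi>[OF w(1)] c[OF w(1)] by (simp add: F_def K.word_val_closed)
    next
      fix g h assume "g \<in> carrier G" "h \<in> carrier G"
      then obtain w v where w: "w \<in> words_over B" "g = word_val G w" "v \<in> words_over B" "h = word_val G v"
        using gen by auto
      have "g \<otimes> h = word_val G (w @ v)" using w BG by (subst word_val_append) auto
      then show "\<psi> (g \<otimes> h) = \<psi> g \<otimes>\<^bsub>K\<^esub> \<psi> h"
        using w \<psi>[of "w @ v"] \<psi>[of w] \<psi>[of v] c[of w] c[of v]
        by (auto simp: F_def K.word_val_append)
    qed
  qed
qed

lemma hom_eq_on_generate:
  assumes "\<phi> \<in> hom G K" "\<psi> \<in> hom G K" "group K" "B \<subseteq> carrier G" "\<And>x. x \<in> B \<Longrightarrow> \<phi> x = \<psi> x"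
    and "g \<in> generate G B"
  shows "\<phi> g = \<psi> g"
proof -
  obtain w where w: "w \<in> words_over B" "g = word_val G w"
    using assms(6) unfolding generate_eq_words[OF assms(4)] by blast
  then have c: "fst ` set w \<subseteq> carrier G" using assms(4) by auto
  moreover have "map (apfst \<phi>) w = map (apfst \<psi>) w"
    using w(1) assms(5) by (intro map_apfst_cong) auto
  ultimately show ?thesis using hom_word_val[OF assms(1,3) c] hom_word_val[OF assms(2,3) c] w(2) by (simp only:)
qed

end

section \<open>Separation of reduced words by finite permutation groups, and a criterion for free
  bases\<close>

lemma partial_perm_extend:
  assumes "finite S" "A \<subseteq> S" "f ` A \<subseteq> S" "inj_on f A"
  shows "\<exists>p. p permutes S \<and> (\<forall>x\<in>A. p x = f x)"
proof -
  have "card (S - A) = card (S - f ` A)"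
    using card_Diff_subset[OF finite_subset[OF assms(2,1)] assms(2)]
      card_Diff_subset[OF finite_subset[OF assms(3,1)] assms(3)] card_image[OF assms(4)] by simp
  then obtain g where g: "bij_betw g (S - A) (S - f ` A)"
    using finite_same_card_bij[of "S - A" "S - f ` A"] assms(1) by auto
  define p where "p x = (if x \<in> A then f x else if x \<in> S then g x else x)" for x
  have "bij_betw p (A \<union> (S - A)) (f ` A \<union> (S - f ` A))"
  proof (rule bij_betw_combine)
    show "bij_betw p A (f ` A)" using assms(4) by (auto simp: p_def bij_betw_def inj_on_def)
    show "bij_betw p (S - A) (S - f ` A)"
      using g by (rule bij_betw_cong[THEN iffD1, rotated]) (auto simp: p_def)
  qed auto
  moreover have "A \<union> (S - A) = S" "f ` A \<union> (S - f ` A) = S" using assms by auto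
  ultimately have "p permutes S" using assms(2) by (intro bij_imp_permutes) (auto simp: p_def)
  then show ?thesis by (auto simp: p_def)
qed

text \<open>A reduced word of length \<open>k\<close> prescribes partial injections of a path with \<open>k + 1\<close> points;
  extending these to permutations makes the word move the end of the path to its beginning.\<close>

lemma reduced_word_separated:
  assumes "reduced_word w" "w \<noteq> []"
  shows "\<exists>N \<phi>. (\<forall>x. \<phi> x \<in> carrier (sym_group N)) \<and>
           word_val (sym_group N) (map (apfst \<phi>) w) \<noteq> \<one>\<^bsub>sym_group N\<^esub>"
proof -
  define k where "k = length w"
  define S where "S = {1..Suc k}"
  \<comment> \<open>\<open>A x\<close> is where the permutation for \<open>x\<close> is prescribed,
    \<open>f x\<close> its prescribed value. Letter \<open>i\<close> has to send
    \<open>i + 2\<close> to \<open>i + 1\<close>, since the rightmost permutation acts first; an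
    inverse letter prescribes its generator from \<open>i + 1\<close> to
    \<open>i + 2\<close>.\<close>
  define A where "A x = {Suc (Suc i) | i. i < k \<and> w ! i = (x, False)} \<union> {Suc i | i. i < k \<and> w ! i = (x, True)}" for x
  define f where "f x j = (if j \<ge> 2 \<and> j - 2 < k \<and> w ! (j - 2) = (x, False) then j - 1 else j + 1)" for x j
  have red: "w ! Suc i \<noteq> linv (w ! i)" if "Suc i < k" for i
    using reduced_word_nth assms(1) that k_def by blast
  have f1: "f x (Suc (Suc i)) = Suc i" if "i < k" "w ! i = (x, False)" for x i
    using that by (simp add: f_def)
  have f2: "f x (Suc i) = Suc (Suc i)" if "i < k" "w ! i = (x, True)" for x i
  proof -
    \<comment> \<open>A conflicting prescription could only come from the letter before, which would
      then be inverse to letter \<open>i\<close>.\<close>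
    have "\<not> (i \<ge> 1 \<and> w ! (i - 1) = (x, False))"
      using red[of "i - 1"] that by (cases i) (auto simp: linv_def)
    then show ?thesis by (auto simp: f_def numeral_2_eq_2)
  qed
  have inj: "inj_on (f x) (A x)" for x
  proof (rule inj_onI)
    fix i j assume ij: "i \<in> A x" "j \<in> A x" "f x i = f x j"
    consider i' j' where "i = Suc (Suc i')" "i' < k" "w ! i' = (x, False)" "j = Suc (Suc j')" "j' < k" "w ! j' = (x, False)"
      | i' j' where "i = Suc (Suc i')" "i' < k" "w ! i' = (x, False)" "j = Suc j'" "j' < k" "w ! j' = (x, True)"
      | i' j' where "i = Suc i'" "i' < k" "w ! i' = (x, True)" "j = Suc (Suc j')" "j' < k" "w ! j' = (x, False)"
      | i' j' where "i = Suc i'" "i' < k" "w ! i' = (x, True)" "j = Suc j'" "j' < k" "w ! j' = (x, True)"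
      using ij(1,2) unfolding A_def by blast
    then show "i = j"
    proof cases
      case 1 then show ?thesis using ij(3) f1 by auto
    next
      case 2
      then have "i' = Suc j'" using ij(3) f1[of i' x] f2[of j' x] by simp
      then show ?thesis using red[of j'] 2 by (auto simp: linv_def)
    next
      case 3
      then have "j' = Suc i'" using ij(3) f1[of j' x] f2[of i' x] by simp
      then show ?thesis using red[of i'] 3 by (auto simp: linv_def)
    next
      case 4 then show ?thesis using ij(3) f2 by auto
    qed
  qed
  have "\<exists>p. p permutes S \<and> (\<forall>j\<in>A x. p j = f x j)" for x
  proof (rule partial_perm_extend[OF _ _ _ inj])
    show "f x ` A x \<subseteq> S" using f1 f2 by (auto simp: A_def S_def)
  qed (auto simp: A_def S_def)
  then obtain \<phi> where \<phi>: "\<And>x. \<phi> x permutes S" "\<And>x j. j \<in> A x \<Longrightarrow> \<phi> x j = f x j" by metis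
  interpret S: group "sym_group (Suc k)" by (rule sym_group_is_group)
  have car: "\<phi> x \<in> carrier (sym_group (Suc k))" for x using \<phi>(1) by (simp add: sym_group_carrier S_def)
  define lv where "lv l = letter_val (sym_group (Suc k)) (apfst \<phi> l)" for l
  have step: "lv (w ! i) (Suc (Suc i)) = Suc i" if i: "i < k" for i
  proof (cases "snd (w ! i)")
    case False
    then have wi: "w ! i = (fst (w ! i), False)" by (metis prod.collapse)
    have "Suc (Suc i) \<in> A (fst (w ! i))" unfolding A_def using i wi by auto
    then show ?thesis using \<phi>(2) f1[OF i wi] False by (simp add: lv_def letter_val_def)
  next
    case True
    then have wi: "w ! i = (fst (w ! i), True)" by (metis prod.collapse)
    have "Suc i \<in> A (fst (w ! i))" unfolding A_def using i wi by auto
    then have "\<phi> (fst (w ! i)) (Suc i) = Suc (Suc i)" using \<phi>(2) f2[OF i wi] by simp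
    then have "Hilbert_Choice.inv (\<phi> (fst (w ! i))) (Suc (Suc i)) = Suc i"
      using \<phi>(1) permutes_inverses(2) by metis
    then show ?thesis using True car by (simp add: lv_def letter_val_def)
  qed
  have "word_val (sym_group (Suc k)) (map (apfst \<phi>) (drop (k - j) w)) (Suc k) = Suc (k - j)" if "j \<le> k" for j
    using that
  proof (induction j)
    case 0
    have "drop k w = []" by (simp add: k_def)
    then show ?case by (simp add: sym_group_one)
  next
    case (Suc j)
    then have "drop (k - Suc j) w = w ! (k - Suc j) # drop (k - j) w"
      by (subst Cons_nth_drop_Suc[symmetric]) (auto simp: k_def Suc_diff_Suc)
    then show ?case using Suc step[of "k - Suc j"]
      by (simp add: sym_group_mult lv_def Suc_diff_Suc)
  qed
  from this[of k] have "word_val (sym_group (Suc k)) (map (apfst \<phi>) w) (Suc k) = 1" by simp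
  moreover have "k > 0" using assms(2) by (simp add: k_def)
  ultimately have "word_val (sym_group (Suc k)) (map (apfst \<phi>) w) \<noteq> \<one>\<^bsub>sym_group (Suc k)\<^esub>"
    by (auto simp: sym_group_one fun_eq_iff intro!: exI[of _ "Suc k"])
  then show ?thesis using car by blast
qed

lemma finite_sym_group: "finite (carrier (sym_group N))"
  by (simp add: sym_group_def finite_permutations)

text \<open>A homomorphism from \<open>H\<close> to a finite group \<open>S\<close>, pulled back
  along \<open>h\<close>, is determined by its values on \<open>Y\<close>. There are
  \<open>|S|^|B|\<close> of them and at most as many maps from \<open>Y\<close> to \<open>S\<close>,
  so every map from \<open>Y\<close> to \<open>S\<close> arises, in particular one that separates a
  given reduced word from \<open>\<one>\<close>. This takes the place of the Hopf property.\<close>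

lemma free_basis_of_surjection:
  fixes G :: "('a, 'm) monoid_scheme" and H :: "('b, 'n) monoid_scheme"
  assumes "group G" "group H" and Y: "Y \<subseteq> carrier G" "finite Y" "generate G Y = carrier G"
    and B: "free_basis H B" "finite B" "card Y \<le> card B"
    and h: "h \<in> hom G H" "h ` carrier G = carrier H"
  shows "free_basis G Y"
proof -
  interpret G: group G by fact
  interpret H: group H by fact
  interpret h: group_hom G H h using h(1) by unfold_locales
  have BH: "B \<subseteq> carrier H" "generate H B = carrier H" using B by (auto simp: free_basis_def)
  have hY: "generate H (h ` Y) = carrier H" using h.generate_img[OF Y(1)] Y(3) h(2) by simp
  have "word_val G w \<noteq> \<one>\<^bsub>G\<^esub>" if w: "w \<noteq> []" "reduced_word w" "fst ` set w \<subseteq> Y" for w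
  proof
    assume w1: "word_val G w = \<one>\<^bsub>G\<^esub>"
    obtain N \<phi> where \<phi>: "\<And>x. \<phi> x \<in> carrier (sym_group N)"
      and ne: "word_val (sym_group N) (map (apfst \<phi>) w) \<noteq> \<one>\<^bsub>sym_group N\<^esub>"
      using reduced_word_separated[OF w(2,1)] by blast
    define S where "S = sym_group N"
    interpret S: group S unfolding S_def by (rule sym_group_is_group)
    have finS: "finite (carrier S)" and neS: "card (carrier S) > 0"
      using finite_sym_group S.one_closed by (auto simp: S_def card_gt_0_iff)
    have "\<exists>\<psi>\<in>hom H S. \<forall>x\<in>B. \<psi> x = p x" if "p \<in> B \<rightarrow>\<^sub>E carrier S" for p
      using H.free_basis_hom[OF B(1), of S p] that S.is_group by (auto simp: PiE_def)
    then obtain \<Psi> where \<Psi>: "\<And>p. p \<in> B \<rightarrow>\<^sub>E carrier S \<Longrightarrow> \<Psi> p \<in> hom H S"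
      "\<And>p x. p \<in> B \<rightarrow>\<^sub>E carrier S \<Longrightarrow> x \<in> B \<Longrightarrow> \<Psi> p x = p x" by metis
    define R where "R p = (\<lambda>y\<in>Y. \<Psi> p (h y))" for p
    have inj: "inj_on R (B \<rightarrow>\<^sub>E carrier S)"
    proof (rule inj_onI)
      fix p q assume p: "p \<in> B \<rightarrow>\<^sub>E carrier S" and q: "q \<in> B \<rightarrow>\<^sub>E carrier S" and "R p = R q"
      then have eq: "\<Psi> p z = \<Psi> q z" if "z \<in> h ` Y" for z using that by (auto simp: R_def fun_eq_iff restrict_def split: if_splits)
      have hYH: "h ` Y \<subseteq> carrier H" using Y(1) by auto
      have "\<Psi> p z = \<Psi> q z" if "z \<in> carrier H" for z
        by (rule H.hom_eq_on_generate[OF \<Psi>(1)[OF p] \<Psi>(1)[OF q] S.is_group hYH eq])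
          (use hY that in auto)
      then have "p x = q x" if "x \<in> B" for x using that BH \<Psi>(2)[OF p that] \<Psi>(2)[OF q that] by auto
      then show "p = q" using PiE_ext[OF p q] by blast
    qed
    have sub: "R ` (B \<rightarrow>\<^sub>E carrier S) \<subseteq> Y \<rightarrow>\<^sub>E carrier S"
    proof (rule image_subsetI)
      fix p assume "p \<in> B \<rightarrow>\<^sub>E carrier S"
      then have "\<Psi> p (h y) \<in> carrier S" if "y \<in> Y" for y
        using h.hom_closed Y(1) that by (blast intro: hom_in_carrier[OF \<Psi>(1)])
      then show "R p \<in> Y \<rightarrow>\<^sub>E carrier S" unfolding R_def by (intro restrict_PiE_iff[THEN iffD2]) blast
    qed
    have "R ` (B \<rightarrow>\<^sub>E carrier S) = Y \<rightarrow>\<^sub>E carrier S"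
    proof (rule card_subset_eq[OF _ sub])
      show f: "finite (Y \<rightarrow>\<^sub>E carrier S)" using Y(2) finS by (intro finite_PiE)
      have "card (R ` (B \<rightarrow>\<^sub>E carrier S)) = card (carrier S) ^ card B"
        using inj B(2) by (simp add: card_image card_PiE)
      moreover have "card (Y \<rightarrow>\<^sub>E carrier S) = card (carrier S) ^ card Y" using Y(2) by (simp add: card_PiE)
      moreover have "card (carrier S) ^ card Y \<le> card (carrier S) ^ card B"
        using B(3) neS by (intro power_increasing) auto
      ultimately show "card (R ` (B \<rightarrow>\<^sub>E carrier S)) = card (Y \<rightarrow>\<^sub>E carrier S)"
        using card_mono[OF f sub] by linarith
    qed
    moreover have "restrict \<phi> Y \<in> Y \<rightarrow>\<^sub>E carrier S" using \<phi> by (auto simp: S_def)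
    ultimately obtain p where p: "p \<in> B \<rightarrow>\<^sub>E carrier S" "restrict \<phi> Y = R p" by blast
    have "\<Psi> p (h y) = \<phi> y" if "y \<in> Y" for y using fun_cong[OF p(2), of y] that by (simp add: R_def)
    then have "map (apfst (\<Psi> p \<circ> h)) w = map (apfst \<phi>) w"
      using w(3) by (intro map_apfst_cong) auto
    moreover have hom: "\<Psi> p \<circ> h \<in> hom G S" using h(1) \<Psi>(1)[OF p(1)] by (rule hom_compose)
    moreover have "fst ` set w \<subseteq> carrier G" using w(3) Y(1) by blast
    ultimately have "(\<Psi> p \<circ> h) (word_val G w) = word_val S (map (apfst \<phi>) w)"
      using G.hom_word_val[OF hom S.is_group] by (simp only:)
    moreover have "(\<Psi> p \<circ> h) \<one>\<^bsub>G\<^esub> = \<one>\<^bsub>S\<^esub>"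
      using hom_one[OF hom] G.is_group S.is_group by simp
    ultimately show False using ne w1 by (simp add: S_def)
  qed
  then show ?thesis using Y(1,3) unfolding free_basis_def by blast
qed

section \<open>Counting over the field with two elements\<close>

text \<open>The nonempty fibres are translates of the kernel: rank-nullity in the multiplicative
  form in which all dimensions enter below.\<close>

lemma card_additive_image:
  fixes f :: "'a::ab_group_add \<Rightarrow> 'b::ab_group_add"
  assumes "finite U" and cl: "\<And>u v. u \<in> U \<Longrightarrow> v \<in> U \<Longrightarrow> u - v \<in> U"
    and f: "\<And>u v. u \<in> U \<Longrightarrow> v \<in> U \<Longrightarrow> f (u - v) = f u - f v"
  shows "card U = card (f ` U) * card {u \<in> U. f u = 0}"
proof -
  have cl': "u + v \<in> U" "f (u + v) = f u + f v" if "u \<in> U" "v \<in> U" for u v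
  proof -
    have "0 \<in> U" using cl[of u u] that by simp
    then have m: "- v \<in> U" using cl[of 0 v] that by simp
    have "f 0 = 0" using f[of u u] that by simp
    then have "f (- v) = - f v" using f[of 0 v] that \<open>0 \<in> U\<close> by simp
    then show "u + v \<in> U" "f (u + v) = f u + f v" using cl[of u "- v"] f[of u "- v"] that m by auto
  qed
  have "card {u \<in> U. f u = y} = card {u \<in> U. f u = 0}" if y: "y \<in> f ` U" for y
  proof -
    obtain u0 where u0: "u0 \<in> U" "f u0 = y" using y by auto
    have "bij_betw (\<lambda>u. u - u0) {u \<in> U. f u = y} {u \<in> U. f u = 0}"
      by (rule bij_betw_byWitness[where f' = "\<lambda>u. u + u0"]) (auto simp: u0 cl cl' f)
    then show ?thesis by (rule bij_betw_same_card)
  qed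
  moreover have "card U = (\<Sum>y\<in>f ` U. card {u \<in> U. f u = y})"
    using sum.image_gen[OF assms(1), of "\<lambda>_. 1::nat" f] by simp
  ultimately show ?thesis by simp
qed

text \<open>Restriction extends by zero instead of shrinking the domain, so that a restricted
  function can again be a member of \<open>W\<close>; this is what it means to be a
  separator.\<close>

definition res :: "'i set \<Rightarrow> ('i \<Rightarrow> bit) \<Rightarrow> 'i \<Rightarrow> bit" where
  "res T w = (\<lambda>i. if i \<in> T then w i else 0)"

text \<open>The rank of \<open>T\<close> in the matroid represented by \<open>W\<close> is the binary logarithm of \<open>rho W T\<close>.\<close>

definition rho :: "('i \<Rightarrow> bit) set \<Rightarrow> 'i set \<Rightarrow> nat" where
  "rho W T = card (res T ` W)"

lemma bit_plus_self [simp]: "b + b = (0::bit)"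
  by (cases b) auto

lemma bit_plus_eq_0_iff [simp]: "b + c = (0::bit) \<longleftrightarrow> b = c"
  by (cases b; cases c) auto

lemma res_minus: "res T (u - v) = res T u - res T v"
  by (auto simp: res_def fun_eq_iff)

lemma res_res: "res T (res U w) = res (T \<inter> U) w"
  by (auto simp: res_def fun_eq_iff)

lemma res_UNIV [simp]: "res UNIV w = w"
  by (simp add: res_def)

text \<open>Over the field with two elements a nonempty set closed under differences is already a
  linear subspace.\<close>

locale function_space =
  fixes W :: "('i \<Rightarrow> bit) set"
  assumes finite_W: "finite W" and W_minus: "u \<in> W \<Longrightarrow> v \<in> W \<Longrightarrow> u - v \<in> W" and W_nonempty: "W \<noteq> {}"
begin

lemma W_zero: "0 \<in> W"
  using W_minus W_nonempty by (metis diff_self ex_in_conv)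

lemma rho_pos: "rho W T > 0"
  using finite_W W_nonempty by (simp add: rho_def card_gt_0_iff)

lemma rho_mono: assumes "T \<subseteq> U" shows "rho W T \<le> rho W U"
proof -
  have "res T ` W = res T ` res U ` W"
    using assms by (simp add: image_image res_res Int_absorb2)
  then show ?thesis by (simp add: rho_def finite_W card_image_le)
qed

text \<open>The logarithm of the second factor is the rank of \<open>U\<close> after contraction of
  \<open>T\<close>.\<close>

lemma rho_kernel:
  assumes "T \<subseteq> U"
  shows "rho W U = rho W T * card {w \<in> res U ` W. res T w = 0}"
proof -
  have "card (res U ` W) = card (res T ` res U ` W) * card {w \<in> res U ` W. res T w = 0}"
  proof (rule card_additive_image)
    show "u - v \<in> res U ` W" if "u \<in> res U ` W" "v \<in> res U ` W" for u v
      using that W_minus by (auto simp flip: res_minus)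
  qed (auto simp: finite_W res_minus)
  moreover have "res T ` res U ` W = res T ` W"
    using assms by (simp add: image_image res_res Int_absorb2)
  ultimately show ?thesis by (simp add: rho_def)
qed

text \<open>A function on \<open>T \<union> U\<close> that vanishes on \<open>T\<close> is its own
  restriction to \<open>U\<close>, where it vanishes on \<open>T \<inter> U\<close>. By
  \<open>rho_kernel\<close> this compares the ratio of \<open>T \<union> U\<close> to
  \<open>T\<close> with that of \<open>U\<close> to \<open>T \<inter> U\<close>.\<close>

lemma rho_submodular: "rho W (T \<union> U) * rho W (T \<inter> U) \<le> rho W T * rho W U"
proof -
  have sub: "{w \<in> res (T \<union> U) ` W. res T w = 0} \<subseteq> {w \<in> res U ` W. res (T \<inter> U) w = 0}"
  proof safe
    fix w assume w: "w \<in> W" "res T (res (T \<union> U) w) = 0"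
    then have z: "w i = 0" if "i \<in> T" for i using that by (auto simp: res_def fun_eq_iff split: if_splits)
    then have e: "res (T \<union> U) w = res U w" by (auto simp: res_def fun_eq_iff)
    show "res (T \<union> U) w \<in> res U ` W" using e w(1) by auto
    show "res (T \<inter> U) (res (T \<union> U) w) = 0" using z by (auto simp: res_def fun_eq_iff)
  qed
  have "card {w \<in> res (T \<union> U) ` W. res T w = 0} \<le> card {w \<in> res U ` W. res (T \<inter> U) w = 0}"
    using finite_W by (intro card_mono sub) auto
  then show ?thesis
    using rho_kernel[of T "T \<union> U"] rho_kernel[of "T \<inter> U" U] by (simp add: mult_le_mono2)
qed

lemma rho_submultiplicative: "rho W (T \<union> U) \<le> rho W T * rho W U"
proof -
  have "rho W (T \<union> U) * 1 \<le> rho W (T \<union> U) * rho W (T \<inter> U)"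
    using rho_pos[of "T \<inter> U"] by (intro mult_le_mono2) simp
  then show ?thesis using rho_submodular[of T U] by linarith
qed

text \<open>Iterated submodularity: adding \<open>T k\<close> to a union \<open>U\<close> releases a
  factor for \<open>U \<inter> T k\<close>, and these are the points that \<open>T k\<close> covers
  once more.\<close>

lemma rho_double_cover:
  assumes "finite J"
  shows "rho W (\<Union>j\<in>J. T j) * rho W {i. \<exists>j\<in>J. \<exists>k\<in>J. j \<noteq> k \<and> i \<in> T j \<and> i \<in> T k} \<le> (\<Prod>j\<in>J. rho W (T j))"
  using assms
proof (induction J)
  case empty
  have "res {} ` W = {0}" using W_nonempty by (auto simp: res_def fun_eq_iff image_def)
  then show ?case by (simp add: rho_def)
next
  case (insert k J)
  define U where "U = (\<Union>j\<in>J. T j)"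
  define D where "D = {i. \<exists>j\<in>J. \<exists>k\<in>J. j \<noteq> k \<and> i \<in> T j \<and> i \<in> T k}"
  have D': "{i. \<exists>j\<in>insert k J. \<exists>k'\<in>insert k J. j \<noteq> k' \<and> i \<in> T j \<and> i \<in> T k'} = D \<union> (U \<inter> T k)"
    using insert(2) by (auto simp: D_def U_def)
  have U': "(\<Union>j\<in>insert k J. T j) = U \<union> T k" by (auto simp: U_def)
  have "rho W (U \<union> T k) * rho W (D \<union> (U \<inter> T k)) \<le> rho W (U \<union> T k) * (rho W D * rho W (U \<inter> T k))"
    by (intro mult_le_mono2 rho_submultiplicative)
  also have "\<dots> = (rho W (U \<union> T k) * rho W (U \<inter> T k)) * rho W D" by simp
  also have "\<dots> \<le> (rho W U * rho W (T k)) * rho W D" by (intro mult_le_mono1 rho_submodular)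
  also have "\<dots> = rho W (T k) * (rho W U * rho W D)" by simp
  also have "\<dots> \<le> rho W (T k) * (\<Prod>j\<in>J. rho W (T j))"
    using insert.IH by (intro mult_le_mono2) (simp add: U_def D_def)
  finally show ?case by (simp only: U' D' prod.insert[OF insert(1,2)])
qed

text \<open>A function is determined by its restrictions to \<open>T\<close> and \<open>- T\<close>,
  which embeds \<open>W\<close> in a product. The hypothesis makes the embedding onto, so the pair
  of \<open>res T w\<close> and zero comes from a member of \<open>W\<close>.\<close>

lemma separator:
  assumes "rho W T * rho W (- T) \<le> rho W UNIV" "w \<in> W"
  shows "res T w \<in> W"
proof -
  define P where "P = (res T ` W) \<times> (res (- T) ` W)"
  define f where "f w = (res T w, res (- T) w)" for w :: "'i \<Rightarrow> bit"
  have "inj_on f W"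
  proof (rule inj_onI, rule ext)
    fix u v i assume "f u = f v"
    then have "res T u i = res T v i" "res (- T) u i = res (- T) v i" by (simp_all add: f_def)
    then show "u i = v i" by (auto simp: res_def split: if_splits)
  qed
  then have "card (f ` W) = rho W UNIV" by (simp add: card_image rho_def)
  moreover have "card P = rho W T * rho W (- T)" by (simp add: P_def rho_def card_cartesian_product)
  moreover have "finite P" "f ` W \<subseteq> P" using finite_W by (auto simp: P_def f_def)
  ultimately have "f ` W = P" using assms(1) by (intro card_seteq) auto
  moreover have "(res T w, res (- T) 0) \<in> P" using assms(2) W_zero by (auto simp: P_def)
  ultimately obtain w' where w': "w' \<in> W" "res T w' = res T w" "res (- T) w' = res (- T) 0"
    by (auto simp: f_def image_iff)
  have "w' = res T w"
  proof
    fix i show "w' i = res T w i"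
      using fun_cong[OF w'(2), of i] fun_cong[OF w'(3), of i] by (auto simp: res_def split: if_splits)
  qed
  then show ?thesis using w'(1) by simp
qed

end

section \<open>A pair of closed paths\<close>

lemma periodic_mult:
  fixes f :: "int \<Rightarrow> 'a"
  assumes "\<And>i. f (i + d) = f i"
  shows "f (i + k * d) = f i"
proof (induction k rule: int_induct[of _ 0])
  case (step1 k)
  then show ?case using assms[of "i + k * d"] by (simp add: algebra_simps)
next
  case (step2 k)
  then show ?case using assms[of "i + (k - 1) * d"] by (simp add: algebra_simps)
qed simp

lemma periodic_mod:
  fixes f :: "int \<Rightarrow> 'a"
  assumes "\<And>i. f (i + d) = f i"
  shows "f (i mod d) = f i"
  using periodic_mult[of f d "i mod d" "i div d", OF assms] by (simp add: algebra_simps)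

lemma periodic_cong:
  fixes f :: "int \<Rightarrow> 'a"
  assumes "\<And>i. f (i + d) = f i" "d dvd j - i"
  shows "f j = f i"
proof -
  obtain k where "j = i + k * d" using assms(2) by (metis add.commute diff_add_cancel dvdE mult.commute)
  then show ?thesis using periodic_mult[of f d, OF assms(1)] by simp
qed

text \<open>A cyclic word \<open>L\<close>, unrolled to a periodic function on the integers, is read simultaneously by the
  closed paths \<open>a\<close> and \<open>b\<close> in two graphs whose letters act by \<open>sa\<close> and \<open>sb\<close>. Below, \<open>W\<close> is
  the cut space of the bipartite graph with an edge from \<open>a i\<close> to \<open>b i\<close> for each position \<open>i\<close>, \<open>T l\<close>
  is the set of positions that the circle leaves in direction \<open>l\<close>, forwards or backwards, and
  \<open>move l\<close> is the position reached in this way.\<close>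

locale circle_pair =
  fixes L :: "int \<Rightarrow> 'x \<times> bool" and len :: int and a :: "int \<Rightarrow> 'v" and b :: "int \<Rightarrow> 'u"
    and sa :: "'v \<Rightarrow> 'x \<times> bool \<Rightarrow> 'v" and sb :: "'u \<Rightarrow> 'x \<times> bool \<Rightarrow> 'u" and B :: "'x set"
  assumes len: "len > 0" and L_per: "L (i + len) = L i" and a_per: "a (i + len) = a i"
    and b_per: "b (i + len) = b i" and red: "L (i + 1) \<noteq> linv (L i)"
    and a_step: "a (i + 1) = sa (a i) (L i)" and a_back: "a i = sa (a (i + 1)) (linv (L i))"
    and b_step: "b (i + 1) = sb (b i) (L i)" and b_back: "b i = sb (b (i + 1)) (linv (L i))"
    and finite_B: "finite B" and L_B: "fst (L i) \<in> B"
begin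

definition W :: "(int \<Rightarrow> bit) set" where
  "W = {\<lambda>i. p (a i) + q (b i) | p q. True}"

definition T :: "'x \<times> bool \<Rightarrow> int set" where
  "T l = {i. L i = l \<or> L (i - 1) = linv l}"

definition move :: "'x \<times> bool \<Rightarrow> int \<Rightarrow> int" where
  "move l i = (if L i = l then i + 1 else i - 1)"

lemma red': "L i \<noteq> linv (L (i - 1))"
  using red[of "i - 1"] by simp

lemma a_move: "i \<in> T l \<Longrightarrow> a (move l i) = sa (a i) l"
  using a_step[of i] a_back[of "i - 1"] by (auto simp: T_def move_def)

lemma b_move: "i \<in> T l \<Longrightarrow> b (move l i) = sb (b i) l"
  using b_step[of i] b_back[of "i - 1"] by (auto simp: T_def move_def)

lemma move_T: "i \<in> T l \<Longrightarrow> move l i \<in> T (linv l)"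
  by (auto simp: T_def move_def)

lemma move_move: "i \<in> T l \<Longrightarrow> move (linv l) (move l i) = i"
  using red[of i] by (auto simp: T_def move_def)

lemma T_forward: "i \<in> T (L i)" and T_backward: "i \<in> T (linv (L (i - 1)))"
  by (auto simp: T_def)

lemma T_iff: "i \<in> T l \<longleftrightarrow> l = L i \<or> l = linv (L (i - 1))"
  by (auto simp: T_def)

lemma W_memI: "(\<lambda>i. p (a i) + q (b i)) \<in> W"
  by (auto simp: W_def)

lemma W_memE:
  assumes "w \<in> W" obtains p q where "w = (\<lambda>i. p (a i) + q (b i))"
  using assms unfolding W_def by blast

lemma W_per: "w \<in> W \<Longrightarrow> w (i + len) = w i"
  by (auto simp: W_def a_per b_per)

sublocale function_space W
proof
  show "u - v \<in> W" if uv: "u \<in> W" "v \<in> W" for u v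
  proof -
    obtain p q p' q' where "u = (\<lambda>i. p (a i) + q (b i))" "v = (\<lambda>i. p' (a i) + q' (b i))"
      using uv by (auto simp: W_def)
    then have "u - v = (\<lambda>i. (p + p') (a i) + (q + q') (b i))" by (auto simp: fun_eq_iff)
    then show ?thesis using W_memI[of "p + p'" "q + q'"] by simp
  qed
  show "W \<noteq> {}" using W_memI by blast
  have sub: "W \<subseteq> (\<lambda>f i. f (i mod len)) ` ({0..<len} \<rightarrow>\<^sub>E UNIV)"
  proof
    fix w assume w: "w \<in> W"
    have "restrict w {0..<len} (i mod len) = w i" for i
      using periodic_mod[of w len i, OF W_per[OF w]] len by simp
    then show "w \<in> (\<lambda>f i. f (i mod len)) ` ({0..<len} \<rightarrow>\<^sub>E UNIV)"
      by (intro image_eqI[of _ _ "restrict w {0..<len}"]) auto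
  qed
  have fin: "finite (UNIV :: bit set)"
  proof (rule finite_subset[of _ "{0, 1}"])
    show "UNIV \<subseteq> {0, 1 :: bit}" using bit.exhaust by blast
  qed simp
  have "finite ((\<lambda>f i. f (i mod len)) ` ({0..<len} \<rightarrow>\<^sub>E (UNIV :: bit set)))"
    using fin by (intro finite_imageI finite_PiE) auto
  then show "finite W" by (rule finite_subset[OF sub])
qed

text \<open>Precomposing \<open>p\<close> and \<open>q\<close> with the action of \<open>l\<close>
  on vertices turns a cut function read at the far ends of the \<open>l\<close>-steps into one read
  at the near ends.\<close>

lemma transport:
  assumes "w \<in> W"
  shows "\<exists>w'\<in>W. \<forall>i\<in>T l. w' i = w (move l i)"
proof -
  obtain p q where w: "w = (\<lambda>i. p (a i) + q (b i))" using assms by (auto simp: W_def)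
  show ?thesis
    by (rule bexI[OF _ W_memI[of "\<lambda>v. p (sa v l)" "\<lambda>v. q (sb v l)"]]) (auto simp: w a_move b_move)
qed

text \<open>\<open>move\<close> matches the two ends of the \<open>l\<close>-steps, and
  \<open>transport\<close> carries restrictions of \<open>W\<close> along. With
  \<open>linv l\<close> in place of \<open>l\<close> the ranks agree.\<close>

lemma rho_T_linv: "rho W (T (linv l)) \<le> rho W (T l)"
proof -
  define g where "g u = (\<lambda>i. if i \<in> T (linv l) then u (move (linv l) i) else 0 :: bit)" for u :: "int \<Rightarrow> bit"
  have "res (T (linv l)) ` W \<subseteq> g ` res (T l) ` W"
  proof safe
    fix w assume w: "w \<in> W"
    then obtain w' where w': "w' \<in> W" "\<And>i. i \<in> T l \<Longrightarrow> w' i = w (move l i)" using transport by blast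
    have "res (T (linv l)) w i = g (res (T l) w') i" for i
      using move_T[of i "linv l"] move_move[of i "linv l"] w'(2) by (auto simp: res_def g_def)
    then have "res (T (linv l)) w = g (res (T l) w')" by blast
    then show "res (T (linv l)) w \<in> g ` res (T l) ` W" using w'(1) by blast
  qed
  then show ?thesis using finite_W by (simp add: rho_def surj_card_le)
qed

text \<open>Each position lies in \<open>T\<close> of exactly two letters, \<open>L i\<close> and
  \<open>linv (L (i - 1))\<close>, which differ because the word is reduced. Without the letter
  \<open>l\<close> the sets still cover everything, and doubly outside \<open>T l\<close>. Leaving
  \<open>l\<close> out preserves the factor for \<open>- T l\<close> that decides whether
  \<open>T l\<close> is a separator. The square comes from the two orientations of each
  generator.\<close>

lemma rho_cover:
  assumes "fst l \<in> B"
  shows "rho W UNIV * (rho W (T l) * rho W (- T l)) \<le> (\<Prod>x\<in>B. rho W (T (x, False)))\<^sup>2"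
proof -
  define J where "J = B \<times> (UNIV :: bool set)"
  have J: "finite J" "l \<in> J" using assms finite_B by (auto simp: J_def mem_Times_iff)
  have LJ: "L i \<in> J" "linv (L i) \<in> J" for i using L_B[of i] by (auto simp: J_def mem_Times_iff)
  have U: "(\<Union>j\<in>J - {l}. T j) = UNIV"
  proof -
    have "\<exists>j\<in>J - {l}. i \<in> T j" for i
    proof (cases "L i = l")
      case False then show ?thesis using LJ T_forward by blast
    next
      case True
      then have "linv (L (i - 1)) \<noteq> l" using red'[of i] by metis
      then show ?thesis using LJ T_backward by blast
    qed
    then show ?thesis by blast
  qed
  have D: "- T l \<subseteq> {i. \<exists>j\<in>J - {l}. \<exists>k\<in>J - {l}. j \<noteq> k \<and> i \<in> T j \<and> i \<in> T k}"
  proof safe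
    fix i assume "i \<notin> T l"
    then have "L i \<noteq> l" "linv (L (i - 1)) \<noteq> l" by (auto simp: T_iff)
    then show "\<exists>j\<in>J - {l}. \<exists>k\<in>J - {l}. j \<noteq> k \<and> i \<in> T j \<and> i \<in> T k"
      using LJ T_forward[of i] T_backward[of i] red'[of i] by blast
  qed
  have "rho W UNIV * rho W (- T l) \<le> (\<Prod>j\<in>J - {l}. rho W (T j))"
    using rho_double_cover[of "J - {l}" T] rho_mono[OF D] J(1) unfolding U
    by (meson dual_order.trans finite_Diff mult_le_mono2)
  then have "rho W UNIV * rho W (- T l) * rho W (T l) \<le> rho W (T l) * (\<Prod>j\<in>J - {l}. rho W (T j))"
    by simp
  also have "\<dots> = (\<Prod>j\<in>J. rho W (T j))" using J by (simp add: prod.remove)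
  also have "\<dots> = (\<Prod>x\<in>B. \<Prod>s\<in>UNIV. rho W (T (x, s)))"
    unfolding J_def by (simp add: prod.cartesian_product)
  also have "\<dots> = (\<Prod>x\<in>B. rho W (T (x, False)) * rho W (T (x, True)))"
    by (simp add: UNIV_bool mult.commute)
  also have "\<dots> \<le> (\<Prod>x\<in>B. rho W (T (x, False)) * rho W (T (x, False)))"
  proof (intro prod_mono conjI mult_le_mono2)
    fix x show "rho W (T (x, True)) \<le> rho W (T (x, False))"
      using rho_T_linv[of "(x, False)"] by (simp add: linv_def)
  qed simp
  finally show ?thesis by (simp add: prod.distrib power2_eq_square mult.assoc mult.left_commute mult.commute)
qed

text \<open>Splitting \<open>UNIV\<close> into \<open>T l\<close> and its complement turns
  \<open>rho_cover\<close> into an inequality between squares.\<close>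

lemma rho_UNIV_le: "rho W UNIV \<le> (\<Prod>x\<in>B. rho W (T (x, False)))"
proof -
  have "rho W UNIV \<le> rho W (T (L 0)) * rho W (- T (L 0))"
    using rho_submultiplicative[of "T (L 0)" "- T (L 0)"] by simp
  then have "(rho W UNIV)\<^sup>2 \<le> (\<Prod>x\<in>B. rho W (T (x, False)))\<^sup>2"
    using rho_cover[OF L_B[of 0]] by (metis (no_types, lifting) mult_le_mono2 order_trans power2_eq_square)
  then show ?thesis using power2_le_imp_le by blast
qed

end

section \<open>The equality case: separators and inseparable positions\<close>

text \<open>The converse of \<open>rho_UNIV_le\<close>, to be supplied by Euler characteristics. It
  leaves no slack in \<open>rho_cover\<close>, which makes each \<open>T l\<close> a
  separator.\<close>

locale tight_circle_pair = circle_pair +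
  assumes tight: "(\<Prod>x\<in>B. rho W (T (x, False))) \<le> rho W UNIV"
begin

text \<open>The separators of the matroid represented by \<open>W\<close>.\<close>

definition Sep :: "int set set" where
  "Sep = {S. \<forall>w\<in>W. res S w \<in> W}"

text \<open>The classes are the connected components of the matroid.\<close>

definition eqv :: "int \<Rightarrow> int \<Rightarrow> bool" where
  "eqv i j \<longleftrightarrow> (\<forall>S\<in>Sep. i \<in> S \<longleftrightarrow> j \<in> S)"

lemma eqv_sym: "eqv i j \<Longrightarrow> eqv j i"
  and eqv_trans: "eqv i j \<Longrightarrow> eqv j k \<Longrightarrow> eqv i k"
  by (auto simp: eqv_def)

lemma one_W: "(\<lambda>_. 1) \<in> W"
  using W_memI[of "\<lambda>_. 1" "\<lambda>_. 0"] by simp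

lemma Sep_T: assumes "fst l \<in> B" shows "T l \<in> Sep"
proof -
  have "rho W UNIV * (rho W (T l) * rho W (- T l)) \<le> rho W UNIV * rho W UNIV"
    using order_trans[OF rho_cover[OF assms] power_mono[OF tight, of 2]] by (simp add: power2_eq_square)
  then have "rho W (T l) * rho W (- T l) \<le> rho W UNIV" using rho_pos[of UNIV] by simp
  then show ?thesis using separator by (auto simp: Sep_def)
qed

lemma Sep_UNIV: "UNIV \<in> Sep"
  by (simp add: Sep_def)

lemma Sep_Int: "S \<in> Sep \<Longrightarrow> S' \<in> Sep \<Longrightarrow> S \<inter> S' \<in> Sep"
  by (auto simp: Sep_def simp flip: res_res)

lemma Sep_Compl: assumes "S \<in> Sep" shows "- S \<in> Sep"
proof -
  have "res (- S) w = w - res S w" for w by (auto simp: res_def fun_eq_iff)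
  then show ?thesis using assms W_minus by (auto simp: Sep_def)
qed

text \<open>A separator is recovered from its indicator, which lies in the finite space
  \<open>W\<close> because the constant 1 does.\<close>

lemma finite_Sep: "finite Sep"
proof (rule finite_imageD)
  show "finite ((\<lambda>S. res S (\<lambda>_. 1)) ` Sep)"
    by (rule finite_subset[OF _ finite_W]) (auto simp: Sep_def one_W)
  show "inj_on (\<lambda>S. res S (\<lambda>_. 1)) Sep"
    by (rule inj_onI) (auto simp: res_def fun_eq_iff split: if_splits; metis zero_neq_one)
qed

text \<open>Separators are closed under complement, so being equivalent to \<open>i\<close> amounts
  to lying in every separator that contains \<open>i\<close>.\<close>

lemma Sep_class: "{j. eqv i j} \<in> Sep"
proof -
  have "\<Inter>F \<in> Sep" if "finite F" "F \<subseteq> Sep" for F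
    using that by (induction F) (auto simp: Sep_UNIV Sep_Int)
  then have "\<Inter>{S \<in> Sep. i \<in> S} \<in> Sep" using finite_Sep by simp
  moreover have "{j. eqv i j} = \<Inter>{S \<in> Sep. i \<in> S}"
    using Sep_Compl by (auto simp: eqv_def)
  ultimately show ?thesis by simp
qed

text \<open>A function is moved to the far ends of the \<open>l\<close>-steps, cut down to
  \<open>S\<close> there and moved back; cutting down to \<open>T (linv l)\<close> and
  \<open>T l\<close> on the way stays in \<open>W\<close> by \<open>Sep_T\<close>.\<close>

lemma Sep_transport:
  assumes "S \<in> Sep" "fst l \<in> B"
  shows "{i \<in> T l. move l i \<in> S} \<in> Sep"
proof -
  have "res {i \<in> T l. move l i \<in> S} w \<in> W" if w: "w \<in> W" for w
  proof -
    obtain w1 where w1: "w1 \<in> W" "\<And>i. i \<in> T (linv l) \<Longrightarrow> w1 i = w (move (linv l) i)"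
      using transport[OF w] by blast
    have "res S (res (T (linv l)) w1) \<in> W"
      using Sep_T[of "linv l"] w1(1) assms by (auto simp: Sep_def)
    then obtain w2 where w2: "w2 \<in> W" "\<And>i. i \<in> T l \<Longrightarrow> w2 i = res S (res (T (linv l)) w1) (move l i)"
      using transport by blast
    have "res {i \<in> T l. move l i \<in> S} w = res (T l) w2"
    proof
      fix i show "res {i \<in> T l. move l i \<in> S} w i = res (T l) w2 i"
        using w2(2)[of i] w1(2)[of "move l i"] move_T[of i l] move_move[of i l] by (simp add: res_def)
    qed
    then show ?thesis using Sep_T[OF assms(2)] w2(1) by (simp add: Sep_def)
  qed
  then show ?thesis by (simp add: Sep_def)
qed

lemma eqv_move:
  assumes "eqv i j" "i \<in> T l" "fst l \<in> B"
  shows "j \<in> T l" "eqv (move l i) (move l j)"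
proof -
  show j: "j \<in> T l" using assms Sep_T by (auto simp: eqv_def)
  show "eqv (move l i) (move l j)"
    using assms(1,2) j Sep_transport[OF _ assms(3)] by (fastforce simp: eqv_def)
qed

lemma eqv_periodic: "len dvd j - i \<Longrightarrow> eqv i j"
proof -
  assume d: "len dvd j - i"
  have "i \<in> S \<longleftrightarrow> j \<in> S" if S: "S \<in> Sep" for S
  proof -
    have w: "res S (\<lambda>_. 1) \<in> W" using S one_W by (auto simp: Sep_def)
    show ?thesis
      using periodic_cong[of "res S (\<lambda>_. 1)" len j i, OF W_per[OF w] d] by (auto simp: res_def split: if_splits)
  qed
  then show ?thesis by (simp add: eqv_def)
qed

text \<open>The positions move on together, and the next letter at \<open>i + 1\<close> must be one
  of the two directions available at \<open>j + 1\<close>. The one leading back is excluded by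
  reducedness.\<close>

lemma eqv_same:
  assumes "eqv i j" "L j = L i"
  shows "L (j + 1) = L (i + 1) \<and> eqv (i + 1) (j + 1)"
proof -
  have e: "eqv (i + 1) (j + 1)"
    using eqv_move(2)[OF assms(1) T_forward[of i] L_B] assms(2) by (simp add: move_def)
  have "j + 1 \<in> T (L (i + 1))" using eqv_move(1)[OF e T_forward L_B] .
  then have "L (i + 1) = L (j + 1) \<or> L (i + 1) = linv (L j)" by (simp add: T_iff)
  then show ?thesis using e assms(2) red[of i] by auto
qed

text \<open>The mirror image of \<open>eqv_same\<close>: the second position runs around the circle
  backwards.\<close>

lemma eqv_opposite:
  assumes "eqv i j" "L (j - 1) = linv (L i)"
  shows "L (j - 1 - 1) = linv (L (i + 1)) \<and> eqv (i + 1) (j - 1)"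
proof -
  have "L j \<noteq> L i" using red'[of j] assms(2) by simp
  then have e: "eqv (i + 1) (j - 1)"
    using eqv_move(2)[OF assms(1) T_forward[of i] L_B] by (simp add: move_def)
  have "j - 1 \<in> T (L (i + 1))" using eqv_move(1)[OF e T_forward L_B] .
  then have "L (i + 1) = L (j - 1) \<or> L (i + 1) = linv (L (j - 1 - 1))" by (simp add: T_iff)
  then show ?thesis using e assms(2) red[of i] by auto
qed

text \<open>Otherwise walk forwards from \<open>i\<close> and backwards from a translate of
  \<open>j\<close> beyond it. If the walks meet at a position, a letter is followed by its inverse;
  if they meet inside a step, a letter is its own inverse.\<close>

lemma eqv_not_opposite:
  assumes "eqv i j" shows "L (j - 1) \<noteq> linv (L i)"
proof
  assume opp: "L (j - 1) = linv (L i)"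
  \<comment> \<open>A multiple of \<open>len\<close> that puts \<open>j + M\<close> to the right of
    \<open>i\<close>.\<close>
  define M where "M = len * (\<bar>i - j\<bar> + 1)"
  define j' where "j' = j + M"
  have "\<bar>i - j\<bar> + 1 \<le> M" using mult_right_mono[of 1 len "\<bar>i - j\<bar> + 1"] len by (simp add: M_def)
  then have ij: "i < j'" unfolding j'_def by linarith
  have d: "len dvd j' - j" "len dvd (j' - 1) - (j - 1)" by (simp_all add: j'_def M_def)
  have "eqv i j'" using eqv_trans[OF assms eqv_periodic[OF d(1)]] .
  moreover have "L (j' - 1) = linv (L i)" using periodic_cong[of L, OF L_per d(2)] opp by simp
  ultimately have k: "L (j' - int k - 1) = linv (L (i + int k)) \<and> eqv (i + int k) (j' - int k)" for k
  proof (induction k)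
    case (Suc k)
    show ?case using eqv_opposite[of "i + int k" "j' - int k"] Suc.IH[OF Suc.prems] by (simp add: algebra_simps)
  qed simp
  show False
  proof (cases "even (j' - i)")
    case True
    then obtain k where k': "j' - i = 2 * k" by (rule evenE)
    have "j' - int (nat k) - 1 = i + int (nat k) - 1" using k' ij by simp
    then show False using k[of "nat k"] red'[of "i + int (nat k)"] by (metis linv_linv)
  next
    case False
    then obtain k where k': "j' - i = 2 * k + 1" by (rule oddE)
    have "j' - int (nat k) - 1 = i + int (nat k)" using k' ij by simp
    then show False using k[of "nat k"] by (metis linv_neq(1))
  qed
qed

lemma eqv_letters:
  assumes "eqv i j" shows "L (j + int k) = L (i + int k) \<and> eqv (i + int k) (j + int k)"
proof (induction k)
  case 0
  have "j \<in> T (L i)" using eqv_move(1)[OF assms T_forward L_B] .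
  then show ?case using eqv_not_opposite[OF assms] assms by (auto simp: T_iff)
next
  case (Suc k)
  then show ?case using eqv_same[of "i + int k" "j + int k"] by (simp add: algebra_simps)
qed

text \<open>The form in which the absence of roots of \<open>t\<close> is used;
  \<open>pos_no_subperiod\<close> provides it.\<close>

definition no_subperiod :: "(int \<Rightarrow> 'z) \<Rightarrow> bool" where
  "no_subperiod f \<longleftrightarrow> (\<forall>i j. i < j \<longrightarrow> (\<forall>k. L (j + int k) = L (i + int k)) \<longrightarrow> f i = f j \<longrightarrow> len dvd j - i)"

text \<open>The edges at the vertex \<open>f i\<close> form a cut, and so does the part of it in the
  class of \<open>i\<close>. By \<open>eqv_letters\<close> and \<open>no_subperiod\<close> only the
  translates of \<open>i\<close> remain: a single edge that is a cut, hence a bridge.\<close>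

lemma delta_W_aux:
  assumes f: "no_subperiod f" "\<And>i. f (i + len) = f i" "(\<lambda>j. if f j = f i then 1 else 0) \<in> W"
  shows "(\<lambda>j. if len dvd j - i then 1 else 0) \<in> W"
proof -
  have 1: "len dvd j - i" if "eqv i j" "f j = f i" for j
  proof (cases i j rule: linorder_cases)
    case less then show ?thesis using f(1) that eqv_letters[OF that(1)] by (auto simp: no_subperiod_def)
  next
    case greater
    then have "len dvd i - j" using f(1) that eqv_letters[OF eqv_sym[OF that(1)]] by (auto simp: no_subperiod_def)
    then show ?thesis by (simp add: dvd_diff_commute)
  qed simp
  have 2: "f j = f i" if "len dvd j - i" for j using periodic_cong[of f, OF f(2) that] .
  have "(if len dvd j - i then 1 else 0) = res {j. eqv i j} (\<lambda>j. if f j = f i then 1 else 0) j" for j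
    using 1[of j] 2[of j] eqv_periodic[of j i] by (auto simp: res_def)
  then have "(\<lambda>j. if len dvd j - i then 1 else 0) = res {j. eqv i j} (\<lambda>j. if f j = f i then 1 else 0)"
    by blast
  then show ?thesis using Sep_class[of i] f(3) by (simp add: Sep_def)
qed

lemma delta_W:
  assumes "no_subperiod a \<or> no_subperiod b"
  shows "(\<lambda>j. if len dvd j - i then 1 else 0) \<in> W"
  using assms
proof
  assume "no_subperiod a"
  moreover have "(\<lambda>j. if a j = a i then 1 else 0) \<in> W"
    using W_memI[of "\<lambda>v. if v = a i then 1 else 0" "\<lambda>_. 0"] by (simp only: add_0_right)
  ultimately show ?thesis by (intro delta_W_aux[of a] a_per)
next
  assume "no_subperiod b"
  moreover have "(\<lambda>j. if b j = b i then 1 else 0) \<in> W"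
    using W_memI[of "\<lambda>_. 0" "\<lambda>v. if v = b i then 1 else 0"] by (simp only: add_0_left)
  ultimately show ?thesis by (intro delta_W_aux[of b] b_per)
qed

text \<open>A sum of bridges. Since every set of edges is a cut, the bipartite graph is a
  forest.\<close>

lemma indicator_W:
  assumes "no_subperiod a \<or> no_subperiod b" "K \<subseteq> {0..<len}"
  shows "(\<lambda>j. if j mod len \<in> K then 1 else 0) \<in> W"
proof -
  have "finite K" using assms(2) finite_subset by blast
  then show ?thesis using assms(2)
  proof (induction K)
    case empty then show ?case using W_zero by (simp add: zero_fun_def)
  next
    case (insert k K)
    have "len dvd j - k \<longleftrightarrow> j mod len = k" for j
      using insert.prems by (simp add: mod_eq_dvd_iff[symmetric])
    then have "(\<lambda>j. if j mod len \<in> insert k K then 1 else 0 :: bit) =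
      (\<lambda>j. if j mod len \<in> K then 1 else 0) - (\<lambda>j. if len dvd j - k then 1 else 0)"
      using insert(2) by (auto simp: fun_eq_iff)
    then show ?case using insert W_minus delta_W[OF assms(1), of k] by simp
  qed
qed

text \<open>Without a leaf every vertex has degree at least two, so each side has at most half as
  many vertices as there are edges. But all \<open>2^|S|\<close> sets of edges are cuts, and there
  are too few sets of vertices to define them once one vertex is normalised away.\<close>

lemma leaf_exists:
  assumes "no_subperiod a \<or> no_subperiod b" and S: "S \<subseteq> {0..<len}" "S \<noteq> {}"
  shows "\<exists>i\<in>S. (\<forall>j\<in>S. a j = a i \<longrightarrow> j = i) \<or> (\<forall>j\<in>S. b j = b i \<longrightarrow> j = i)"
proof (rule ccontr)
  assume neg: "\<not> ?thesis"
  have finS: "finite S" using S(1) finite_subset by blast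
  obtain i0 where i0: "i0 \<in> S" using S(2) by blast
  have half: "2 * card (f ` S) \<le> card S" if "\<And>i. i \<in> S \<Longrightarrow> \<exists>j\<in>S. f j = f i \<and> j \<noteq> i" for f :: "int \<Rightarrow> 'z"
  proof -
    have "card {i \<in> S. f i = y} \<ge> 2" if "y \<in> f ` S" for y
    proof -
      obtain i where i: "i \<in> S" "f i = y" using \<open>y \<in> f ` S\<close> by blast
      then obtain j where j: "j \<in> S" "f j = f i" "j \<noteq> i" using \<open>\<And>i. i \<in> S \<Longrightarrow> _ i\<close> by blast
      have "card {i, j} \<le> card {i \<in> S. f i = y}" using i j finS by (intro card_mono) auto
      then show ?thesis using j(3) by simp
    qed
    then have "(\<Sum>y\<in>f ` S. 2) \<le> (\<Sum>y\<in>f ` S. card {i \<in> S. f i = y})" by (intro sum_mono)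
    then show ?thesis using sum.image_gen[OF finS, of "\<lambda>_. 1::nat" f] by simp
  qed
  have ha: "2 * card (a ` S) \<le> card S" using neg by (intro half) blast
  have hb: "2 * card (b ` S) \<le> card S" using neg by (intro half) blast
  \<comment> \<open>Complementing both vertex sets does not change the cut, so \<open>b i0\<close>
    can be kept out of the second one.\<close>
  define dom where "dom = Pow (a ` S) \<times> Pow (b ` S - {b i0})"
  define F where "F = (\<lambda>(P, Q). {i \<in> S. (a i \<in> P) \<noteq> (b i \<in> Q)})"
  have "Pow S \<subseteq> F ` dom"
  proof
    fix K assume "K \<in> Pow S"
    then have K: "K \<subseteq> S" by simp
    obtain p q where pq: "(\<lambda>j. if j mod len \<in> K then 1 else 0 :: bit) = (\<lambda>i. p (a i) + q (b i))"
      using W_memE[OF indicator_W[OF assms(1) order_trans[OF K S(1)]]] by blast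
    have pqK: "p (a i) + q (b i) = (if i \<in> K then 1 else 0)" if "i \<in> S" for i
    proof -
      have "i mod len = i" using that S(1) by auto
      then show ?thesis using fun_cong[OF pq, of i] by simp
    qed
    define P where "P = {v \<in> a ` S. p v + q (b i0) = 1}"
    define Q where "Q = {v \<in> b ` S. q v + q (b i0) = 1}"
    have "(P, Q) \<in> dom" by (auto simp: dom_def P_def Q_def)
    moreover have "i \<in> K \<longleftrightarrow> (a i \<in> P) \<noteq> (b i \<in> Q)" if "i \<in> S" for i
      using pqK[OF that] that
      by (cases "p (a i)"; cases "q (b i)"; cases "q (b i0)") (auto simp: P_def Q_def split: if_splits)
    then have "F (P, Q) = K" using K by (auto simp: F_def)
    ultimately show "K \<in> F ` dom" by (metis image_eqI)
  qed
  then have "card (Pow S) \<le> card dom"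
    using finS by (intro surj_card_le) (auto simp: dom_def)
  then have "2 ^ card S \<le> (2::nat) ^ (card (a ` S) + (card (b ` S) - 1))"
    using finS i0 by (simp add: dom_def card_cartesian_product card_Pow power_add)
  then have "card S \<le> card (a ` S) + (card (b ` S) - 1)" by simp
  moreover have "card (b ` S) > 0" using finS i0 by (auto simp: card_gt_0_iff)
  ultimately show False using ha hb by linarith
qed

text \<open>The end of the \<open>k\<close>-th step at which the underlying positively oriented edge starts.\<close>

definition tail :: "int \<Rightarrow> int" where
  "tail k = (if snd (L k) then k + 1 else k)"

text \<open>Within the forest, the positions in \<open>T l\<close> are the starting points of the
  edges with one label. A leaf among them is a vertex from which the edge with this label is crossed
  only once.\<close>

lemma simple_edge:
  assumes "no_subperiod a \<or> no_subperiod b"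
  shows "\<exists>k\<in>{0..<len}.
    (\<forall>k'\<in>{0..<len}. fst (L k') = fst (L k) \<longrightarrow> a (tail k') = a (tail k) \<longrightarrow> k' = k) \<or>
    (\<forall>k'\<in>{0..<len}. fst (L k') = fst (L k) \<longrightarrow> b (tail k') = b (tail k) \<longrightarrow> k' = k)"
proof -
  \<comment> \<open>Positive orientation makes \<open>T l\<close> the set of tails of the steps with
    this label; taking the generator of \<open>L 0\<close> keeps it nonempty.\<close>
  define l where "l = (fst (L 0), False)"
  define S where "S = T l \<inter> {0..<len}"
  have T_per: "i mod len \<in> T l \<longleftrightarrow> i \<in> T l" for i
  proof -
    have "L (i mod len) = L i" by (rule periodic_mod[of L len i, OF L_per])
    moreover have "L (i mod len - 1) = L (i - 1)"
      by (rule periodic_cong[of L len, OF L_per]) (simp add: minus_mod_eq_mult_div[symmetric] dvd_minus_mod mod_eq_dvd_iff[symmetric])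
    ultimately show ?thesis by (simp add: T_iff)
  qed
  have tailT: "tail k \<in> T l" if "fst (L k) = fst l" for k
    using that by (cases "L k") (auto simp: tail_def T_iff l_def linv_def)
  have tailS: "tail k mod len \<in> S" if "fst (L k) = fst l" for k
    using tailT[OF that] T_per len by (simp add: S_def)
  have "S \<subseteq> {0..<len}" "S \<noteq> {}" using tailS[of 0] by (auto simp: S_def l_def)
  then obtain i where i: "i \<in> S" "(\<forall>j\<in>S. a j = a i \<longrightarrow> j = i) \<or> (\<forall>j\<in>S. b j = b i \<longrightarrow> j = i)"
    using leaf_exists[OF assms, of S] by blast
  define k0 where "k0 = (if L i = l then i else i - 1)"
  define k where "k = k0 mod len"
  have Lk0: "fst (L k0) = fst l" "tail k0 = i"
    using i(1) by (auto simp: S_def T_iff k0_def tail_def l_def linv_def)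
  have k: "k \<in> {0..<len}" "L k = L k0" using len periodic_mod[of L, OF L_per] by (auto simp: k_def)
  have imod: "i mod len = i" using i(1) by (simp add: S_def)
  have dk: "len dvd k - k0" by (simp add: k_def mod_eq_dvd_iff[symmetric])
  then have dt: "len dvd tail k - i" using k(2) Lk0(2) by (auto simp: tail_def)
  have main: "k' = k"
    if f: "\<And>i. f (i + len) = f i" "\<forall>j\<in>S. f j = f i \<longrightarrow> j = i"
      and k': "k' \<in> {0..<len}" "fst (L k') = fst (L k)" "f (tail k') = f (tail k)" for f :: "int \<Rightarrow> 'z" and k'
  proof -
    have "f (tail k' mod len) = f i"
      using k'(3) periodic_mod[of f, OF f(1)] periodic_cong[of f, OF f(1) dt] by simp
    then have "tail k' mod len = i" using f(2) tailS[of k'] k'(2) k(2) Lk0(1) by auto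
    then have "len dvd tail k' - i" using imod by (metis mod_eq_dvd_iff)
    then have d: "len dvd tail k' - tail k" using dt by (metis dvd_diff diff_diff_eq2 diff_add_cancel)
    \<comment> \<open>Equal tails still allow one step to arrive where the other departs; then a
      letter would be followed by its inverse.\<close>
    have "snd (L k') = snd (L k)"
    proof (rule ccontr)
      assume ne: "snd (L k') \<noteq> snd (L k)"
      then have inv: "L k' = linv (L k)" "L k = linv (L k')" using k'(2) by (auto simp: eq_linv_iff)
      consider "tail k' = k' + 1" "tail k = k" | "tail k' = k'" "tail k = k + 1"
        using ne by (auto simp: tail_def)
      then show False
      proof cases
        case 1
        then have "L (k' + 1) = L k" using periodic_cong[of L, OF L_per d] by simp
        then show False using red[of k'] inv(2) by simp
      next
        case 2
        then have "L k' = L (k + 1)" using periodic_cong[of L, OF L_per d] by simp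
        then show False using red[of k] inv(1) by simp
      qed
    qed
    then have "len dvd k' - k" using d by (auto simp: tail_def split: if_splits)
    then have "k' mod len = k mod len" by (simp add: mod_eq_dvd_iff)
    then show "k' = k" using k'(1) k(1) by simp
  qed
  show ?thesis using i(2) main[of a, OF a_per] main[of b, OF b_per] k(1) by blast
qed

end

section \<open>An Euler characteristic estimate\<close>

declare add_bit_eq_xor [simp del]

definition supp_in :: "'v set \<Rightarrow> ('v \<Rightarrow> bit) set" where
  "supp_in D = {p. \<forall>v. v \<notin> D \<longrightarrow> p v = 0}"

lemma card_supp_in:
  assumes "finite D" shows "card (supp_in D) = 2 ^ card D" "finite (supp_in D)"
proof -
  have b: "bij_betw (\<lambda>P v. if v \<in> P then 1 else 0) (Pow D) (supp_in D)"
    by (rule bij_betw_byWitness[where f' = "\<lambda>p. {v. p v = 1}"])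
      (auto simp: supp_in_def fun_eq_iff)
  then show "card (supp_in D) = 2 ^ card D"
    using bij_betw_same_card[OF b] assms by (simp add: card_Pow)
  show "finite (supp_in D)" using bij_betw_finite[OF b] assms by simp
qed

lemma supp_in_minus: "p \<in> supp_in D \<Longrightarrow> q \<in> supp_in D \<Longrightarrow> p - q \<in> supp_in D"
  by (auto simp: supp_in_def)

text \<open>Glue the graphs along the circle: \<open>Z\<close> and \<open>Z'\<close> are the
  functions on glued vertices and glued edges, and the images of \<open>\<theta>\<close> and
  \<open>\<theta>'\<close> measure what is identified. \<open>rigid\<close>, \<open>connA\<close>
  and \<open>connB\<close> bound the mod 2 first Betti number of the glued graph below by
  \<open>card B\<close>, which is \<open>eZ\<close>.\<close>

lemma rank_count:
  fixes a :: "'i \<Rightarrow> 'v" and b :: "'i \<Rightarrow> 'u" and na :: "'v \<Rightarrow> 'x \<Rightarrow> 'v" and nb :: "'u \<Rightarrow> 'x \<Rightarrow> 'u"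
  assumes fin: "finite DA" "finite DB" "finite EA" "finite EB" "finite B"
    and EA: "\<And>v x. (v, x) \<in> EA \<Longrightarrow> v \<in> DA \<and> na v x \<in> DA"
    and EB: "\<And>v x. (v, x) \<in> EB \<Longrightarrow> v \<in> DB \<and> nb v x \<in> DB"
    and ran: "range a \<subseteq> DA" "range b \<subseteq> DB"
    and T: "\<And>i x. x \<in> B \<Longrightarrow> i \<in> T x \<Longrightarrow> (a i, x) \<in> EA \<and> (b i, x) \<in> EB"
    and T_step: "\<And>i x. x \<in> B \<Longrightarrow> i \<in> T x \<Longrightarrow> \<exists>j. a j = na (a i) x \<and> b j = nb (b i) x"
    and connA: "\<And>p :: 'v \<Rightarrow> bit. (\<And>v x. (v, x) \<in> EA \<Longrightarrow> p (na v x) = p v) \<Longrightarrow> \<exists>k. \<forall>v\<in>DA. p v = k"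
    and connB: "\<And>p :: 'u \<Rightarrow> bit. (\<And>v x. (v, x) \<in> EB \<Longrightarrow> p (nb v x) = p v) \<Longrightarrow> \<exists>k. \<forall>v\<in>DB. p v = k"
    and rigid: "\<And>\<phi> p q. (\<And>v x. (v, x) \<in> EA \<Longrightarrow> p (na v x) = p v + \<phi> x) \<Longrightarrow>
        (\<And>v x. (v, x) \<in> EB \<Longrightarrow> q (nb v x) = q v + \<phi> x) \<Longrightarrow> \<forall>x\<in>B. \<phi> x = (0::bit)"
    and W: "W = {\<lambda>i. p (a i) + q (b i) | p q. True}"
  shows "(\<Prod>x\<in>B. rho W (T x)) * 2 ^ (card B + card DA + card DB) \<le> rho W UNIV * 2 ^ (card EA + card EB + 1)"
proof -
  define M where "M = supp_in DA \<times> supp_in DB"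
  define \<theta> where "\<theta> u = (\<lambda>i. fst u (a i) + snd u (b i))" for u :: "('v \<Rightarrow> bit) \<times> ('u \<Rightarrow> bit)"
  define Z where "Z = {u \<in> M. \<theta> u = 0}"
  define N where "N = supp_in EA \<times> supp_in EB"
  define \<theta>' where "\<theta>' u = (\<lambda>(i, x). if x \<in> B \<and> i \<in> T x then fst u (a i, x) + snd u (b i, x) else 0)"
    for u :: "('v \<times> 'x \<Rightarrow> bit) \<times> ('u \<times> 'x \<Rightarrow> bit)"
  define Z' where "Z' = {u \<in> N. \<theta>' u = 0}"
  have finM: "finite M" and finN: "finite N" and cM: "card M = 2 ^ (card DA + card DB)"
    and cN: "card N = 2 ^ (card EA + card EB)"
    using fin by (simp_all add: M_def N_def card_supp_in card_cartesian_product power_add)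
  have "\<theta> ` M = W"
  proof (intro equalityI subsetI)
    fix w assume "w \<in> W"
    then obtain p q where w: "w = (\<lambda>i. p (a i) + q (b i))" unfolding W by blast
    define u where "u = (res DA p, res DB q)"
    have "u \<in> M" by (auto simp: u_def M_def supp_in_def res_def)
    moreover have "a i \<in> DA" "b i \<in> DB" for i using ran by auto
    then have "w = \<theta> u" by (simp add: w \<theta>_def u_def res_def)
    ultimately show "w \<in> \<theta> ` M" by blast
  qed (auto simp: W \<theta>_def)
  moreover have "card M = card (\<theta> ` M) * card {u \<in> M. \<theta> u = 0}"
  proof (rule card_additive_image[OF finM])
    show "u - v \<in> M" if "u \<in> M" "v \<in> M" for u v
      using that by (auto simp: M_def mem_Times_iff intro: supp_in_minus)
    show "\<theta> (u - v) = \<theta> u - \<theta> v" for u v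
      by (simp add: \<theta>_def fun_eq_iff add_ac)
  qed
  ultimately have eM: "2 ^ (card DA + card DB) = rho W UNIV * card Z"
    by (simp add: cM Z_def rho_def)
  have "card N = card (\<theta>' ` N) * card {u \<in> N. \<theta>' u = 0}"
  proof (rule card_additive_image[OF finN])
    show "u - v \<in> N" if "u \<in> N" "v \<in> N" for u v
      using that by (auto simp: N_def mem_Times_iff intro: supp_in_minus)
    show "\<theta>' (u - v) = \<theta>' u - \<theta>' v" for u v
      by (simp add: \<theta>'_def fun_eq_iff add_ac)
  qed
  then have eN: "2 ^ (card EA + card EB) = card (\<theta>' ` N) * card Z'"
    by (simp add: cN Z'_def)
  \<comment> \<open>Edges with different labels are independent, so a restriction of a cut function
    can be prescribed for each label separately.\<close>
  have rk: "(\<Prod>x\<in>B. rho W (T x)) \<le> card (\<theta>' ` N)"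
  proof -
    define J where "J F = (\<lambda>(i, x). if x \<in> B then F x i else 0)" for F :: "'x \<Rightarrow> 'i \<Rightarrow> bit"
    define P where "P = (PiE B (\<lambda>x. res (T x) ` W))"
    have inj: "inj_on J P"
    proof (rule inj_onI)
      fix F F' assume F: "F \<in> P" "F' \<in> P" and e: "J F = J F'"
      have "F x i = F' x i" if "x \<in> B" for x i using fun_cong[OF e, of "(i, x)"] that by (simp add: J_def)
      then have "F x = F' x" if "x \<in> B" for x using that by blast
      then show "F = F'" using PiE_ext F unfolding P_def by blast
    qed
    have sub: "J ` P \<subseteq> \<theta>' ` N"
    proof
      fix y assume "y \<in> J ` P"
      then obtain F where F: "F \<in> P" "y = J F" by blast
      have "\<exists>p q. F x = res (T x) (\<lambda>i. p (a i) + q (b i))" if x: "x \<in> B" for x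
      proof -
        have "F x \<in> res (T x) ` W" using F(1) x unfolding P_def by (rule PiE_mem)
        then show ?thesis unfolding W by blast
      qed
      then obtain p q where pq: "\<And>x. x \<in> B \<Longrightarrow> F x = res (T x) (\<lambda>i. p x (a i) + q x (b i))" by metis
      define u where "u = (res EA (\<lambda>(v, x). p x v), res EB (\<lambda>(v, x). q x v))"
      have "u \<in> N" by (auto simp: u_def N_def supp_in_def res_def)
      moreover have "y (i, x) = \<theta>' u (i, x)" for i x
        using T[of x i] pq[of x] by (auto simp: F(2) J_def \<theta>'_def u_def res_def)
      then have "y = \<theta>' u" by (simp add: fun_eq_iff)
      ultimately show "y \<in> \<theta>' ` N" by blast
    qed
    have "card P = (\<Prod>x\<in>B. rho W (T x))" using fin(5) by (simp add: P_def card_PiE rho_def)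
    then show ?thesis using card_mono[OF _ sub] finN card_image[OF inj] by simp
  qed
  have eZ: "2 ^ card B * card Z \<le> card Z' * 2"
  proof -
    define U where "U = supp_in B \<times> Z"
    \<comment> \<open>The coboundary of a vertex function plus a function lifted from the rose. In
      its kernel \<open>rigid\<close> kills the latter and connectedness leaves only constants,
      whence the factor 2.\<close>
    define \<Phi> where "\<Phi> u = (res EA (\<lambda>(v, x). fst (snd u) (na v x) + fst (snd u) v + fst u x),
        res EB (\<lambda>(v, x). snd (snd u) (nb v x) + snd (snd u) v + fst u x))"
      for u :: "('x \<Rightarrow> bit) \<times> ('v \<Rightarrow> bit) \<times> ('u \<Rightarrow> bit)"
    have finZ: "finite Z" using finM by (simp add: Z_def)
    have finU: "finite U" and cU: "card U = 2 ^ card B * card Z"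
      using fin finZ by (simp_all add: U_def card_supp_in card_cartesian_product)
    have "card U = card (\<Phi> ` U) * card {u \<in> U. \<Phi> u = 0}"
    proof (rule card_additive_image[OF finU])
      show "u - v \<in> U" if "u \<in> U" "v \<in> U" for u v
        using that by (auto simp: U_def Z_def M_def mem_Times_iff \<theta>_def fun_eq_iff intro: supp_in_minus)
      show "\<Phi> (u - v) = \<Phi> u - \<Phi> v" for u v
        by (simp add: \<Phi>_def prod_eq_iff fun_eq_iff res_def add_ac)
    qed
    also have "\<dots> \<le> card Z' * 2"
    proof (rule mult_le_mono)
      have "\<Phi> ` U \<subseteq> Z'"
      proof (rule image_subsetI)
        fix u assume "u \<in> U"
        moreover obtain \<phi> p q where u_eq: "u = (\<phi>, p, q)" by (cases u) auto
        ultimately have "\<theta> (p, q) = 0" by (simp add: U_def Z_def)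
        then have pq: "p (a i) = q (b i)" for i
          by (auto simp: \<theta>_def dest: fun_cong[of _ _ i])
        have "\<Phi> (\<phi>, p, q) \<in> N" by (auto simp: \<Phi>_def N_def supp_in_def res_def)
        moreover have "\<theta>' (\<Phi> (\<phi>, p, q)) (i, x) = 0" for i x
        proof (cases "x \<in> B \<and> i \<in> T x")
          case True
          then obtain j where "a j = na (a i) x" "b j = nb (b i) x" using T_step by blast
          then have "p (na (a i) x) = q (nb (b i) x)" using pq[of j] by simp
          then show ?thesis using True T[of x i] pq[of i] by (simp add: \<theta>'_def \<Phi>_def res_def)
        qed (auto simp: \<theta>'_def)
        then have "\<theta>' (\<Phi> (\<phi>, p, q)) = 0" by (simp add: fun_eq_iff)
        ultimately show "\<Phi> u \<in> Z'" by (simp add: Z'_def u_eq)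
      qed
      moreover have "finite Z'" using finN by (simp add: Z'_def)
      ultimately show "card (\<Phi> ` U) \<le> card Z'" by (rule card_mono[rotated])
      have "{u \<in> U. \<Phi> u = 0} \<subseteq> {(0, 0, 0), (0, res DA (\<lambda>_. 1), res DB (\<lambda>_. 1))}"
      proof
        fix u assume u: "u \<in> {u \<in> U. \<Phi> u = 0}"
        obtain \<phi> p q where u_eq: "u = (\<phi>, p, q)" by (cases u) auto
        have \<Phi>0: "fst (\<Phi> u) = 0" "snd (\<Phi> u) = 0" using u by simp_all
        have A: "p (na v x) + p v + \<phi> x = 0" if "(v, x) \<in> EA" for v x
          using fun_cong[OF \<Phi>0(1), of "(v, x)"] that by (simp add: u_eq \<Phi>_def res_def)
        have A': "q (nb v x) + q v + \<phi> x = 0" if "(v, x) \<in> EB" for v x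
          using fun_cong[OF \<Phi>0(2), of "(v, x)"] that by (simp add: u_eq \<Phi>_def res_def)
        have \<phi>0: "\<forall>x\<in>B. \<phi> x = 0"
        proof (rule rigid[where p = p and q = q and \<phi> = \<phi>])
          show "p (na v x) = p v + \<phi> x" if "(v, x) \<in> EA" for v x
            using A[OF that] by (cases "p (na v x)"; cases "p v"; cases "\<phi> x") auto
          show "q (nb v x) = q v + \<phi> x" if "(v, x) \<in> EB" for v x
            using A'[OF that] by (cases "q (nb v x)"; cases "q v"; cases "\<phi> x") auto
        qed
        then have \<phi>: "\<phi> = 0" using u by (auto simp: u_eq U_def supp_in_def fun_eq_iff)
        obtain k where k: "\<forall>v\<in>DA. p v = k" using connA[of p] A by (auto simp: \<phi>)
        obtain k' where k': "\<forall>v\<in>DB. q v = k'" using connB[of q] A' by (auto simp: \<phi>)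
        have "\<theta> (p, q) = 0" using u by (simp add: u_eq U_def Z_def)
        \<comment> \<open>\<open>undefined\<close> is just some position on the circle; there the
          two constants have to agree.\<close>
        then have "p (a undefined) = q (b undefined)"
          by (auto simp: \<theta>_def dest: fun_cong[of _ _ undefined])
        moreover have "p (a undefined) = k" "q (b undefined) = k'" using k k' ran by blast+
        ultimately have "k = k'" by simp
        have "p = res DA (\<lambda>_. k)" "q = res DB (\<lambda>_. k)"
          using u k k' \<open>k = k'\<close> by (auto simp: u_eq U_def Z_def M_def supp_in_def res_def fun_eq_iff)
        moreover have "res DA (\<lambda>_. 0) = 0" "res DB (\<lambda>_. 0) = 0" by (auto simp: res_def fun_eq_iff)
        ultimately show "u \<in> {(0, 0, 0), (0, res DA (\<lambda>_. 1), res DB (\<lambda>_. 1))}"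
          by (cases k) (auto simp: u_eq \<phi>)
      qed
      then have "card {u \<in> U. \<Phi> u = 0} \<le> card {(0 :: 'x \<Rightarrow> bit, 0 :: 'v \<Rightarrow> bit, 0 :: 'u \<Rightarrow> bit), (0, res DA (\<lambda>_. 1), res DB (\<lambda>_. 1))}"
        by (intro card_mono) auto
      also have "\<dots> \<le> 2" by (simp add: card_insert_if)
      finally show "card {u \<in> U. \<Phi> u = 0} \<le> 2" .
    qed
    finally show ?thesis by (simp add: cU)
  qed
  let ?P = "\<Prod>x\<in>B. rho W (T x)"
  have "?P * 2 ^ (card B + card DA + card DB) = ?P * (2 ^ card B * card Z) * rho W UNIV"
    using eM by (simp add: power_add mult_ac)
  also have "\<dots> \<le> card (\<theta>' ` N) * (card Z' * 2) * rho W UNIV"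
    by (intro mult_le_mono1 mult_le_mono rk eZ)
  also have "\<dots> = rho W UNIV * 2 ^ (card EA + card EB + 1)"
    using eN by (simp add: mult_ac)
  finally show ?thesis .
qed

section \<open>Paths in coset graphs\<close>

context group
begin

text \<open>Edges of the coset graph are pairs \<open>(v, x)\<close>, leading from \<open>v\<close> to \<open>v #> x\<close>.\<close>

definition cross :: "'a set \<Rightarrow> 'a \<times> bool \<Rightarrow> 'a set \<times> 'a" where
  "cross v l = (if snd l then v #> inv (fst l) else v, fst l)"

fun path_edges :: "'a set \<Rightarrow> ('a \<times> bool) list \<Rightarrow> ('a set \<times> 'a) set" where
  "path_edges v [] = {}"
| "path_edges v (l # w) = insert (cross v l) (path_edges (v #> letter_val G l) w)"

lemma finite_path_edges: "finite (path_edges v w)"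
  by (induction w arbitrary: v) auto

lemma rcosets_act:
  assumes "subgroup K G" "v \<in> rcosets K" "g \<in> carrier G" shows "v #> g \<in> rcosets K"
proof -
  obtain h where h: "h \<in> carrier G" "v = K #> h" using assms(2) by (auto simp: RCOSETS_def)
  then have "v #> g = K #> (h \<otimes> g)"
    using assms by (simp add: coset_mult_assoc subgroup.subset)
  then show ?thesis using h assms by (simp add: rcosetsI subgroup.subset)
qed

lemma rcosets_subset: "subgroup K G \<Longrightarrow> v \<in> rcosets K \<Longrightarrow> v \<subseteq> carrier G"
  using rcosets_part_G by blast

lemma act_inv_cancel [simp]:
  assumes "v \<subseteq> carrier G" "g \<in> carrier G"
  shows "v #> g #> inv g = v" "v #> inv g #> g = v"
  using assms by (simp_all add: coset_mult_assoc)

lemma coset_subset: "v \<subseteq> carrier G \<Longrightarrow> g \<in> carrier G \<Longrightarrow> v #> g \<subseteq> carrier G"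
  by (rule r_coset_subset_G)

lemma act_letter_cancel:
  assumes "v \<subseteq> carrier G" "fst l \<in> carrier G"
  shows "v #> letter_val G l #> letter_val G (linv l) = v"
  using assms by (simp add: letter_val_linv letter_val_closed)

lemma cross_linv:
  assumes "v \<subseteq> carrier G" "fst l \<in> carrier G"
  shows "cross (v #> letter_val G l) (linv l) = cross v l"
  using assms by (auto simp: cross_def letter_val_def coset_subset)

lemma path_edges_append:
  assumes "v \<subseteq> carrier G" "fst ` set u \<subseteq> carrier G" "fst ` set w \<subseteq> carrier G"
  shows "path_edges v (u @ w) = path_edges v u \<union> path_edges (v #> word_val G u) w"
  using assms
  by (induction u arbitrary: v) (auto simp: coset_subset letter_val_closed word_val_closed coset_mult_assoc)

lemma act_mem_subgroup:
  assumes "subgroup K G" "g \<in> carrier G" shows "K #> g = K \<longleftrightarrow> g \<in> K"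
  using assms coset_join1 coset_join2 subgroup.subset by blast

text \<open>The holonomy of a path with respect to an edge labelling \<open>c\<close> in
  \<open>S\<close>.\<close>

fun hol :: "('s, 'm) monoid_scheme \<Rightarrow> ('a set \<times> 'a \<Rightarrow> 's) \<Rightarrow> 'a set \<Rightarrow> ('a \<times> bool) list \<Rightarrow> 's" where
  "hol S c v [] = \<one>\<^bsub>S\<^esub>"
| "hol S c v (l # w) =
     (if snd l then inv\<^bsub>S\<^esub> (c (cross v l)) else c (cross v l)) \<otimes>\<^bsub>S\<^esub> hol S c (v #> letter_val G l) w"

lemma hol_closed:
  assumes "group S" "range c \<subseteq> carrier S" shows "hol S c v w \<in> carrier S"
proof -
  interpret S: group S by fact
  have "c e \<in> carrier S" for e using assms(2) by auto
  then show ?thesis by (induction w arbitrary: v) auto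
qed

lemma hol_append:
  assumes "group S" "range c \<subseteq> carrier S"
    and "v \<subseteq> carrier G" "fst ` set u \<subseteq> carrier G" "fst ` set w \<subseteq> carrier G"
  shows "hol S c v (u @ w) = hol S c v u \<otimes>\<^bsub>S\<^esub> hol S c (v #> word_val G u) w"
proof -
  interpret S: group S by fact
  show ?thesis using assms(3,4)
  proof (induction u arbitrary: v)
    case Nil then show ?case by (simp add: hol_closed[OF assms(1,2)])
  next
    case (Cons l u)
    have "c (cross v l) \<in> carrier S" using assms(2) by auto
    then show ?case using Cons
      by (simp add: S.m_assoc hol_closed[OF assms(1,2)] coset_subset letter_val_closed word_val_closed coset_mult_assoc)
  qed
qed

text \<open>A cancelling pair crosses one edge back and forth, so holonomy is invariant under
  cancellation.\<close>

lemma hol_cong: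
  assumes "free_basis G B" "group S" "range c \<subseteq> carrier S" "v \<subseteq> carrier G"
    and "w \<in> words_over B" "w' \<in> words_over B" "word_val G w = word_val G w'"
  shows "hol S c v w = hol S c v w'"
proof (rule free_basis_cong[OF assms(1) _ assms(5,6,7)])
  interpret S: group S by fact
  fix u z :: "('a \<times> bool) list" and l :: "'a \<times> bool" assume ul: "u \<in> words_over B" "fst l \<in> B" "z \<in> words_over B"
  have BG: "B \<subseteq> carrier G" using assms(1) by (simp add: free_basis_def)
  then have c: "fst ` set u \<subseteq> carrier G" "fst l \<in> carrier G" "fst ` set z \<subseteq> carrier G" using ul by auto
  define v' where "v' = v #> word_val G u"
  have v': "v' \<subseteq> carrier G" using c assms(4) by (simp add: v'_def coset_subset word_val_closed)
  have cc: "c (cross v' l) \<in> carrier S" using assms(3) by auto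
  have "hol S c v' (l # linv l # z) = hol S c v' z"
    using cc c v' hol_closed[OF assms(2,3)]
    by (simp add: cross_linv act_letter_cancel flip: S.m_assoc)
  then show "hol S c v (u @ l # linv l # z) = hol S c v (u @ z)"
    using c assms(4) by (simp add: hol_append[OF assms(2,3)] v'_def)
qed

lemma hol_hom:
  assumes B: "free_basis G B" and K: "subgroup K G" and S: "group S" and c: "range c \<subseteq> carrier S"
  shows "\<exists>\<chi>\<in>hom (G\<lparr>carrier := K\<rparr>) S. \<forall>w\<in>words_over B. word_val G w \<in> K \<longrightarrow> \<chi> (word_val G w) = hol S c K w"
proof -
  interpret S: group S by fact
  have BG: "B \<subseteq> carrier G" and gen: "carrier G = word_val G ` words_over B"
    using B generate_eq_words[of B] by (auto simp: free_basis_def)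
  have KG: "K \<subseteq> carrier G" using K by (rule subgroup.subset)
  define \<chi> where "\<chi> g = hol S c K (SOME w. w \<in> words_over B \<and> word_val G w = g)" for g
  have \<chi>: "\<chi> (word_val G w) = hol S c K w" if "w \<in> words_over B" for w
  proof -
    have "\<exists>w'. w' \<in> words_over B \<and> word_val G w' = word_val G w" using that by blast
    from someI_ex[OF this] show ?thesis
      unfolding \<chi>_def using hol_cong[OF B S c KG _ that] by blast
  qed
  have "\<chi> \<in> hom (G\<lparr>carrier := K\<rparr>) S"
  proof (rule homI)
    fix g show "\<chi> g \<in> carrier S" by (simp add: \<chi>_def hol_closed[OF S c])
  next
    fix g h assume "g \<in> carrier (G\<lparr>carrier := K\<rparr>)" "h \<in> carrier (G\<lparr>carrier := K\<rparr>)"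
    then have gh: "g \<in> K" "h \<in> K" by auto
    then have "g \<in> carrier G" "h \<in> carrier G" using KG by auto
    then obtain w v where w: "w \<in> words_over B" "g = word_val G w" "v \<in> words_over B" "h = word_val G v"
      unfolding gen by blast
    have cw: "fst ` set w \<subseteq> carrier G" "fst ` set v \<subseteq> carrier G" using w BG by auto
    have "g \<otimes> h = word_val G (w @ v)" using w cw by (simp add: word_val_append)
    moreover have "w @ v \<in> words_over B" using w by auto
    ultimately have "\<chi> (g \<otimes> h) = hol S c K (w @ v)" using \<chi> by simp
    also have "\<dots> = hol S c K w \<otimes>\<^bsub>S\<^esub> hol S c (K #> g) v"
      using hol_append[OF S c KG cw] w(2) by simp
    also have "K #> g = K" using gh K KG act_mem_subgroup by blast
    finally show "\<chi> (g \<otimes>\<^bsub>G\<lparr>carrier := K\<rparr>\<^esub> h) = \<chi> g \<otimes>\<^bsub>S\<^esub> \<chi> h"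
      using \<chi> w by simp
  qed
  then show ?thesis using \<chi> by blast
qed

text \<open>The gauge transformation between \<open>r\<close> and \<open>c\<close> at the end of \<open>w\<close> is \<open>(hol r w)\<^sup>-\<^sup>1 (hol c w)\<close>.\<close>

lemma hol_gauge:
  assumes B: "free_basis G B" and K: "subgroup K G" and S: "group S"
    and c: "range c \<subseteq> carrier S" and r: "range r \<subseteq> carrier S"
    and eq: "\<And>w. w \<in> words_over B \<Longrightarrow> word_val G w \<in> K \<Longrightarrow> hol S r K w = hol S c K w"
    and w: "w \<in> words_over B" "w' \<in> words_over B" "x \<in> B" "K #> word_val G w' = K #> word_val G w #> x"
  shows "c (K #> word_val G w, x) =
    (inv\<^bsub>S\<^esub> (inv\<^bsub>S\<^esub> (hol S r K w) \<otimes>\<^bsub>S\<^esub> hol S c K w) \<otimes>\<^bsub>S\<^esub> r (K #> word_val G w, x)) \<otimes>\<^bsub>S\<^esub>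
    (inv\<^bsub>S\<^esub> (hol S r K w') \<otimes>\<^bsub>S\<^esub> hol S c K w')"
proof -
  interpret S: group S by fact
  have BG: "B \<subseteq> carrier G" using B by (simp add: free_basis_def)
  then have cw: "fst ` set w \<subseteq> carrier G" "fst ` set w' \<subseteq> carrier G" "x \<in> carrier G" using w by auto
  have KG: "K \<subseteq> carrier G" using K by (rule subgroup.subset)
  define v where "v = K #> word_val G w"
  have v: "v \<subseteq> carrier G" using KG cw by (simp add: v_def coset_subset word_val_closed)
  \<comment> \<open>The closed path out along \<open>w\<close>, across the edge and back along
    \<open>w'\<close>; its holonomy compares the two labels of the edge.\<close>
  define z where "z = w @ (x, False) # winv w'"
  have zB: "z \<in> words_over B" using w by (simp add: z_def image_Un)
  have zv: "word_val G z = word_val G w \<otimes> (x \<otimes> inv (word_val G w'))"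
    using cw by (simp add: z_def word_val_append word_val_winv letter_val_def image_Un)
  have "K #> word_val G z = (K #> word_val G w #> x) #> inv (word_val G w')"
    using KG cw by (simp add: zv coset_mult_assoc m_assoc word_val_closed)
  also have "\<dots> = K" using KG cw by (simp add: w(4)[symmetric] word_val_closed)
  finally have zK: "word_val G z \<in> K"
    using act_mem_subgroup[OF K] cw by (simp add: zv word_val_closed)
  have hz: "hol S f K z = hol S f K w \<otimes>\<^bsub>S\<^esub> (f (v, x) \<otimes>\<^bsub>S\<^esub> inv\<^bsub>S\<^esub> (hol S f K w'))"
    if f: "range f \<subseteq> carrier S" for f
  proof -
    have ww: "w' @ winv w' \<in> words_over B" using w(2) by (simp add: image_Un)
    have "hol S f K (w' @ winv w') = hol S f K []"
      using cw by (intro hol_cong[OF B S f KG ww]) (auto simp: word_val_append word_val_winv word_val_closed)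
    then have "hol S f K w' \<otimes>\<^bsub>S\<^esub> hol S f (K #> word_val G w') (winv w') = \<one>\<^bsub>S\<^esub>"
      using cw by (simp add: hol_append[OF S f KG])
    then have "hol S f (v #> x) (winv w') = inv\<^bsub>S\<^esub> (hol S f K w')"
      using S.inv_equality[of "hol S f (v #> x) (winv w')" "hol S f K w'"] hol_closed[OF S f] w(4)
        S.inv_comm by (simp add: v_def)
    then show ?thesis using cw
      by (simp add: z_def hol_append[OF S f KG] v_def cross_def letter_val_def)
  qed
  have cl: "hol S f K u \<in> carrier S" "f (v, x) \<in> carrier S" if "range f \<subseteq> carrier S" for f u
    using hol_closed[OF S that] that by auto
  note cls = cl[OF c] cl[OF r]
  have e: "hol S r K w \<otimes>\<^bsub>S\<^esub> (r (v, x) \<otimes>\<^bsub>S\<^esub> inv\<^bsub>S\<^esub> (hol S r K w')) =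
      hol S c K w \<otimes>\<^bsub>S\<^esub> (c (v, x) \<otimes>\<^bsub>S\<^esub> inv\<^bsub>S\<^esub> (hol S c K w'))"
    using eq[OF zB zK] hz[OF r] hz[OF c] by simp
  have "(inv\<^bsub>S\<^esub> (inv\<^bsub>S\<^esub> (hol S r K w) \<otimes>\<^bsub>S\<^esub> hol S c K w) \<otimes>\<^bsub>S\<^esub> r (v, x)) \<otimes>\<^bsub>S\<^esub>
      (inv\<^bsub>S\<^esub> (hol S r K w') \<otimes>\<^bsub>S\<^esub> hol S c K w') =
    inv\<^bsub>S\<^esub> (hol S c K w) \<otimes>\<^bsub>S\<^esub> (hol S r K w \<otimes>\<^bsub>S\<^esub> (r (v, x) \<otimes>\<^bsub>S\<^esub> inv\<^bsub>S\<^esub> (hol S r K w'))) \<otimes>\<^bsub>S\<^esub> hol S c K w'"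
    using cls by (simp add: S.inv_mult_group S.m_assoc)
  also have "\<dots> = c (v, x)"
  proof -
    have "inv\<^bsub>S\<^esub> (hol S c K w) \<otimes>\<^bsub>S\<^esub> (hol S c K w \<otimes>\<^bsub>S\<^esub> (c (v, x) \<otimes>\<^bsub>S\<^esub> inv\<^bsub>S\<^esub> (hol S c K w')))
      = c (v, x) \<otimes>\<^bsub>S\<^esub> inv\<^bsub>S\<^esub> (hol S c K w')"
      using cls by (simp flip: S.m_assoc)
    then show ?thesis unfolding e using cls by (simp add: S.m_assoc)
  qed
  finally show ?thesis by (simp add: v_def)
qed

text \<open>Each of the \<open>|S|^|E|\<close> labellings induces a homomorphism on
  \<open>K\<close>, recorded by its values on generators. Labellings with the same homomorphism
  differ by a gauge transformation that is trivial at the base vertex, and there are at most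
  \<open>|S|^(|D| - 1)\<close> of these.\<close>

lemma hol_count:
  fixes s :: "'i \<Rightarrow> 'a" and S :: "('s, 'm) monoid_scheme"
  assumes B: "free_basis G B" and K: "subgroup K G" and I: "finite I" "s ` I \<subseteq> K" "generate G (s ` I) = K"
    and D: "finite D" "K \<in> D" "D \<subseteq> rcosets K"
    and E: "finite E" "\<And>v x. (v, x) \<in> E \<Longrightarrow> v \<in> D \<and> x \<in> B \<and> v #> x \<in> D"
    and S: "group S" "finite (carrier S)"
  shows "card (carrier S) ^ card E \<le>
    card {\<phi> \<in> I \<rightarrow>\<^sub>E carrier S. \<exists>\<chi>\<in>hom (G\<lparr>carrier := K\<rparr>) S. \<forall>i\<in>I. \<phi> i = \<chi> (s i)} * card (carrier S) ^ (card D - 1)"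
proof -
  interpret S: group S by fact
  have BG: "B \<subseteq> carrier G" and gen: "carrier G = word_val G ` words_over B"
    using B generate_eq_words[of B] by (auto simp: free_basis_def)
  have KG: "K \<subseteq> carrier G" using K by (rule subgroup.subset)
  define C where "C = E \<rightarrow>\<^sub>E carrier S"
  \<comment> \<open>The paths may leave the finite graph; edges outside \<open>E\<close> get the
    neutral label.\<close>
  define ext where "ext c = (\<lambda>e. if e \<in> E then c e else \<one>\<^bsub>S\<^esub>)" for c :: "'a set \<times> 'a \<Rightarrow> 's"
  have ext: "range (ext c) \<subseteq> carrier S" if "c \<in> C" for c
    using that by (auto simp: ext_def C_def PiE_def Pi_def)
  have "\<exists>\<chi>\<in>hom (G\<lparr>carrier := K\<rparr>) S. \<forall>w\<in>words_over B. word_val G w \<in> K \<longrightarrow> \<chi> (word_val G w) = hol S (ext c) K w"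
    if "c \<in> C" for c
    using hol_hom[OF B K S(1) ext[OF that]] .
  then obtain \<chi> where \<chi>: "\<And>c. c \<in> C \<Longrightarrow> \<chi> c \<in> hom (G\<lparr>carrier := K\<rparr>) S"
    "\<And>c w. c \<in> C \<Longrightarrow> w \<in> words_over B \<Longrightarrow> word_val G w \<in> K \<Longrightarrow> \<chi> c (word_val G w) = hol S (ext c) K w"
    by metis
  define \<Psi> where "\<Psi> c = (\<lambda>i\<in>I. \<chi> c (s i))" for c
  define Im where "Im = {\<phi> \<in> I \<rightarrow>\<^sub>E carrier S. \<exists>\<chi>\<in>hom (G\<lparr>carrier := K\<rparr>) S. \<forall>i\<in>I. \<phi> i = \<chi> (s i)}"
  have \<Psi>Im: "\<Psi> c \<in> Im" if "c \<in> C" for c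
  proof -
    have "\<chi> c (s i) \<in> carrier S" if "i \<in> I" for i
      using hom_in_carrier[OF \<chi>(1)[OF \<open>c \<in> C\<close>]] I(2) that by auto
    then show ?thesis unfolding Im_def using \<chi>(1)[OF that] by (auto simp: \<Psi>_def intro!: bexI[of _ "\<chi> c"])
  qed
  \<comment> \<open>A reference labelling for each homomorphism, from which gauge transformations
    are measured.\<close>
  define rep where "rep y = (SOME c. c \<in> C \<and> \<Psi> c = y)" for y
  have rep: "rep (\<Psi> c) \<in> C" "\<Psi> (rep (\<Psi> c)) = \<Psi> c" if "c \<in> C" for c
    using someI_ex[of "\<lambda>c'. c' \<in> C \<and> \<Psi> c' = \<Psi> c"] that by (auto simp: rep_def)
  have eqh: "hol S (ext c) K w = hol S (ext c') K w"
    if c: "c \<in> C" "c' \<in> C" "\<Psi> c = \<Psi> c'" and w: "w \<in> words_over B" "word_val G w \<in> K" for c c' w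
  proof -
    interpret K: group "G\<lparr>carrier := K\<rparr>" using subgroup.subgroup_is_group[OF K is_group] .
    have "generate (G\<lparr>carrier := K\<rparr>) (s ` I) = K" using generate_consistent[OF I(2) K] I(3) by simp
    then have g: "word_val G w \<in> generate (G\<lparr>carrier := K\<rparr>) (s ` I)" using w by simp
    have "\<chi> c (word_val G w) = \<chi> c' (word_val G w)"
    proof (rule K.hom_eq_on_generate[OF \<chi>(1)[OF c(1)] \<chi>(1)[OF c(2)] S(1) _ _ g])
      show "s ` I \<subseteq> carrier (G\<lparr>carrier := K\<rparr>)" using I(2) by simp
      show "\<chi> c y = \<chi> c' y" if y: "y \<in> s ` I" for y
      proof -
        obtain i where i: "i \<in> I" "y = s i" using y by blast
        then show ?thesis using fun_cong[OF c(3), of i] by (simp add: \<Psi>_def)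
      qed
    qed
    then show ?thesis using \<chi>(2) c w by simp
  qed
  define wd where "wd v = (SOME w. w \<in> words_over B \<and> K #> word_val G w = v)" for v
  have wd: "wd v \<in> words_over B" "K #> word_val G (wd v) = v" if v: "v \<in> rcosets K" for v
  proof -
    obtain h where h: "h \<in> carrier G" "v = K #> h" using v by (auto simp: RCOSETS_def)
    from h(1) obtain w where "w \<in> words_over B" "h = word_val G w" unfolding gen by blast
    then have "w \<in> words_over B \<and> K #> word_val G w = v" using h(2) by simp
    from someI[of "\<lambda>w. w \<in> words_over B \<and> K #> word_val G w = v", OF this]
    show "wd v \<in> words_over B" "K #> word_val G (wd v) = v" by (simp_all add: wd_def)
  qed
  define pot where "pot c v = inv\<^bsub>S\<^esub> (hol S (ext (rep (\<Psi> c))) K (wd v)) \<otimes>\<^bsub>S\<^esub> hol S (ext c) K (wd v)" for c v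
  define R where "R c = (\<Psi> c, \<lambda>v\<in>D - {K}. pot c v)" for c
  \<comment> \<open>The word chosen for the base vertex may be nonempty, but it is a closed path,
    where the holonomies agree.\<close>
  have potK: "pot c K = \<one>\<^bsub>S\<^esub>" if "c \<in> C" for c
  proof -
    have KK: "K \<in> rcosets K" using D by blast
    have "word_val G (wd K) \<in> carrier G" using wd(1)[OF KK] BG by (intro word_val_closed) auto
    then have "word_val G (wd K) \<in> K" using wd(2)[OF KK] act_mem_subgroup[OF K] by simp
    then have "hol S (ext (rep (\<Psi> c))) K (wd K) = hol S (ext c) K (wd K)"
      using eqh[OF rep(1)[OF that] that rep(2)[OF that] wd(1)[OF KK]] by simp
    then show ?thesis using hol_closed[OF S(1) ext[OF that]] by (simp add: pot_def)
  qed
  have val: "c (v, x) = (inv\<^bsub>S\<^esub> (pot c v) \<otimes>\<^bsub>S\<^esub> ext (rep (\<Psi> c)) (v, x)) \<otimes>\<^bsub>S\<^esub> pot c (v #> x)"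
    if c: "c \<in> C" and e: "(v, x) \<in> E" for c v x
  proof -
    have v: "v \<in> rcosets K" "v #> x \<in> rcosets K" "x \<in> B" using E(2)[OF e] D(3) by auto
    have "K #> word_val G (wd (v #> x)) = K #> word_val G (wd v) #> x"
      using wd(2)[OF v(1)] wd(2)[OF v(2)] by simp
    from hol_gauge[OF B K S(1) ext[OF c] ext[OF rep(1)[OF c]]
        eqh[OF rep(1)[OF c] c rep(2)[OF c]] wd(1)[OF v(1)] wd(1)[OF v(2)] v(3) this]
    show ?thesis using e unfolding wd(2)[OF v(1)] pot_def by (simp add: ext_def)
  qed
  have inj: "inj_on R C"
  proof (rule inj_onI)
    fix c c' assume c: "c \<in> C" "c' \<in> C" and e: "R c = R c'"
    then have \<Psi>: "\<Psi> c = \<Psi> c'" and p: "(\<lambda>v\<in>D - {K}. pot c v) = (\<lambda>v\<in>D - {K}. pot c' v)"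
      by (auto simp: R_def)
    have pot: "pot c v = pot c' v" if "v \<in> D" for v
    proof (cases "v = K")
      case False
      then show ?thesis using fun_cong[OF p, of v] that by simp
    qed (simp add: potK c)
    have ce: "c (v, x) = c' (v, x)" if vx: "(v, x) \<in> E" for v x
    proof -
      have "pot c v = pot c' v" "pot c (v #> x) = pot c' (v #> x)" using E(2)[OF vx] pot by auto
      then show ?thesis unfolding val[OF c(1) vx] val[OF c(2) vx] \<Psi> by simp
    qed
    have "c y = c' y" if "y \<in> E" for y using that ce by (cases y) simp
    then show "c = c'" using PiE_ext c unfolding C_def by blast
  qed
  have finIm: "finite Im" using I(1) S(2) by (auto simp: Im_def intro: finite_subset finite_PiE)
  have "R ` C \<subseteq> Im \<times> ((D - {K}) \<rightarrow>\<^sub>E carrier S)"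
  proof (rule image_subsetI)
    fix c assume c: "c \<in> C"
    have "pot c v \<in> carrier S" for v
      using hol_closed[OF S(1) ext[OF c]] hol_closed[OF S(1) ext[OF rep(1)[OF c]]] by (simp add: pot_def)
    then show "R c \<in> Im \<times> ((D - {K}) \<rightarrow>\<^sub>E carrier S)" using \<Psi>Im[OF c] by (auto simp: R_def)
  qed
  then have "card (R ` C) \<le> card (Im \<times> ((D - {K}) \<rightarrow>\<^sub>E carrier S))"
    using finIm D(1) S(2) by (intro card_mono finite_cartesian_product finite_PiE) auto
  moreover have "card (R ` C) = card (carrier S) ^ card E"
    using card_image[OF inj] E(1) by (simp add: C_def card_PiE)
  moreover have "card (Im \<times> ((D - {K}) \<rightarrow>\<^sub>E carrier S)) = card Im * card (carrier S) ^ (card D - 1)"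
    using D(1,2) by (simp add: card_cartesian_product card_PiE)
  ultimately show ?thesis by (simp add: Im_def)
qed

end

section \<open>Finite connected subgraphs and generators from spanning trees\<close>

context group
begin

lemma inv_cancel_left:
  assumes "a \<in> carrier G" "b \<in> carrier G"
  shows "inv a \<otimes> (a \<otimes> b) = b" "a \<otimes> (inv a \<otimes> b) = b"
  using assms by (simp_all flip: m_assoc)

lemma subgroup_in_rcosets: "subgroup K G \<Longrightarrow> K \<in> rcosets K"
  using rcosetsI[of K \<one>] by (simp add: subgroup.subset)

text \<open>The edges crossed by the paths from \<open>K\<close> suffice. Connectedness is put in
  terms of vertex sets closed under edges, ready to be applied to level sets of potentials.\<close>

lemma coset_graph_exists:
  assumes K: "subgroup K G" and B: "B \<subseteq> carrier G" and Ws: "finite Ws" "Ws \<subseteq> words_over B"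
  shows "\<exists>D E. finite D \<and> K \<in> D \<and> D \<subseteq> rcosets K \<and> finite E \<and>
    (\<forall>v x. (v, x) \<in> E \<longrightarrow> v \<in> D \<and> x \<in> B \<and> v #> x \<in> D) \<and>
    (\<forall>w\<in>Ws. path_edges K w \<subseteq> E) \<and>
    (\<forall>Z\<subseteq>D. K \<in> Z \<longrightarrow> (\<forall>v x. (v, x) \<in> E \<longrightarrow> (v \<in> Z \<longleftrightarrow> v #> x \<in> Z)) \<longrightarrow> Z = D)"
proof -
  define E where "E = (\<Union>w\<in>Ws. path_edges K w)"
  define D where "D = insert K (fst ` E \<union> (\<lambda>(v, x). v #> x) ` E)"
  have finE: "finite E" using Ws(1) finite_path_edges by (auto simp: E_def)
  have path: "u \<in> rcosets K \<and> x \<in> B \<and> u #> x \<in> rcosets K"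
    if "(u, x) \<in> path_edges v w" "v \<in> rcosets K" "w \<in> words_over B" for u x v w
    using that
  proof (induction w arbitrary: v)
    case (Cons l w)
    have l: "fst l \<in> B" "fst l \<in> carrier G" using Cons.prems(3) B by auto
    have v: "v \<subseteq> carrier G" using rcosets_subset[OF K Cons.prems(2)] .
    have "v #> letter_val G l \<in> rcosets K" using K Cons.prems(2) l by (intro rcosets_act letter_val_closed)
    moreover have "v #> fst l \<in> rcosets K" "v #> inv (fst l) \<in> rcosets K"
      using K Cons.prems(2) l by (auto intro: rcosets_act)
    ultimately show ?case using Cons l v by (auto simp: cross_def split: if_splits)
  qed simp
  have Eprop: "v \<in> rcosets K \<and> x \<in> B \<and> v #> x \<in> rcosets K" if "(v, x) \<in> E" for v x
    using that path[OF _ subgroup_in_rcosets[OF K]] Ws(2) unfolding E_def by blast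
  have conn: "v \<in> Z \<and> (\<forall>u x. (u, x) \<in> path_edges v w \<longrightarrow> u \<in> Z \<and> u #> x \<in> Z)"
    if "v \<in> Z" "v \<in> rcosets K" "w \<in> words_over B" "path_edges v w \<subseteq> E"
      and Z: "\<And>v x. (v, x) \<in> E \<Longrightarrow> v \<in> Z \<longleftrightarrow> v #> x \<in> Z" for Z v w
    using that(1-4)
  proof (induction w arbitrary: v)
    case (Cons l w)
    have l: "fst l \<in> B" "fst l \<in> carrier G" using Cons.prems(3) B by auto
    have v: "v \<subseteq> carrier G" using rcosets_subset[OF K Cons.prems(2)] .
    have c: "cross v l \<in> E" using Cons.prems(4) by simp
    have v': "v #> letter_val G l \<in> rcosets K" using K Cons.prems(2) l by (intro rcosets_act letter_val_closed)
    have Zl: "v #> letter_val G l \<in> Z \<and> (\<forall>u x. (u, x) = cross v l \<longrightarrow> u \<in> Z \<and> u #> x \<in> Z)"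
    proof (cases "snd l")
      case True
      then have "(v #> inv (fst l), fst l) \<in> E" using c by (simp add: cross_def)
      from Z[OF this] show ?thesis using True Cons.prems(1) v l by (simp add: cross_def letter_val_def)
    next
      case False
      then have "(v, fst l) \<in> E" using c by (simp add: cross_def)
      from Z[OF this] show ?thesis using False Cons.prems(1) v l by (simp add: cross_def letter_val_def)
    qed
    have "w \<in> words_over B" "path_edges (v #> letter_val G l) w \<subseteq> E" using Cons.prems by auto
    from Cons.IH[OF conjunct1[OF Zl] v' this] show ?case using Zl Cons.prems(1) by auto
  qed simp
  have 1: "Z = D" if Z: "Z \<subseteq> D" "K \<in> Z" "\<forall>v x. (v, x) \<in> E \<longrightarrow> (v \<in> Z \<longleftrightarrow> v #> x \<in> Z)" for Z
  proof -
    have "u \<in> Z \<and> u #> x \<in> Z" if e: "(u, x) \<in> E" for u x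
    proof -
      obtain w where w: "w \<in> Ws" "(u, x) \<in> path_edges K w" using e by (auto simp: E_def)
      have "path_edges K w \<subseteq> E" "w \<in> words_over B" using w(1) Ws(2) by (auto simp: E_def)
      then show ?thesis using conn[of K Z w] Z(2,3) subgroup_in_rcosets[OF K] w(2) by blast
    qed
    then have "D \<subseteq> Z" using Z(2) by (auto simp: D_def)
    then show ?thesis using Z(1) by blast
  qed
  have 2: "finite D" "K \<in> D" using finE by (auto simp: D_def)
  have 3: "D \<subseteq> rcosets K" using Eprop subgroup_in_rcosets[OF K] by (auto simp: D_def)
  have 4: "v \<in> D \<and> x \<in> B \<and> v #> x \<in> D" if "(v, x) \<in> E" for v x
    using that Eprop[OF that] by (force simp: D_def)
  have 5: "path_edges K w \<subseteq> E" if "w \<in> Ws" for w using that by (auto simp: E_def)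
  show ?thesis
  proof (intro exI[of _ D] exI[of _ E] conjI)
    show "\<forall>v x. (v, x) \<in> E \<longrightarrow> v \<in> D \<and> x \<in> B \<and> v #> x \<in> D" using 4 by blast
    show "\<forall>w\<in>Ws. path_edges K w \<subseteq> E" using 5 by blast
    show "\<forall>Z\<subseteq>D. K \<in> Z \<longrightarrow> (\<forall>v x. (v, x) \<in> E \<longrightarrow> (v \<in> Z \<longleftrightarrow> v #> x \<in> Z)) \<longrightarrow> Z = D"
      using 1 by (intro allI impI)
  qed (fact 2 3 finE)+
qed

text \<open>A subgraph grows edge by edge. An edge to a new vertex extends the spanning tree, where
  \<open>p v\<close> is the value of the tree path to \<open>v\<close>; any other edge contributes
  the loop that it closes to \<open>Y\<close>.\<close>

lemma spanning_generators:
  assumes K: "subgroup K G" and D: "finite D" "K \<in> D" "D \<subseteq> rcosets K"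
    and E: "finite E" "\<And>v x. (v, x) \<in> E \<Longrightarrow> v \<in> D \<and> x \<in> carrier G \<and> v #> x \<in> D"
    and conn: "\<And>Z. Z \<subseteq> D \<Longrightarrow> K \<in> Z \<Longrightarrow> (\<And>v x. (v, x) \<in> E \<Longrightarrow> v \<in> Z \<longleftrightarrow> v #> x \<in> Z) \<Longrightarrow> Z = D"
  obtains p Y where "finite Y" "card Y + card D \<le> card E + 1" "Y \<subseteq> K" "p K = \<one>"
    "\<And>v. v \<in> D \<Longrightarrow> p v \<in> carrier G"
    "\<And>v x. (v, x) \<in> E \<Longrightarrow> p v \<otimes> x \<otimes> inv (p (v #> x)) \<in> generate G Y"
proof -
  have KG: "K \<subseteq> carrier G" using K by (rule subgroup.subset)
  have DG: "v \<subseteq> carrier G" if "v \<in> D" for v using rcosets_subset[OF K] D(3) that by blast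
  \<comment> \<open>The count is an inequality because different edges may close loops of equal
    value.\<close>
  define good where "good D' E' p Y \<longleftrightarrow> D' \<subseteq> D \<and> E' \<subseteq> E \<and> K \<in> D' \<and>
    (\<forall>v x. (v, x) \<in> E' \<longrightarrow> v \<in> D' \<and> v #> x \<in> D') \<and>
    finite Y \<and> card Y + card D' \<le> card E' + 1 \<and> Y \<subseteq> K \<and> p K = \<one> \<and>
    (\<forall>v\<in>D'. p v \<in> carrier G \<and> K #> p v = v) \<and>
    (\<forall>v x. (v, x) \<in> E' \<longrightarrow> p v \<otimes> x \<otimes> inv (p (v #> x)) \<in> generate G Y)"
    for D' E' and p :: "'a set \<Rightarrow> 'a" and Y
  have "\<exists>p Y. good D E p Y" if "good D' E' p Y" for D' E' p Y
    using that
  proof (induction "card (E - E')" arbitrary: D' E' p Y rule: less_induct)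
    case less
    note g = less.prems[unfolded good_def]
    have g1: "D' \<subseteq> D" "E' \<subseteq> E" "K \<in> D'" "finite Y" "card Y + card D' \<le> card E' + 1" "Y \<subseteq> K" "p K = \<one>"
      and gE: "\<forall>v x. (v, x) \<in> E' \<longrightarrow> v \<in> D' \<and> v #> x \<in> D'"
      and gp: "\<forall>v\<in>D'. p v \<in> carrier G \<and> K #> p v = v"
      and gq: "\<forall>v x. (v, x) \<in> E' \<longrightarrow> p v \<otimes> x \<otimes> inv (p (v #> x)) \<in> generate G Y"
      by (insert g, (elim conjE, assumption)+)
    from g1 have finD': "finite D'" and finE': "finite E'" using D(1) E(1) by (simp_all add: finite_subset)
    show ?case
    proof (cases "\<exists>v x. (v, x) \<in> E - E' \<and> (v \<in> D' \<or> v #> x \<in> D')")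
      case False
      have "D' = D"
      proof (rule conn)
        show "v \<in> D' \<longleftrightarrow> v #> x \<in> D'" if "(v, x) \<in> E" for v x using that False gE by blast
      qed (use g1 in auto)
      have "E \<subseteq> E'"
      proof safe
        fix v x assume "(v, x) \<in> E"
        then show "(v, x) \<in> E'" using False E(2) \<open>D' = D\<close> by blast
      qed
      then have "E' = E" using g1(2) by blast
      then show ?thesis using less.prems \<open>D' = D\<close> by blast
    next
      case True
      then obtain v x where vx: "(v, x) \<in> E" "(v, x) \<notin> E'" "v \<in> D' \<or> v #> x \<in> D'" by blast
      have vD: "v \<in> D" "x \<in> carrier G" "v #> x \<in> D" using E(2)[OF vx(1)] by auto
      have vG: "v \<subseteq> carrier G" using DG vD by blast
      have cardE: "card (insert (v, x) E') = card E' + 1" using finE' vx(2) by simp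
      have smaller: "card (E - insert (v, x) E') < card (E - E')"
        using vx E(1) by (intro psubset_card_mono) auto
      have "\<exists>D'' p' Y'. good D'' (insert (v, x) E') p' Y'"
      proof (cases "v \<in> D' \<and> v #> x \<in> D'")
        case True
        \<comment> \<open>The loop along the tree, across the new edge and back.\<close>
        define y where "y = p v \<otimes> x \<otimes> inv (p (v #> x))"
        have pc: "p v \<in> carrier G" "p (v #> x) \<in> carrier G" "K #> p v = v" "K #> p (v #> x) = v #> x"
          using gp True by auto
        have yG: "y \<in> carrier G" using pc vD by (simp add: y_def)
        have "K #> y = K #> p v #> x #> inv (p (v #> x))"
          unfolding y_def using pc(1,2) vD KG by (simp flip: coset_mult_assoc)
        also have "\<dots> = K #> p (v #> x) #> inv (p (v #> x))" using pc by simp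
        also have "\<dots> = K" using pc(2) KG by (rule act_inv_cancel(1)[rotated])
        finally have yK: "y \<in> K" using act_mem_subgroup[OF K yG] by simp
        have "card (insert y Y) \<le> card Y + 1" using g1(4) by (simp add: card_insert_if)
        then have card_y: "card (insert y Y) + card D' \<le> card (insert (v, x) E') + 1" using cardE g1(5) by linarith
        have "generate G Y \<subseteq> generate G (insert y Y)" by (intro mono_generate) auto
        moreover have "y \<in> generate G (insert y Y)" by (intro generate.incl) simp
        ultimately have "\<forall>u z. (u, z) \<in> insert (v, x) E' \<longrightarrow> p u \<otimes> z \<otimes> inv (p (u #> z)) \<in> generate G (insert y Y)"
          using gq unfolding y_def by blast
        then have "good D' (insert (v, x) E') p (insert y Y)"
          unfolding good_def using g1 gE gp True vx(1) yK card_y by (intro conjI) auto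
        then show ?thesis by blast
      next
        case new: False
        show ?thesis
        proof (cases "v \<in> D'")
          case True
          then have n: "v #> x \<notin> D'" using new by blast
          \<comment> \<open>Chosen so that the loop of the new edge is
            \<open>\<one>\<close>.\<close>
          define p' where "p' = p(v #> x := p v \<otimes> x)"
          have pc: "p v \<in> carrier G" "K #> p v = v" using gp True by auto
          have p'D: "p' u = p u" if "u \<in> D'" for u using that n by (auto simp: p'_def)
          have "card (insert (v #> x) D') = card D' + 1" using finD' n by simp
          then have cd: "card Y + card (insert (v #> x) D') \<le> card (insert (v, x) E') + 1" using cardE g1(5) by linarith
          have q: "p' v \<otimes> x \<otimes> inv (p' (v #> x)) \<in> generate G Y"
            using p'D[OF True] pc vD by (simp add: p'_def generate.one)
          have pn: "K #> p' (v #> x) = v #> x" "p' (v #> x) \<in> carrier G"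
            using pc vD KG by (simp_all add: p'_def flip: coset_mult_assoc)
          have "\<forall>u z. (u, z) \<in> insert (v, x) E' \<longrightarrow> p' u \<otimes> z \<otimes> inv (p' (u #> z)) \<in> generate G Y"
            using gq gE q p'D by auto
          moreover have "\<forall>u\<in>insert (v #> x) D'. p' u \<in> carrier G \<and> K #> p' u = u"
            using gp pn p'D by simp
          ultimately have "good (insert (v #> x) D') (insert (v, x) E') p' Y"
            unfolding good_def using g1 gE True vx(1) vD(3) cd p'D by (intro conjI) auto
          then show ?thesis by blast
        next
          case F: False
          then have n: "v #> x \<in> D'" using vx(3) by blast
          define p' where "p' = p(v := p (v #> x) \<otimes> inv x)"
          have pc: "p (v #> x) \<in> carrier G" "K #> p (v #> x) = v #> x" using gp n by auto
          have p'D: "p' u = p u" if "u \<in> D'" for u using that F by (auto simp: p'_def)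
          have "card (insert v D') = card D' + 1" using finD' F by simp
          then have cd: "card Y + card (insert v D') \<le> card (insert (v, x) E') + 1" using cardE g1(5) by linarith
          have q: "p' v \<otimes> x \<otimes> inv (p' (v #> x)) \<in> generate G Y"
            using p'D[OF n] pc vD by (simp add: p'_def generate.one m_assoc)
          have pn: "K #> p' v = v" "p' v \<in> carrier G"
            using pc vD KG vG by (simp_all add: p'_def flip: coset_mult_assoc)
          have "\<forall>u z. (u, z) \<in> insert (v, x) E' \<longrightarrow> p' u \<otimes> z \<otimes> inv (p' (u #> z)) \<in> generate G Y"
            using gq gE q p'D by auto
          moreover have "\<forall>u\<in>insert v D'. p' u \<in> carrier G \<and> K #> p' u = u"
            using gp pn p'D by simp
          ultimately have "good (insert v D') (insert (v, x) E') p' Y"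
            unfolding good_def using g1 gE n vx(1) vD(1) cd p'D by (intro conjI) auto
          then show ?thesis by blast
        qed
      qed
      then show ?thesis using less.hyps[OF smaller] by blast
    qed
  qed
  moreover have "good {K} {} (\<lambda>_. \<one>) {}" using D(2) KG by (simp add: good_def)
  ultimately obtain p Y where "good D E p Y" by blast
  then have Y: "finite Y" "card Y + card D \<le> card E + 1" "Y \<subseteq> K" "p K = \<one>"
    and p: "\<forall>v\<in>D. p v \<in> carrier G \<and> K #> p v = v"
      "\<forall>v x. (v, x) \<in> E \<longrightarrow> p v \<otimes> x \<otimes> inv (p (v #> x)) \<in> generate G Y"
    unfolding good_def by - (elim conjE, assumption)+
  show thesis
  proof (rule that[of Y p, OF Y])
    show "p v \<in> carrier G" if "v \<in> D" for v using p(1) that by simp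
    show "p v \<otimes> x \<otimes> inv (p (v #> x)) \<in> generate G Y" if "(v, x) \<in> E" for v x using p(2) that by simp
  qed
qed

text \<open>The conjugated letters telescope. For a closed path at a vertex with
  \<open>p v = \<one>\<close> the value itself lies in \<open>Q\<close>.\<close>

lemma path_in_subgroup:
  assumes Q: "subgroup Q G" and D: "\<And>v. v \<in> D \<Longrightarrow> v \<subseteq> carrier G \<and> p v \<in> carrier G"
    and E: "\<And>v x. (v, x) \<in> E \<Longrightarrow> v \<in> D \<and> x \<in> carrier G \<and> v #> x \<in> D \<and> p v \<otimes> x \<otimes> inv (p (v #> x)) \<in> Q"
    and w: "v \<in> D" "fst ` set w \<subseteq> carrier G" "path_edges v w \<subseteq> E"
  shows "v #> word_val G w \<in> D \<and> p v \<otimes> word_val G w \<otimes> inv (p (v #> word_val G w)) \<in> Q"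
  using w
proof (induction w arbitrary: v)
  case Nil
  then show ?case using D[OF Nil.prems(1)] Q by (simp add: subgroup.one_closed)
next
  case (Cons l w)
  have v: "v \<subseteq> carrier G" "p v \<in> carrier G" using D Cons.prems(1) by auto
  have c: "fst l \<in> carrier G" "fst ` set w \<subseteq> carrier G" "cross v l \<in> E" using Cons.prems by auto
  define g where "g = letter_val G l"
  have gG: "g \<in> carrier G" using c by (simp add: g_def letter_val_closed)
  have step: "v #> g \<in> D \<and> p v \<otimes> g \<otimes> inv (p (v #> g)) \<in> Q"
  proof (cases "snd l")
    case False
    then show ?thesis using c E[of v "fst l"] by (simp add: cross_def g_def letter_val_def)
  next
    case True
    then have e: "(v #> inv (fst l), fst l) \<in> E" using c by (simp add: cross_def)
    define v' where "v' = v #> inv (fst l)"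
    have v': "v' \<in> D" "p v' \<in> carrier G" "v' #> fst l = v" using E[OF e] D v c by (auto simp: v'_def)
    have "p v' \<otimes> fst l \<otimes> inv (p v) \<in> Q" using E[OF e] v' by (simp add: v'_def)
    then have "inv (p v' \<otimes> fst l \<otimes> inv (p v)) \<in> Q" using Q by (simp add: subgroup.m_inv_closed)
    then show ?thesis using True v' v c by (simp add: g_def letter_val_def inv_mult_group m_assoc flip: v'_def)
  qed
  define u where "u = v #> g #> word_val G w"
  have IH: "u \<in> D" "p (v #> g) \<otimes> word_val G w \<otimes> inv (p u) \<in> Q"
    using Cons.IH[of "v #> g"] step c Cons.prems(3) by (auto simp: g_def u_def)
  have u: "v #> word_val G (l # w) = u"
    using v gG c by (simp add: u_def g_def[symmetric] coset_mult_assoc word_val_closed)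
  have cl: "p (v #> g) \<in> carrier G" "p u \<in> carrier G" "word_val G w \<in> carrier G"
    using step IH D c by (auto simp: word_val_closed)
  have "(p v \<otimes> g \<otimes> inv (p (v #> g))) \<otimes> (p (v #> g) \<otimes> word_val G w \<otimes> inv (p u)) \<in> Q"
    using subgroup.m_closed[OF Q] step IH(2) by blast
  also have "(p v \<otimes> g \<otimes> inv (p (v #> g))) \<otimes> (p (v #> g) \<otimes> word_val G w \<otimes> inv (p u)) =
      p v \<otimes> (g \<otimes> word_val G w) \<otimes> inv (p u)"
    using cl v gG by (simp add: m_assoc inv_cancel_left)
  finally show ?case using u IH(1) by (simp add: g_def)
qed

lemma path_closed_set:
  assumes Z: "\<And>v x. (v, x) \<in> E \<Longrightarrow> v \<in> Z \<longleftrightarrow> v #> x \<in> Z"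
    and w: "v \<subseteq> carrier G" "fst ` set w \<subseteq> carrier G" "path_edges v w \<subseteq> E"
  shows "v \<in> Z \<longleftrightarrow> v #> word_val G w \<in> Z"
  using w
proof (induction w arbitrary: v)
  case (Cons l w)
  have c: "fst l \<in> carrier G" "fst ` set w \<subseteq> carrier G" "cross v l \<in> E" using Cons.prems by auto
  have "v \<in> Z \<longleftrightarrow> v #> letter_val G l \<in> Z"
    using Z[of "v #> inv (fst l)" "fst l"] Z[of v "fst l"] c Cons.prems(1)
    by (auto simp: cross_def letter_val_def split: if_splits)
  moreover have "v #> letter_val G l \<in> Z \<longleftrightarrow> v #> letter_val G l #> word_val G w \<in> Z"
    using Cons.IH[of "v #> letter_val G l"] Cons.prems c by (simp add: coset_subset letter_val_closed)
  ultimately show ?case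
    using Cons.prems(1) c by (simp add: coset_mult_assoc letter_val_closed word_val_closed)
qed simp

text \<open>Cutting the coset graph at an edge that a closed path crosses once leaves it connected.\<close>

lemma simple_edge_generators:
  assumes K: "subgroup K G" and D: "finite D" "K \<in> D" "D \<subseteq> rcosets K"
    and E: "finite E" "\<And>v x. (v, x) \<in> E \<Longrightarrow> v \<in> D \<and> x \<in> carrier G \<and> v #> x \<in> D"
    and conn: "\<And>Z. Z \<subseteq> D \<Longrightarrow> K \<in> Z \<Longrightarrow> (\<And>v x. (v, x) \<in> E \<Longrightarrow> v \<in> Z \<longleftrightarrow> v #> x \<in> Z) \<Longrightarrow> Z = D"
    and Ws: "generate G (word_val G ` Ws) = K" "\<And>w. w \<in> Ws \<Longrightarrow> fst ` set w \<subseteq> carrier G \<and> path_edges K w \<subseteq> E"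
    and c: "c = c1 @ l # c2" "fst ` set c \<subseteq> carrier G" "word_val G c \<in> K" "path_edges K c \<subseteq> E"
    and e1: "cross (K #> word_val G c1) l \<notin> path_edges K c1"
    and e2: "cross (K #> word_val G c1) l \<notin> path_edges (K #> word_val G (c1 @ [l])) c2"
  shows "\<exists>Y\<subseteq>K. finite Y \<and> card Y + card D \<le> card E \<and> generate G (insert (word_val G c) Y) = K"
proof -
  have KG: "K \<subseteq> carrier G" using K by (rule subgroup.subset)
  have DG: "v \<subseteq> carrier G" if "v \<in> D" for v using rcosets_subset[OF K] D(3) that by blast
  have cc: "fst ` set c1 \<subseteq> carrier G" "fst ` set c2 \<subseteq> carrier G" "fst l \<in> carrier G"
    "fst ` set (c1 @ [l]) \<subseteq> carrier G" using c by auto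
  define u where "u = K #> word_val G c1"
  define u' where "u' = K #> word_val G (c1 @ [l])"
  have uG: "u \<subseteq> carrier G" "u' \<subseteq> carrier G" using KG cc by (simp_all add: u_def u'_def coset_subset word_val_closed)
  have u'u: "u' = u #> letter_val G l"
    using KG cc by (simp add: u_def u'_def word_val_append coset_mult_assoc word_val_closed letter_val_closed)
  have cval: "word_val G c = word_val G (c1 @ [l]) \<otimes> word_val G c2"
    using cc by (simp add: c(1) word_val_append word_val_closed letter_val_closed m_assoc)
  have u'c2: "u' #> word_val G c2 = K"
    using KG cc c(2,3) coset_join2[OF _ K c(3)]
    by (simp add: u'_def coset_mult_assoc word_val_closed cval[symmetric])
  define e where "e = cross u l"
  have eE: "e \<in> E" using c(4) KG cc by (auto simp: c(1) path_edges_append e_def u_def)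
  have pe1: "path_edges K c1 \<subseteq> E - {e}" and pe2: "path_edges u' c2 \<subseteq> E - {e}"
    using c(4) KG cc e1 e2
    by (auto simp: c(1) path_edges_append e_def u_def u'_def word_val_append coset_mult_assoc word_val_closed letter_val_closed)
  have e_ends: "(u \<in> Z \<and> u' \<in> Z \<longrightarrow> fst e \<in> Z \<and> fst e #> snd e \<in> Z)" for Z
    using uG cc by (auto simp: e_def cross_def u'u letter_val_def)
  \<comment> \<open>The rest of \<open>c\<close>, from \<open>u'\<close> through \<open>K\<close> to
    \<open>u\<close>, joins the ends of \<open>e\<close> without crossing it.\<close>
  have conn': "Z = D" if Z: "Z \<subseteq> D" "K \<in> Z"
    and cl: "\<And>v x. (v, x) \<in> E - {e} \<Longrightarrow> v \<in> Z \<longleftrightarrow> v #> x \<in> Z" for Z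
  proof -
    have "u \<in> Z" using path_closed_set[OF cl KG cc(1) pe1] Z by (simp add: u_def)
    moreover have "u' \<in> Z" using path_closed_set[OF cl uG(2) cc(2) pe2] Z u'c2 by simp
    ultimately have ez: "fst e \<in> Z" "fst e #> snd e \<in> Z" using e_ends by blast+
    have "v \<in> Z \<longleftrightarrow> v #> x \<in> Z" if "(v, x) \<in> E" for v x
    proof (cases "(v, x) = e")
      case True then show ?thesis using ez by (metis fst_conv snd_conv)
    next
      case False then show ?thesis using cl that by blast
    qed
    then show "Z = D" using conn Z by blast
  qed
  have finE': "finite (E - {e})" using E(1) by simp
  have E': "v \<in> D \<and> x \<in> carrier G \<and> v #> x \<in> D" if "(v, x) \<in> E - {e}" for v x
    using E(2)[of v x] that by blast
  obtain p Y where Y: "finite Y" "card Y + card D \<le> card (E - {e}) + 1" "Y \<subseteq> K" and pK: "p K = \<one>"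
    and p: "\<And>v. v \<in> D \<Longrightarrow> p v \<in> carrier G"
    and pE: "\<And>v x. (v, x) \<in> E - {e} \<Longrightarrow> p v \<otimes> x \<otimes> inv (p (v #> x)) \<in> generate G Y"
  proof (rule spanning_generators[OF K D finE' E' conn'], goal_cases)
    case prems: (5 p Y)
    show ?case by (rule that[of Y p]) (fact prems)+
  qed
  have "card (E - {e}) + 1 = card E" using card_Suc_Diff1[OF E(1) eE] by simp
  then have cardY: "card Y + card D \<le> card E" using Y(2) by simp
  define Q where "Q = generate G (insert (word_val G c) Y)"
  have YG: "insert (word_val G c) Y \<subseteq> carrier G" using Y(3) KG c(3) by blast
  have Q: "subgroup Q G" unfolding Q_def using YG by (rule generate_is_subgroup)
  have YQ: "generate G Y \<subseteq> Q" unfolding Q_def by (intro mono_generate) auto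
  have cQ: "word_val G c \<in> Q" unfolding Q_def by (intro generate.incl) simp
  have Dp: "v \<subseteq> carrier G \<and> p v \<in> carrier G" if "v \<in> D" for v using that DG p by blast
  have E'Q: "v \<in> D \<and> x \<in> carrier G \<and> v #> x \<in> D \<and> p v \<otimes> x \<otimes> inv (p (v #> x)) \<in> Q"
    if "(v, x) \<in> E - {e}" for v x using that E(2) pE YQ by blast
  have q1: "u \<in> D" "word_val G c1 \<otimes> inv (p u) \<in> Q"
    using path_in_subgroup[OF Q Dp E'Q D(2) cc(1) pe1] pK cc by (auto simp: u_def word_val_closed)
  have u'D: "u' \<in> D" using E(2)[of u "fst l"] E(2)[of "u #> inv (fst l)" "fst l"] eE
    by (cases "snd l") (auto simp: e_def cross_def u'u letter_val_def)
  have q2: "p u' \<otimes> word_val G c2 \<in> Q"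
    using path_in_subgroup[OF Q Dp E'Q u'D cc(2) pe2] pK cc u'c2 Dp[OF u'D] by (auto simp: word_val_closed)
  define g where "g = letter_val G l"
  have cl: "p u \<in> carrier G" "p u' \<in> carrier G" "g \<in> carrier G" "word_val G c1 \<in> carrier G" "word_val G c2 \<in> carrier G"
    using Dp q1(1) u'D cc by (auto simp: g_def letter_val_closed word_val_closed)
  \<comment> \<open>Solving \<open>c = c1 @ l # c2\<close> for \<open>l\<close>: the value of
    \<open>c\<close> replaces the loop of the removed edge as a generator.\<close>
  have "inv (word_val G c1 \<otimes> inv (p u)) \<otimes> word_val G c \<otimes> inv (p u' \<otimes> word_val G c2) \<in> Q"
    using subgroup.m_closed[OF Q subgroup.m_closed[OF Q subgroup.m_inv_closed[OF Q q1(2)] cQ]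
        subgroup.m_inv_closed[OF Q q2]] .
  also have "inv (word_val G c1 \<otimes> inv (p u)) \<otimes> word_val G c \<otimes> inv (p u' \<otimes> word_val G c2) =
     p u \<otimes> g \<otimes> inv (p u')"
    using cl cc by (simp add: cval word_val_append inv_mult_group m_assoc g_def[symmetric] inv_cancel_left)
  finally have mid: "p u \<otimes> g \<otimes> inv (p u') \<in> Q" .
  have EQ: "v \<in> D \<and> x \<in> carrier G \<and> v #> x \<in> D \<and> p v \<otimes> x \<otimes> inv (p (v #> x)) \<in> Q"
    if vx: "(v, x) \<in> E" for v x
  proof (cases "(v, x) = e")
    case False then show ?thesis using E'Q vx by blast
  next
    case True
    show ?thesis
    proof (cases "snd l")
      case False
      then have "v = u" "x = fst l" "x = g" "v #> x = u'" using True by (auto simp: e_def cross_def g_def u'u letter_val_def)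
      then show ?thesis using mid E(2)[OF vx] by simp
    next
      case T: True
      then have vx': "v = u'" "x = fst l" "g = inv x" "v #> x = u"
        using True uG cc by (auto simp: e_def cross_def g_def u'u letter_val_def)
      have "inv (p u \<otimes> g \<otimes> inv (p u')) \<in> Q" using mid Q by (simp add: subgroup.m_inv_closed)
      then show ?thesis using E(2)[OF vx] cl vx' cc by (simp add: inv_mult_group m_assoc)
    qed
  qed
  have "word_val G w \<in> Q" if "w \<in> Ws" for w
  proof -
    have wK: "word_val G w \<in> K" using Ws(1) that generate.incl[of _ "word_val G ` Ws" G] by blast
    have w: "fst ` set w \<subseteq> carrier G" "path_edges K w \<subseteq> E" using Ws(2)[OF that] by auto
    have "K #> word_val G w = K" using wK K KG by (intro coset_join2) auto
    then show ?thesis using path_in_subgroup[OF Q Dp EQ D(2) w] pK w by (simp add: word_val_closed)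
  qed
  then have "K \<subseteq> Q" using generate_subgroup_incl[OF _ Q, of "word_val G ` Ws"] Ws(1) by blast
  moreover have "Q \<subseteq> K" unfolding Q_def using Y(3) c(3) by (intro generate_subgroup_incl[OF _ K]) auto
  ultimately show ?thesis using Y cardY unfolding Q_def by blast
qed

end

section \<open>Cyclic words and the closed paths that they trace\<close>

lemma reduced_word_append1: "reduced_word (u @ v) \<Longrightarrow> reduced_word u"
proof (induction u rule: reduced_word.induct)
  case (1 x y w)
  then show ?case by (metis append_Cons reduced_word_Cons2)
qed auto

lemma reduced_word_tl: "reduced_word (l # w) \<Longrightarrow> reduced_word w"
  by (cases w) (auto simp: reduced_word_Cons2)

lemma cyclic_reduction:
  "reduced_word w \<Longrightarrow> \<exists>u c. w = u @ c @ winv u \<and> reduced_word c \<and> (c \<noteq> [] \<longrightarrow> hd c \<noteq> linv (last c))"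
proof (induction "length w" arbitrary: w rule: less_induct)
  case less
  show ?case
  proof (cases "w = [] \<or> hd w \<noteq> linv (last w)")
    case True
    then show ?thesis using less.prems by (intro exI[of _ "[]"] exI[of _ w]) (auto simp: winv_def)
  next
    case False
    then obtain l w1 where w1: "w = l # w1" by (cases w) auto
    then have "w1 \<noteq> []" using False by auto
    then obtain w' x where w': "w1 = w' @ [x]" by (metis append_butlast_last_id)
    have x: "x = linv l" using False w1 w' by simp
    have "reduced_word w'" using less.prems w1 w' reduced_word_tl reduced_word_append1 by blast
    then obtain u c where uc: "w' = u @ c @ winv u" "reduced_word c" "c \<noteq> [] \<longrightarrow> hd c \<noteq> linv (last c)"
      using less.hyps[of w'] w1 w' by auto
    have "w = (l # u) @ c @ winv (l # u)" using w1 w' x uc(1) by (simp add: winv_def)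
    then show ?thesis using uc by blast
  qed
qed

definition cyc :: "('x \<times> bool) list \<Rightarrow> int \<Rightarrow> 'x \<times> bool" where
  "cyc c i = c ! nat (i mod int (length c))"

lemma cyc_periodic: "cyc c (i + int (length c)) = cyc c i"
  by (simp add: cyc_def)

lemma cyc_mod: "cyc c (i mod int (length c) + k) = cyc c (i + k)"
  by (simp add: cyc_def mod_add_left_eq)

lemma cyc_in: "c \<noteq> [] \<Longrightarrow> cyc c i \<in> set c"
  by (simp add: cyc_def nat_less_iff)

lemma succ_mod:
  fixes i n :: int
  assumes "n > 0" shows "(i + 1) mod n = (if i mod n + 1 = n then 0 else i mod n + 1)"
proof -
  have "(i + 1) mod n = (i mod n + 1) mod n" by (simp add: mod_add_left_eq)
  moreover have "0 \<le> i mod n" "i mod n < n" using assms by auto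
  ultimately show ?thesis by auto
qed

lemma cyc_reduced:
  assumes "reduced_word c" "c \<noteq> []" "hd c \<noteq> linv (last c)"
  shows "cyc c (i + 1) \<noteq> linv (cyc c i)"
proof -
  define n where "n = int (length c)"
  define m where "m = nat (i mod n)"
  have n: "n > 0" using assms(2) by (simp add: n_def)
  have m: "i mod n = int m" "m < length c" using n by (simp_all add: m_def n_def nat_less_iff)
  show ?thesis
  proof (cases "Suc m = length c")
    case True
    then have "(i + 1) mod n = 0" using succ_mod[OF n, of i] m by (simp add: n_def)
    then have "cyc c (i + 1) = hd c" using assms(2) by (simp add: cyc_def n_def hd_conv_nth)
    moreover have "length c - 1 = m" using True by simp
    then have "cyc c i = last c" using m(1) assms(2) by (simp add: cyc_def n_def[symmetric] last_conv_nth)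
    ultimately show ?thesis using assms(3) by simp
  next
    case False
    then have "(i + 1) mod n = int (Suc m)" using succ_mod[OF n, of i] m by (simp add: n_def)
    then show ?thesis using reduced_word_nth[OF assms(1), of m] m False
      by (simp add: cyc_def n_def[symmetric] nat_add_distrib)
  qed
qed

context group
begin

definition pos :: "'a set \<Rightarrow> ('a \<times> bool) list \<Rightarrow> int \<Rightarrow> 'a set" where
  "pos K c i = K #> word_val G (take (nat (i mod int (length c))) c)"

lemma path_edges_conv:
  assumes "v \<subseteq> carrier G" "fst ` set w \<subseteq> carrier G"
  shows "path_edges v w = (\<lambda>i. cross (v #> word_val G (take i w)) (w ! i)) ` {..<length w}"
  using assms
proof (induction w arbitrary: v)
  case (Cons l w)
  have l: "fst l \<in> carrier G" "fst ` set w \<subseteq> carrier G" using Cons.prems by auto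
  then have t: "fst ` set (take i w) \<subseteq> carrier G" for i using set_take_subset[of i w] by blast
  have "path_edges (v #> letter_val G l) w =
      (\<lambda>i. cross (v #> letter_val G l #> word_val G (take i w)) (w ! i)) ` {..<length w}"
    using Cons.IH[of "v #> letter_val G l"] Cons.prems(1) l by (simp add: coset_subset letter_val_closed)
  also have "\<dots> = (\<lambda>i. cross (v #> word_val G (take (Suc i) (l # w))) ((l # w) ! Suc i)) ` {..<length w}"
    using Cons.prems(1) l t by (simp add: coset_mult_assoc letter_val_closed word_val_closed)
  finally show ?case using Cons.prems(1)
    by (simp add: lessThan_Suc_eq_insert_0 image_image del: take_Suc_Cons)
qed simp

context
  fixes K c
  assumes K: "subgroup K G" and c: "c \<noteq> []" "fst ` set c \<subseteq> carrier G" "word_val G c \<in> K"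
begin

lemma take_closed: "fst ` set (take m c) \<subseteq> carrier G"
  using c(2) set_take_subset[of m c] by blast

lemma cyc_closed: "fst (cyc c i) \<in> carrier G"
  using c cyc_in by blast

lemma pos_subset: "pos K c i \<subseteq> carrier G"
  unfolding pos_def using subgroup.subset[OF K] take_closed by (intro coset_subset word_val_closed)

lemma pos_periodic: "pos K c (i + int (length c)) = pos K c i"
  by (simp add: pos_def)

lemma pos_step: "pos K c (i + 1) = pos K c i #> letter_val G (cyc c i)"
proof -
  define n where "n = int (length c)"
  define m where "m = nat (i mod n)"
  have n: "n > 0" using c(1) by (simp add: n_def)
  have m: "i mod n = int m" "m < length c" using n by (simp_all add: m_def n_def nat_less_iff)
  have KG: "K \<subseteq> carrier G" using K by (rule subgroup.subset)
  have "pos K c i #> letter_val G (cyc c i) = K #> (word_val G (take m c) \<otimes> word_val G [c ! m])"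
    using KG cyc_closed[of i] take_closed[of m] m
    by (simp add: pos_def cyc_def n_def[symmetric] coset_mult_assoc word_val_closed letter_val_closed)
  also have "word_val G (take m c) \<otimes> word_val G [c ! m] = word_val G (take (Suc m) c)"
    using m(2) c(2) take_closed[of m] nth_mem[OF m(2)]
    by (subst word_val_append[symmetric]) (auto simp: take_Suc_conv_app_nth)
  also have "K #> word_val G (take (Suc m) c) = pos K c (i + 1)"
  proof (cases "Suc m = length c")
    case True
    then have "(i + 1) mod n = 0" using succ_mod[OF n, of i] m by (simp add: n_def)
    then have "pos K c (i + 1) = K" using KG by (simp add: pos_def n_def)
    moreover have "K #> word_val G c = K" using c(3) K KG by (intro coset_join2) auto
    ultimately show ?thesis using True by simp
  next
    case False
    then have "(i + 1) mod n = int (Suc m)" using succ_mod[OF n, of i] m by (simp add: n_def)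
    then show ?thesis by (simp only: pos_def n_def nat_int)
  qed
  finally show ?thesis by simp
qed

lemma pos_back: "pos K c i = pos K c (i + 1) #> letter_val G (linv (cyc c i))"
  using pos_step[of i] act_letter_cancel[OF pos_subset cyc_closed] by simp

lemma pos_cross: "cross (pos K c i) (cyc c i) \<in> path_edges K c"
proof -
  have "nat (i mod int (length c)) < length c" using c(1) by (simp add: nat_less_iff)
  then show ?thesis
    unfolding path_edges_conv[OF subgroup.subset[OF K] c(2)] pos_def cyc_def by blast
qed

definition seg :: "int \<Rightarrow> nat \<Rightarrow> 'a" where
  "seg i k = word_val G (map (\<lambda>t. cyc c (i + int t)) [0..<k])"

lemma seg_words: "fst ` set (map (\<lambda>t. cyc c (i + int t)) ks) \<subseteq> carrier G"
  using cyc_closed by auto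

lemma seg_closed: "seg i k \<in> carrier G"
  unfolding seg_def using seg_words by (rule word_val_closed)

lemma seg_add: "seg i (k + l) = seg i k \<otimes> seg (i + int k) l"
proof -
  have "map (\<lambda>t. cyc c (i + int t)) [k..<k + l] = map (\<lambda>t. cyc c (i + int k + int t)) [0..<l]"
    using map_add_upt[of k l, symmetric] by (simp add: add.commute add.left_commute)
  then have "map (\<lambda>t. cyc c (i + int t)) [0..<k + l] =
      map (\<lambda>t. cyc c (i + int t)) [0..<k] @ map (\<lambda>t. cyc c (i + int k + int t)) [0..<l]"
    by (simp add: upt_add_eq_append[of 0 k l])
  then show ?thesis unfolding seg_def by (simp only: word_val_append[OF seg_words seg_words])
qed

lemma seg_cong: "(\<And>t. cyc c (i + int t) = cyc c (j + int t)) \<Longrightarrow> seg i k = seg j k"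
  by (simp add: seg_def)

lemma seg_1: "seg i (Suc 0) = letter_val G (cyc c i)"
  using cyc_closed by (simp add: seg_def letter_val_closed)

lemma pos_seg: "pos K c (i + int k) = pos K c i #> seg i k"
proof (induction k)
  case 0 then show ?case using pos_subset by (simp add: seg_def)
next
  case (Suc k)
  have "pos K c (i + int (Suc k)) = pos K c (i + int k) #> letter_val G (cyc c (i + int k))"
    using pos_step[of "i + int k"] by (simp add: algebra_simps)
  also have "\<dots> = pos K c i #> seg i k #> seg (i + int k) (Suc 0)" by (simp add: Suc.IH seg_1)
  also have "\<dots> = pos K c i #> seg i (Suc k)"
    using seg_add[of i k "Suc 0"] by (simp add: coset_mult_assoc pos_subset seg_closed)
  finally show ?case .
qed

lemma seg_take: "m \<le> length c \<Longrightarrow> seg 0 m = word_val G (take m c)"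
  unfolding seg_def by (rule arg_cong[of _ _ "word_val G"], rule nth_equalityI) (auto simp: cyc_def)

text \<open>With \<open>m\<close> the residue of \<open>i\<close> and \<open>n\<close> the length of
  \<open>c\<close>, both sides read the first \<open>m + n\<close> letters of the unrolled word,
  split after \<open>m\<close> and after \<open>n\<close> letters respectively.\<close>

lemma seg_conj:
  defines "h \<equiv> \<lambda>i. word_val G (take (nat (i mod int (length c))) c)"
  shows "h i \<otimes> seg i (length c) = word_val G c \<otimes> h i"
proof -
  define n where "n = length c"
  define m where "m = nat (i mod int n)"
  have m: "i mod int n = int m" "m < n" using c(1) by (simp_all add: m_def n_def nat_less_iff)
  have h: "h i = seg 0 m" using m by (simp add: h_def m_def n_def seg_take)
  have s1: "seg (int m) n = seg i n"
    using cyc_mod[of c i] m(1) by (intro seg_cong) (simp add: n_def)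
  have s2: "seg (int n) m = seg 0 m"
    using cyc_periodic[of c] by (intro seg_cong) (simp add: n_def add.commute)
  have "seg 0 m \<otimes> seg (int m) n = seg 0 n \<otimes> seg (int n) m"
    using seg_add[of 0 m n] seg_add[of 0 n m] by (simp add: add.commute)
  moreover have "seg 0 n = word_val G c" using seg_take[of n] by (simp add: n_def)
  ultimately show ?thesis unfolding h s1 s2 by (simp add: n_def)
qed

lemma conj_pow:
  assumes "x \<in> carrier G" "h \<in> carrier G"
  shows "(h \<otimes> x \<otimes> inv h) [^] (k::nat) = h \<otimes> x [^] k \<otimes> inv h"
proof (induction k)
  case (Suc k)
  then show ?case using assms by (simp add: m_assoc inv_cancel_left)
qed (use assms in simp)

text \<open>The least common period of word and path from \<open>i\<close> on divides all others,
  among them the length of \<open>c\<close>. Carried back to the base vertex, one such period is an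
  element of \<open>K\<close> with a power equal to \<open>c\<close>, so it is the full
  length.\<close>

lemma pos_no_subperiod:
  assumes root: "\<And>s k. s \<in> K \<Longrightarrow> s [^] (k::nat) = word_val G c \<Longrightarrow> k = 1"
    and ij: "i < j" "\<And>k. cyc c (j + int k) = cyc c (i + int k)" "pos K c i = pos K c j"
  shows "int (length c) dvd j - i"
proof -
  define Per where "Per k \<longleftrightarrow> k > 0 \<and> (\<forall>t. cyc c (i + int t + int k) = cyc c (i + int t)) \<and> pos K c (i + int k) = pos K c i"
    for k :: nat
  define g where "g = (LEAST k. Per k)"
  have Pn: "Per (length c)" using c(1) cyc_periodic[of c] pos_periodic by (simp add: Per_def)
  have "Per (nat (j - i))" using ij ij(2) by (simp add: Per_def algebra_simps)
  have Pg: "Per g" unfolding g_def using Pn by (rule LeastI)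
  \<comment> \<open>Periods can be subtracted as in the Euclidean algorithm; for the path this works
    because the stretches cut off read the same word.\<close>
  have dvd: "g dvd k" if "Per k" for k
    using that
  proof (induction k rule: less_induct)
    case (less k)
    have "g \<le> k" unfolding g_def using less.prems by (rule Least_le)
    show ?case
    proof (cases "k = g")
      case False
      then have gk: "g < k" using \<open>g \<le> k\<close> by simp
      have c1: "cyc c (i + int t + int (k - g)) = cyc c (i + int t)" for t
      proof -
        have "cyc c (i + int (t + (k - g)) + int g) = cyc c (i + int (t + (k - g)))"
          using Pg unfolding Per_def by blast
        moreover have "i + int (t + (k - g)) + int g = i + int t + int k" using gk by simp
        moreover have "cyc c (i + int t + int k) = cyc c (i + int t)" using less.prems by (simp add: Per_def)
        moreover have "i + int (t + (k - g)) = i + int t + int (k - g)" by simp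
        ultimately show ?thesis by (simp only:)
      qed
      have "seg (i + int (k - g)) g = seg i g"
      proof (rule seg_cong)
        show "cyc c (i + int (k - g) + int t) = cyc c (i + int t)" for t
          using c1[of t] by (simp only: add.assoc add.commute[of "int t"])
      qed
      moreover have "i + int (k - g) + int g = i + int k" using gk by simp
      ultimately have "pos K c (i + int k) = pos K c (i + int (k - g)) #> seg i g"
        using pos_seg[of "i + int (k - g)" g] by (simp only:)
      then have "pos K c (i + int (k - g)) #> seg i g = pos K c i #> seg i g"
        using less.prems Pg pos_seg[of i g] by (simp add: Per_def)
      then have "pos K c (i + int (k - g)) = pos K c i"
        using act_inv_cancel(1)[OF pos_subset seg_closed] by metis
      then have "Per (k - g)" using c1 gk by (simp add: Per_def)
      then have "g dvd k - g" using less.IH[of "k - g"] Pg gk by (simp add: Per_def)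
      then show ?thesis using gk by (metis dvd_add dvd_refl le_add_diff_inverse2 less_imp_le_nat)
    qed simp
  qed
  obtain q where q: "length c = g * q" using dvd[OF Pn] by (rule dvdE)
  define h where "h = word_val G (take (nat (i mod int (length c))) c)"
  have hG: "h \<in> carrier G" unfolding h_def using take_closed by (rule word_val_closed)
  have segpow: "seg i (g * k) = seg i g [^] k" for k
  proof (induction k)
    case 0 then show ?case by (simp add: seg_def)
  next
    case (Suc k)
    have "cyc c (i + int (g * k) + int t) = cyc c (i + int t)" for t
    proof (induction k)
      case (Suc k)
      have "cyc c (i + int (g * k + t) + int g) = cyc c (i + int (g * k + t))"
        using Pg unfolding Per_def by blast
      then show ?case using Suc by (simp add: algebra_simps)
    qed simp
    then have "seg (i + int (g * k)) g = seg i g" by (rule seg_cong)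
    then show ?case using seg_add[of i "g * k" g] Suc by (simp add: add.commute)
  qed
  \<comment> \<open>\<open>h\<close> leads from \<open>K\<close> to the vertex at \<open>i\<close>,
    so conjugation turns the closed segment there into an element of \<open>K\<close>.\<close>
  define s where "s = h \<otimes> seg i g \<otimes> inv h"
  have sG: "s \<in> carrier G" using hG seg_closed by (simp add: s_def)
  have KG: "K \<subseteq> carrier G" using K by (rule subgroup.subset)
  have "K #> s = K #> h #> seg i g #> inv h"
    unfolding s_def using KG hG seg_closed by (simp add: coset_mult_assoc)
  also have "K #> h #> seg i g = K #> h"
    using Pg pos_seg[of i g] by (simp add: Per_def pos_def h_def)
  also have "K #> h #> inv h = K" using KG hG by simp
  finally have "s \<in> K" using act_mem_subgroup[OF K sG] by simp
  moreover have "s [^] q = word_val G c"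
  proof -
    have "s [^] q = h \<otimes> seg i (length c) \<otimes> inv h"
      using conj_pow[OF seg_closed hG] by (simp add: s_def q segpow)
    also have "\<dots> = word_val G c \<otimes> h \<otimes> inv h" using seg_conj[of i] by (simp add: h_def)
    also have "\<dots> = word_val G c" using hG c(2) by (simp add: word_val_closed m_assoc)
    finally show ?thesis .
  qed
  ultimately have "q = 1" by (rule root)
  then have "length c dvd nat (j - i)" using dvd[OF \<open>Per (nat (j - i))\<close>] q by simp
  then show ?thesis using ij(1) by (metis int_dvd_int_iff diff_ge_0_iff_ge int_nat_eq less_imp_le)
qed

lemma cross_pos: "cross (pos K c k) (cyc c k) = (pos K c (if snd (cyc c k) then k + 1 else k), fst (cyc c k))"
  using pos_step[of k] by (simp add: cross_def letter_val_def)

text \<open>Puts an edge crossed once into the form required by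
  \<open>simple_edge_generators\<close>.\<close>

lemma simple_crossing_split:
  assumes k: "k \<in> {0..<int (length c)}"
    and uniq: "\<And>k'. k' \<in> {0..<int (length c)} \<Longrightarrow> cross (pos K c k') (cyc c k') = cross (pos K c k) (cyc c k) \<Longrightarrow> k' = k"
  shows "\<exists>c1 l c2. c = c1 @ l # c2 \<and> cross (K #> word_val G c1) l \<notin> path_edges K c1 \<and>
    cross (K #> word_val G c1) l \<notin> path_edges (K #> word_val G (c1 @ [l])) c2"
proof -
  define m where "m = nat k"
  have m: "m < length c" "k = int m" using k by (auto simp: m_def)
  have KG: "K \<subseteq> carrier G" using K by (rule subgroup.subset)
  define e where "e m = cross (K #> word_val G (take m c)) (c ! m)" for m
  have e: "e i = cross (pos K c (int i)) (cyc c (int i))" if "i < length c" for i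
    using that by (simp add: e_def pos_def cyc_def)
  have ne: "e i \<noteq> e m" if "i < length c" "i \<noteq> m" for i
    using uniq[of "int i"] that m e by auto
  have 1: "e m \<notin> path_edges K (take m c)"
  proof
    assume "e m \<in> path_edges K (take m c)"
    then obtain i where i: "i < m" "e m = cross (K #> word_val G (take i (take m c))) (take m c ! i)"
      using m(1) unfolding path_edges_conv[OF KG take_closed] by auto
    then have "e m = e i" by (simp add: e_def)
    then show False using ne[of i] i(1) m(1) by simp
  qed
  have dr: "fst ` set (drop (Suc m) c) \<subseteq> carrier G" using c(2) set_drop_subset[of "Suc m" c] by blast
  have tk: "take m c @ [c ! m] = take (Suc m) c" using m by (simp add: take_Suc_conv_app_nth)
  have 2: "e m \<notin> path_edges (K #> word_val G (take m c @ [c ! m])) (drop (Suc m) c)"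
  proof
    assume "e m \<in> path_edges (K #> word_val G (take m c @ [c ! m])) (drop (Suc m) c)"
    moreover have Ks: "K #> word_val G (take (Suc m) c) \<subseteq> carrier G"
      using KG take_closed by (intro coset_subset word_val_closed)
    ultimately obtain i where i: "i < length c - Suc m"
      "e m = cross (K #> word_val G (take (Suc m) c) #> word_val G (take i (drop (Suc m) c))) (drop (Suc m) c ! i)"
      unfolding tk path_edges_conv[OF Ks dr] by auto
    have ti: "fst ` set (take i (drop (Suc m) c)) \<subseteq> carrier G" using dr set_take_subset by fastforce
    have "K #> word_val G (take (Suc m) c) #> word_val G (take i (drop (Suc m) c)) = K #> word_val G (take (Suc m + i) c)"
      unfolding take_add using KG take_closed ti
      by (simp add: coset_mult_assoc word_val_closed word_val_append)
    then have "e m = e (Suc m + i)" using i by (simp add: e_def)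
    moreover have "Suc m + i < length c" "Suc m + i \<noteq> m" using i(1) by linarith+
    ultimately show False using ne by metis
  qed
  show ?thesis using 1 2 id_take_nth_drop[OF m(1)] unfolding e_def by blast
qed

end

end

section \<open>Amalgams of free groups mapping onto a free group\<close>

definition bit_group :: "bit monoid" where
  "bit_group = \<lparr>carrier = UNIV, monoid.mult = (+), one = 0\<rparr>"

lemma group_bit_group: "group bit_group"
  by (rule groupI) (auto simp: bit_group_def add.assoc)

lemma card_sym_group_2: "card (carrier (sym_group 2)) = 2"
  using card_permutations[of "{1..2::nat}" 2] by (simp add: sym_group_def numeral_2_eq_2)

context group
begin

text \<open>\<open>hol_count\<close> is played against the bound \<open>|S|^|P|\<close>.
  Homomorphisms that factor through \<open>K\<close> kill the kernel of \<open>f\<close>; if a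
  nontrivial reduced word lies in it, an assignment that separates this word is missed, and the
  bound becomes strict.\<close>

lemma euler_bound:
  fixes F :: "('f, 'm) monoid_scheme" and f :: "'f \<Rightarrow> 'a"
  assumes B: "free_basis G B" and F: "group F" "free_basis F P" "finite P" and f: "f \<in> hom F G"
    and D: "finite D" "f ` carrier F \<in> D" "D \<subseteq> rcosets (f ` carrier F)"
    and E: "finite E" "\<And>v x. (v, x) \<in> E \<Longrightarrow> v \<in> D \<and> x \<in> B \<and> v #> x \<in> D"
  shows "card E + 1 \<le> card P + card D"
    and "\<not> inj_on f (carrier F) \<Longrightarrow> card E + 2 \<le> card P + card D"
proof -
  interpret F: group F by fact
  interpret f: group_hom F G f using f by unfold_locales
  define K where "K = f ` carrier F"
  have K: "subgroup K G" unfolding K_def by (rule f.img_is_subgroup)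
  have PF: "P \<subseteq> carrier F" "generate F P = carrier F" using F(2) by (auto simp: free_basis_def)
  have I: "f ` P \<subseteq> K" "generate G (f ` P) = K"
    using PF f.generate_img[OF PF(1)] by (auto simp: K_def)
  have Dpos: "card D \<ge> 1" using D(1,2) by (metis One_nat_def Suc_leI card_gt_0_iff empty_iff)
  define Im where "Im S = {\<phi> \<in> P \<rightarrow>\<^sub>E carrier S. \<exists>\<chi>\<in>hom (G\<lparr>carrier := K\<rparr>) S. \<forall>i\<in>P. \<phi> i = \<chi> (f i)}"
    for S :: "(nat \<Rightarrow> nat) monoid"
  have count: "card (carrier S) ^ card E \<le> card (Im S) * card (carrier S) ^ (card D - 1)"
    if "group S" "finite (carrier S)" for S :: "(nat \<Rightarrow> nat) monoid"
    unfolding Im_def using hol_count[OF B K F(3) I D(1) D(2,3)[folded K_def] E that] .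
  show "card E + 1 \<le> card P + card D"
  proof -
    \<comment> \<open>A group with two elements is enough to compare exponents.\<close>
    have "Im (sym_group 2) \<subseteq> P \<rightarrow>\<^sub>E carrier (sym_group 2)" by (auto simp: Im_def)
    then have "card (Im (sym_group 2)) \<le> 2 ^ card P"
      using card_mono[OF finite_PiE[OF F(3)], of "\<lambda>_. carrier (sym_group 2)"] finite_sym_group F(3)
      by (simp add: card_PiE card_sym_group_2)
    then have "(2::nat) ^ card E \<le> 2 ^ card P * 2 ^ (card D - 1)"
      using count[OF sym_group_is_group finite_sym_group, of 2]
      by (simp add: card_sym_group_2) (meson le_trans mult_le_mono1)
    then have "(2::nat) ^ card E \<le> 2 ^ (card P + (card D - 1))" by (simp add: power_add)
    then have "card E \<le> card P + (card D - 1)" by (simp only: power_increasing_iff one_less_numeral_iff semiring_norm)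
    then show ?thesis using Dpos by linarith
  qed
  show "card E + 2 \<le> card P + card D" if notinj: "\<not> inj_on f (carrier F)"
  proof -
    obtain y where y: "y \<in> carrier F" "y \<noteq> \<one>\<^bsub>F\<^esub>" "f y = \<one>"
      using notinj unfolding f.inj_on_one_iff by blast
    obtain w0 where "w0 \<in> words_over P" "y = word_val F w0"
      using y(1) F.generate_eq_words[OF PF(1)] PF(2) by auto
    then obtain w where w: "w \<in> words_over P" "reduced_word w" "word_val F w = y"
      using F.reduced_word_exists[OF PF(1)] by metis
    have "w \<noteq> []" using w(3) y(2) by auto
    then obtain N \<phi> where \<phi>: "\<And>x. \<phi> x \<in> carrier (sym_group N)"
      and ne: "word_val (sym_group N) (map (apfst \<phi>) w) \<noteq> \<one>\<^bsub>sym_group N\<^esub>"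
      using reduced_word_separated[OF w(2)] by blast
    define S where "S = sym_group N"
    interpret S: group S unfolding S_def by (rule sym_group_is_group)
    have finS: "finite (carrier S)" and Spos: "card (carrier S) \<ge> 1"
      using finite_sym_group S.one_closed by (auto simp: S_def card_gt_0_iff Suc_le_eq)
    have finPE: "finite (P \<rightarrow>\<^sub>E carrier S)" using F(3) finS by (intro finite_PiE)
    have "restrict \<phi> P \<notin> Im S"
    proof
      assume "restrict \<phi> P \<in> Im S"
      then obtain \<chi> where \<chi>: "\<chi> \<in> hom (G\<lparr>carrier := K\<rparr>) S" "\<forall>i\<in>P. restrict \<phi> P i = \<chi> (f i)"
        by (auto simp: Im_def)
      have hom: "\<chi> \<circ> f \<in> hom F S"
        using \<chi>(1) f by (auto simp: hom_def K_def Pi_def)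
      have cw: "fst ` set w \<subseteq> carrier F" using w(1) PF(1) by auto
      have "(\<chi> \<circ> f) y = word_val S (map (apfst (\<chi> \<circ> f)) w)"
        using F.hom_word_val[OF hom S.is_group cw] w(3) by simp
      also have "map (apfst (\<chi> \<circ> f)) w = map (apfst \<phi>) w"
        using \<chi>(2) w(1) by (intro map_apfst_cong) auto
      finally have "\<chi> (f y) \<noteq> \<one>\<^bsub>S\<^esub>" using ne by (simp add: S_def)
      moreover have "f y = f \<one>\<^bsub>F\<^esub>" using y(3) by simp
      ultimately show False using hom_one[OF hom F.is_group S.is_group] by simp
    qed
    moreover have "restrict \<phi> P \<in> P \<rightarrow>\<^sub>E carrier S" using \<phi> by (auto simp: S_def)
    moreover have "Im S \<subseteq> P \<rightarrow>\<^sub>E carrier S" unfolding Im_def by blast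
    ultimately have "Im S \<subset> P \<rightarrow>\<^sub>E carrier S" by blast
    then have "card (Im S) < card (carrier S) ^ card P"
      using psubset_card_mono[OF finPE] F(3) by (simp add: card_PiE)
    then have "card (Im S) * card (carrier S) ^ (card D - 1) < card (carrier S) ^ (card P + (card D - 1))"
      using Spos by (simp add: power_add)
    then have lt: "card (carrier S) ^ card E < card (carrier S) ^ (card P + (card D - 1))"
      using count[OF S.is_group finS] by linarith
    have "card E < card P + (card D - 1)"
    proof (rule ccontr)
      assume "\<not> ?thesis"
      then have "card (carrier S) ^ (card P + (card D - 1)) \<le> card (carrier S) ^ card E"
        using Spos by (intro power_increasing) auto
      then show False using lt by simp
    qed
    then show ?thesis using Dpos by linarith
  qed
qed

text \<open>On a closed path \<open>p\<close> returns to its value, so \<open>\<psi>\<close>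
  vanishes there: potentials on a coset graph force homomorphisms to vanish on the subgroup.\<close>

lemma path_potential:
  fixes \<psi> :: "'a \<Rightarrow> bit"
  assumes \<psi>: "\<And>x y. x \<in> carrier G \<Longrightarrow> y \<in> carrier G \<Longrightarrow> \<psi> (x \<otimes> y) = \<psi> x + \<psi> y"
    and p: "\<And>v x. (v, x) \<in> E \<Longrightarrow> p (v #> x) = p v + \<psi> x"
    and w: "v \<subseteq> carrier G" "fst ` set w \<subseteq> carrier G" "path_edges v w \<subseteq> E"
  shows "p (v #> word_val G w) = p v + \<psi> (word_val G w)"
proof -
  have \<psi>1: "\<psi> \<one> = 0" using \<psi>[of \<one> \<one>] by simp
  have \<psi>i: "\<psi> (inv x) = \<psi> x" if "x \<in> carrier G" for x
    using \<psi>[of x "inv x"] that \<psi>1 by simp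
  show ?thesis using w
  proof (induction w arbitrary: v)
    case (Cons l w)
    have c: "fst l \<in> carrier G" "fst ` set w \<subseteq> carrier G" "cross v l \<in> E" using Cons.prems by auto
    have "p (v #> letter_val G l) = p v + \<psi> (letter_val G l)"
    proof (cases "snd l")
      case True
      then have "(v #> inv (fst l), fst l) \<in> E" using c(3) by (simp add: cross_def)
      from p[OF this] show ?thesis using True c(1) Cons.prems(1)
        by (simp add: letter_val_def \<psi>i add.assoc)
    next
      case False
      then show ?thesis using p[of v "fst l"] c(3) by (simp add: cross_def letter_val_def)
    qed
    moreover have "p (v #> letter_val G l #> word_val G w) = p (v #> letter_val G l) + \<psi> (word_val G w)"
      using Cons.IH[of "v #> letter_val G l"] Cons.prems c by (simp add: coset_subset letter_val_closed)
    ultimately show ?case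
      using Cons.prems(1) c \<psi> by (simp add: coset_mult_assoc letter_val_closed word_val_closed add.assoc)
  qed (simp add: \<psi>1)
qed

text \<open>For the hypothesis \<open>rigid\<close> of \<open>rank_count\<close>,
  \<open>\<phi>\<close> extends from the basis to a homomorphism to the field with two elements. The
  potentials make it vanish on the closed paths generating \<open>K1\<close> and \<open>K2\<close>,
  hence on \<open>G\<close>.\<close>

lemma graph_rank_count:
  fixes a b :: "int \<Rightarrow> 'a set" and T :: "'a \<Rightarrow> int set"
  assumes B: "free_basis G B" "finite B" and K1: "subgroup K1 G" and K2: "subgroup K2 G"
    and gen: "generate G (K1 \<union> K2) = carrier G"
    and D1: "finite D1" "K1 \<in> D1" and D2: "finite D2" "K2 \<in> D2"
    and E1: "finite E1" "\<And>v x. (v, x) \<in> E1 \<Longrightarrow> v \<in> D1 \<and> x \<in> B \<and> v #> x \<in> D1"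
    and E2: "finite E2" "\<And>v x. (v, x) \<in> E2 \<Longrightarrow> v \<in> D2 \<and> x \<in> B \<and> v #> x \<in> D2"
    and conn1: "\<And>Z. Z \<subseteq> D1 \<Longrightarrow> K1 \<in> Z \<Longrightarrow> (\<And>v x. (v, x) \<in> E1 \<Longrightarrow> v \<in> Z \<longleftrightarrow> v #> x \<in> Z) \<Longrightarrow> Z = D1"
    and conn2: "\<And>Z. Z \<subseteq> D2 \<Longrightarrow> K2 \<in> Z \<Longrightarrow> (\<And>v x. (v, x) \<in> E2 \<Longrightarrow> v \<in> Z \<longleftrightarrow> v #> x \<in> Z) \<Longrightarrow> Z = D2"
    and Ws1: "generate G (word_val G ` Ws1) = K1" "\<And>w. w \<in> Ws1 \<Longrightarrow> fst ` set w \<subseteq> carrier G \<and> path_edges K1 w \<subseteq> E1"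
    and Ws2: "generate G (word_val G ` Ws2) = K2" "\<And>w. w \<in> Ws2 \<Longrightarrow> fst ` set w \<subseteq> carrier G \<and> path_edges K2 w \<subseteq> E2"
    and ran: "range a \<subseteq> D1" "range b \<subseteq> D2"
    and T: "\<And>i x. x \<in> B \<Longrightarrow> i \<in> T x \<Longrightarrow> (a i, x) \<in> E1 \<and> (b i, x) \<in> E2"
    and T_step: "\<And>i x. x \<in> B \<Longrightarrow> i \<in> T x \<Longrightarrow> \<exists>j. a j = a i #> x \<and> b j = b i #> x"
    and W: "W = {\<lambda>i. p (a i) + q (b i) | p q. True}"
  shows "(\<Prod>x\<in>B. rho W (T x)) * 2 ^ (card B + card D1 + card D2) \<le> rho W UNIV * 2 ^ (card E1 + card E2 + 1)"
proof (rule rank_count[OF D1(1) D2(1) E1(1) E2(1) B(2), where na = "\<lambda>v x. v #> x" and nb = "\<lambda>v x. v #> x"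
      and a = a and b = b])
  have BG: "B \<subseteq> carrier G" using B by (simp add: free_basis_def)
  show "\<exists>k. \<forall>v\<in>D1. p v = k" if "\<And>v x. (v, x) \<in> E1 \<Longrightarrow> p (v #> x) = p v" for p :: "'a set \<Rightarrow> bit"
  proof -
    have "{v \<in> D1. p v = p K1} = D1" using that D1 E1(2) by (intro conn1) auto
    then show ?thesis by blast
  qed
  show "\<exists>k. \<forall>v\<in>D2. p v = k" if "\<And>v x. (v, x) \<in> E2 \<Longrightarrow> p (v #> x) = p v" for p :: "'a set \<Rightarrow> bit"
  proof -
    have "{v \<in> D2. p v = p K2} = D2" using that D2 E2(2) by (intro conn2) auto
    then show ?thesis by blast
  qed
  fix \<phi> :: "'a \<Rightarrow> bit" and p q
  assume p: "\<And>v x. (v, x) \<in> E1 \<Longrightarrow> p (v #> x) = p v + \<phi> x"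
    and q: "\<And>v x. (v, x) \<in> E2 \<Longrightarrow> q (v #> x) = q v + \<phi> x"
  obtain \<psi> where \<psi>: "\<psi> \<in> hom G bit_group" "\<forall>x\<in>B. \<psi> x = \<phi> x"
    using free_basis_hom[OF B(1) group_bit_group, of \<phi>] by (auto simp: bit_group_def)
  have add: "\<psi> (x \<otimes> y) = \<psi> x + \<psi> y" if "x \<in> carrier G" "y \<in> carrier G" for x y
    using \<psi>(1) that by (auto simp: hom_def bit_group_def)
  have zero: "\<psi> g = 0" if g: "g \<in> K"
    and K: "subgroup K G" and Ws: "generate G (word_val G ` Ws) = K"
      "\<And>w. w \<in> Ws \<Longrightarrow> fst ` set w \<subseteq> carrier G \<and> path_edges K w \<subseteq> E"
    and p: "\<And>v x. (v, x) \<in> E \<Longrightarrow> x \<in> B \<and> p (v #> x) = p v + \<phi> x" for g K Ws E and p :: "'a set \<Rightarrow> bit"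
  proof -
    have KG: "K \<subseteq> carrier G" using K by (rule subgroup.subset)
    have trivial: "(\<lambda>_. 0) \<in> hom G bit_group" by (auto simp: hom_def bit_group_def)
    show ?thesis
    proof (rule hom_eq_on_generate[OF \<psi>(1) trivial group_bit_group])
      show "word_val G ` Ws \<subseteq> carrier G" using Ws(2) word_val_closed by blast
      show "g \<in> generate G (word_val G ` Ws)" using g Ws(1) by simp
      fix y assume "y \<in> word_val G ` Ws"
      then obtain w where w: "w \<in> Ws" "y = word_val G w" by blast
      have "y \<in> K" using w Ws(1) generate.incl[of y "word_val G ` Ws" G] by blast
      then have "K #> y = K" using K KG by (intro coset_join2) auto
      moreover have "p (K #> y) = p K + \<psi> y"
        unfolding w(2) using p \<psi>(2) Ws(2)[OF w(1)] KG by (intro path_potential[where E = E and p = p, OF add]) auto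
      ultimately show "\<psi> y = 0" by simp
    qed
  qed
  have z1: "\<psi> g = 0" if "g \<in> K1" for g
    using zero[OF that K1 Ws1] p E1(2) by blast
  have z2: "\<psi> g = 0" if "g \<in> K2" for g
    using zero[OF that K2 Ws2] q E2(2) by blast
  have trivial: "(\<lambda>_. 0) \<in> hom G bit_group" by (auto simp: hom_def bit_group_def)
  have "\<psi> g = 0" if "g \<in> carrier G" for g
  proof (rule hom_eq_on_generate[OF \<psi>(1) trivial group_bit_group])
    show "K1 \<union> K2 \<subseteq> carrier G" using subgroup.subset[OF K1] subgroup.subset[OF K2] by blast
    show "g \<in> generate G (K1 \<union> K2)" using that gen by simp
  qed (use z1 z2 in auto)
  then show "\<forall>x\<in>B. \<phi> x = 0" using \<psi>(2) BG by (metis subsetD)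
next
  show "range a \<subseteq> D1" "range b \<subseteq> D2" by (fact ran)+
  show "W = {\<lambda>i. p (a i) + q (b i) | p q. True}" by (fact W)
  show "v \<in> D1 \<and> v #> x \<in> D1" if "(v, x) \<in> E1" for v x using E1(2)[OF that] by simp
  show "v \<in> D2 \<and> v #> x \<in> D2" if "(v, x) \<in> E2" for v x using E2(2)[OF that] by simp
  fix i x assume "x \<in> B" "i \<in> T x"
  then show "(a i, x) \<in> E1 \<and> (b i, x) \<in> E2" "\<exists>j. a j = a i #> x \<and> b j = b i #> x"
    using T T_step by simp_all
qed

text \<open>\<open>G\<close> is here the free target, with \<open>f\<close> and \<open>g\<close> the
  maps of the factors into it. By \<open>rank\<close> the sum of the two Euler bounds compares
  exactly the exponents in \<open>graph_rank_count\<close>.\<close>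

lemma amalgam_core:
  fixes F1 :: "('f, 'm1) monoid_scheme" and F2 :: "('g, 'm2) monoid_scheme"
  assumes B: "free_basis G B" "finite B"
    and F1: "group F1" "free_basis F1 P1" "finite P1" and F2: "group F2" "free_basis F2 P2" "finite P2"
    and f: "f \<in> hom F1 G" and g: "g \<in> hom F2 G"
    and gen: "generate G (f ` carrier F1 \<union> g ` carrier F2) = carrier G"
    and rank: "card B + 1 = card P1 + card P2"
    and t1: "t1 \<in> carrier F1" "t1 \<noteq> \<one>\<^bsub>F1\<^esub>" "f t1 = word_val G c"
    and t2: "t2 \<in> carrier F2" "t2 \<noteq> \<one>\<^bsub>F2\<^esub>" "g t2 = word_val G c"
    and c: "c \<in> words_over B" "reduced_word c" "c \<noteq> [] \<Longrightarrow> hd c \<noteq> linv (last c)"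
    and root: "(\<forall>s\<in>carrier F1. \<forall>k::nat. s [^]\<^bsub>F1\<^esub> k = t1 \<longrightarrow> k = 1) \<or>
      (\<forall>s\<in>carrier F2. \<forall>k::nat. s [^]\<^bsub>F2\<^esub> k = t2 \<longrightarrow> k = 1)"
  shows "inj_on f (carrier F1) \<and> inj_on g (carrier F2) \<and>
    ((\<exists>Y\<subseteq>f ` carrier F1. finite Y \<and> card Y + 1 \<le> card P1 \<and> generate G (insert (word_val G c) Y) = f ` carrier F1) \<or>
     (\<exists>Y\<subseteq>g ` carrier F2. finite Y \<and> card Y + 1 \<le> card P2 \<and> generate G (insert (word_val G c) Y) = g ` carrier F2))"
proof -
  have BG: "B \<subseteq> carrier G" using B by (simp add: free_basis_def)
  have cG: "fst ` set c \<subseteq> carrier G" using c(1) BG by blast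
  define K1 where "K1 = f ` carrier F1"
  define K2 where "K2 = g ` carrier F2"
  have words: "\<exists>Ws. finite Ws \<and> Ws \<subseteq> words_over B \<and> c \<in> Ws \<and> generate G (word_val G ` Ws) = h ` carrier F"
    if F: "group F" "free_basis F P" "finite P" and h: "h \<in> hom F G" and t: "t \<in> carrier F" "h t = word_val G c"
    for F :: "('z, 'n) monoid_scheme" and P h t
  proof -
    interpret h: group_hom F G h using F(1) h is_group by (simp add: group_hom_def group_hom_axioms_def)
    have P: "P \<subseteq> carrier F" "generate F P = carrier F" using F(2) by (auto simp: free_basis_def)
    have "\<exists>w. w \<in> words_over B \<and> word_val G w = h x" if "x \<in> P" for x
    proof -
      have "h x \<in> generate G B" using that P B(1) by (auto simp: free_basis_def)
      then show ?thesis unfolding generate_eq_words[OF BG] by force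
    qed
    then obtain wd where wd: "\<And>x. x \<in> P \<Longrightarrow> wd x \<in> words_over B \<and> word_val G (wd x) = h x" by metis
    \<comment> \<open>\<open>c\<close> is added to the words for the generators so that the finite
      graph carries the closed path \<open>c\<close>.\<close>
    define Ws where "Ws = insert c (wd ` P)"
    have "word_val G ` Ws = insert (word_val G c) (h ` P)" using wd by (force simp: Ws_def image_image)
    moreover have "generate G (insert (word_val G c) (h ` P)) = h ` carrier F"
    proof
      show "generate G (insert (word_val G c) (h ` P)) \<subseteq> h ` carrier F"
        using t P h.img_is_subgroup by (intro generate_subgroup_incl) (auto simp flip: t(2))
      have "h ` carrier F = generate G (h ` P)" using h.generate_img[OF P(1)] P(2) by simp
      also have "\<dots> \<subseteq> generate G (insert (word_val G c) (h ` P))" by (intro mono_generate) auto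
      finally show "h ` carrier F \<subseteq> generate G (insert (word_val G c) (h ` P))" .
    qed
    ultimately have "generate G (word_val G ` Ws) = h ` carrier F" by simp
    moreover have "Ws \<subseteq> words_over B" unfolding Ws_def using wd c(1) by blast
    moreover have "finite Ws" "c \<in> Ws" using F(3) by (simp_all add: Ws_def)
    ultimately show ?thesis by blast
  qed
  obtain Ws1 where Ws1: "finite Ws1" "Ws1 \<subseteq> words_over B" "c \<in> Ws1" "generate G (word_val G ` Ws1) = K1"
    using words[OF F1 f t1(1,3)] unfolding K1_def by blast
  obtain Ws2 where Ws2: "finite Ws2" "Ws2 \<subseteq> words_over B" "c \<in> Ws2" "generate G (word_val G ` Ws2) = K2"
    using words[OF F2 g t2(1,3)] unfolding K2_def by blast
  interpret f: group_hom F1 G f using F1(1) f is_group by (simp add: group_hom_def group_hom_axioms_def)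
  interpret g: group_hom F2 G g using F2(1) g is_group by (simp add: group_hom_def group_hom_axioms_def)
  have K1: "subgroup K1 G" unfolding K1_def by (rule f.img_is_subgroup)
  have K2: "subgroup K2 G" unfolding K2_def by (rule g.img_is_subgroup)
  obtain D1 E1 where D1: "finite D1" "K1 \<in> D1" "D1 \<subseteq> rcosets K1" and E1: "finite E1"
    and E1': "\<forall>v x. (v, x) \<in> E1 \<longrightarrow> v \<in> D1 \<and> x \<in> B \<and> v #> x \<in> D1"
    and p1: "\<forall>w\<in>Ws1. path_edges K1 w \<subseteq> E1"
    and conn1: "\<forall>Z\<subseteq>D1. K1 \<in> Z \<longrightarrow> (\<forall>v x. (v, x) \<in> E1 \<longrightarrow> (v \<in> Z \<longleftrightarrow> v #> x \<in> Z)) \<longrightarrow> Z = D1"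
    using coset_graph_exists[OF K1 BG Ws1(1,2)] by (elim exE conjE)
  obtain D2 E2 where D2: "finite D2" "K2 \<in> D2" "D2 \<subseteq> rcosets K2" and E2: "finite E2"
    and E2': "\<forall>v x. (v, x) \<in> E2 \<longrightarrow> v \<in> D2 \<and> x \<in> B \<and> v #> x \<in> D2"
    and p2: "\<forall>w\<in>Ws2. path_edges K2 w \<subseteq> E2"
    and conn2: "\<forall>Z\<subseteq>D2. K2 \<in> Z \<longrightarrow> (\<forall>v x. (v, x) \<in> E2 \<longrightarrow> (v \<in> Z \<longleftrightarrow> v #> x \<in> Z)) \<longrightarrow> Z = D2"
    using coset_graph_exists[OF K2 BG Ws2(1,2)] by (elim exE conjE)
  have e1: "v \<in> D1 \<and> x \<in> B \<and> v #> x \<in> D1" if "(v, x) \<in> E1" for v x using E1' that by simp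
  have e2: "v \<in> D2 \<and> x \<in> B \<and> v #> x \<in> D2" if "(v, x) \<in> E2" for v x using E2' that by simp
  have c1: "Z = D1" if "Z \<subseteq> D1" "K1 \<in> Z" "\<And>v x. (v, x) \<in> E1 \<Longrightarrow> v \<in> Z \<longleftrightarrow> v #> x \<in> Z" for Z
    using conn1 that by simp
  have c2: "Z = D2" if "Z \<subseteq> D2" "K2 \<in> Z" "\<And>v x. (v, x) \<in> E2 \<Longrightarrow> v \<in> Z \<longleftrightarrow> v #> x \<in> Z" for Z
    using conn2 that by simp
  have w1: "fst ` set w \<subseteq> carrier G \<and> path_edges K1 w \<subseteq> E1" if "w \<in> Ws1" for w
    using that Ws1(2) BG p1 by blast
  have w2: "fst ` set w \<subseteq> carrier G \<and> path_edges K2 w \<subseteq> E2" if "w \<in> Ws2" for w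
    using that Ws2(2) BG p2 by blast
  have cK: "word_val G c \<in> K1" "word_val G c \<in> K2"
    using t1 t2 unfolding K1_def K2_def by (metis imageI)+
  note euler1 = euler_bound[OF B(1) F1 f D1[unfolded K1_def] E1 e1]
  note euler2 = euler_bound[OF B(1) F2 g D2[unfolded K2_def] E2 e2]
  have genK: "generate G (K1 \<union> K2) = carrier G" using gen by (simp add: K1_def K2_def)
  have rank_ineq: "(\<Prod>x\<in>B. rho W (T x)) * 2 ^ (card B + card D1 + card D2) \<le> rho W UNIV * 2 ^ (card E1 + card E2 + 1)"
    if "range a \<subseteq> D1" "range b \<subseteq> D2" "\<And>i x. x \<in> B \<Longrightarrow> i \<in> T x \<Longrightarrow> (a i, x) \<in> E1 \<and> (b i, x) \<in> E2"
      "\<And>i x. x \<in> B \<Longrightarrow> i \<in> T x \<Longrightarrow> \<exists>j. a j = a i #> x \<and> b j = b i #> x"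
      "W = {\<lambda>i. p (a i) + q (b i) | p q. True}"
    for a b :: "int \<Rightarrow> 'a set" and T W
    by (rule graph_rank_count[OF B K1 K2 genK D1(1,2) D2(1,2) E1 e1 E2 e2 c1 c2 Ws1(4) w1 Ws2(4) w2,
          where a = a and b = b and T = T and W = W]) (assumption | rule that)+
  \<comment> \<open>If \<open>t\<close> died in the target, neither factor would embed, and both
    Euler bounds would improve by one.\<close>
  have c_ne: "c \<noteq> []"
  proof
    assume "c = []"
    then have "\<not> inj_on f (carrier F1)" "\<not> inj_on g (carrier F2)"
      using t1 t2 unfolding f.inj_on_one_iff g.inj_on_one_iff by auto
    then have le: "(card E1 + card E2 + 2) + 1 \<le> card B + card D1 + card D2"
      using euler1(2) euler2(2) rank by linarith
    \<comment> \<open>The circle shrinks to a point that joins the base vertices, and no edges are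
      glued.\<close>
    define W where "W = {\<lambda>i::int. p K1 + q K2 | p q. True :: bool} \<inter> (UNIV :: (int \<Rightarrow> bit) set)"
    have W: "W = {\<lambda>i::int. p ((\<lambda>_. K1) i) + q ((\<lambda>_. K2) i) | p q. True}" by (simp add: W_def)
    have "W \<subseteq> {\<lambda>_. 0, \<lambda>_. 1}"
    proof
      fix w assume "w \<in> W"
      then obtain k where "w = (\<lambda>_. k)" unfolding W_def by blast
      then show "w \<in> {\<lambda>_. 0, \<lambda>_. 1}" by (cases k) auto
    qed
    then have W2: "rho W UNIV \<le> 2" "finite W"
      using card_mono[of "{\<lambda>_. 0, \<lambda>_. 1 :: bit}" W] finite_subset[of W "{\<lambda>_. 0, \<lambda>_. 1}"]
      by (auto simp: rho_def card_insert_if split: if_splits)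
    have "W \<noteq> {}" by (auto simp: W_def)
    then have "rho W {} \<ge> 1" using W2(2) by (simp add: rho_def Suc_le_eq card_gt_0_iff)
    then have "1 \<le> (\<Prod>x\<in>B. rho W {})" by (simp add: one_le_power)
    moreover have "(\<Prod>x\<in>B. rho W {}) * 2 ^ (card B + card D1 + card D2) \<le> rho W UNIV * 2 ^ (card E1 + card E2 + 1)"
      by (rule rank_ineq[of "\<lambda>_. K1" "\<lambda>_. K2" "\<lambda>_. {}" W, OF _ _ _ _ W]) (use D1 D2 in auto)
    ultimately have "(2::nat) ^ (card B + card D1 + card D2) \<le> rho W UNIV * 2 ^ (card E1 + card E2 + 1)"
      by (metis (no_types, lifting) le_trans mult_1 mult_le_mono1)
    also have "\<dots> \<le> 2 * 2 ^ (card E1 + card E2 + 1)" using W2(1) by (rule mult_le_mono1)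
    also have "\<dots> = 2 ^ (card E1 + card E2 + 2)" by simp
    finally have "card B + card D1 + card D2 \<le> card E1 + card E2 + 2"
      by (rule power_le_imp_le_exp[rotated]) simp
    then show False using le by linarith
  qed
  define n where "n = int (length c)"
  have cyc_step: "cyc c (i + 1) \<noteq> linv (cyc c i)" for i using cyc_reduced[OF c(2) c_ne c(3)[OF c_ne]] .
  interpret C: circle_pair "cyc c" n "pos K1 c" "pos K2 c" "\<lambda>v l. v #> letter_val G l" "\<lambda>v l. v #> letter_val G l" B
  proof
    show "fst (cyc c i) \<in> B" for i using cyc_in[OF c_ne, of i] c(1) by auto
    show "n > 0" using c_ne by (simp add: n_def)
    show "cyc c (i + n) = cyc c i" for i by (simp add: n_def cyc_periodic)
    show "pos K1 c (i + n) = pos K1 c i" for i unfolding n_def by (rule pos_periodic[OF K1 c_ne cG cK(1)])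
    show "pos K2 c (i + n) = pos K2 c i" for i unfolding n_def by (rule pos_periodic[OF K2 c_ne cG cK(2)])
  qed (fact cyc_step B(2) pos_step[OF K1 c_ne cG cK(1)] pos_step[OF K2 c_ne cG cK(2)]
      pos_back[OF K1 c_ne cG cK(1)] pos_back[OF K2 c_ne cG cK(2)])+
  have cr1: "cross (pos K1 c k) (cyc c k) \<in> E1" for k
    using pos_cross[OF K1 c_ne cG cK(1)] w1[OF Ws1(3)] by blast
  have cr2: "cross (pos K2 c k) (cyc c k) \<in> E2" for k
    using pos_cross[OF K2 c_ne cG cK(2)] w2[OF Ws2(3)] by blast
  note cp1 = cross_pos[OF K1 c_ne cG cK(1)]
  note cp2 = cross_pos[OF K2 c_ne cG cK(2)]
  have edge: "(pos K1 c i, x) \<in> E1 \<and> (pos K2 c i, x) \<in> E2" if i: "i \<in> C.T (x, False)" for i x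
  proof -
    consider "cyc c i = (x, False)" | "cyc c (i - 1) = (x, True)" using i by (auto simp: C.T_def linv_def)
    then show ?thesis
    proof cases
      case 1 then show ?thesis using cr1[of i, unfolded cp1] cr2[of i, unfolded cp2] by simp
    next
      case 2 then show ?thesis using cr1[of "i - 1", unfolded cp1] cr2[of "i - 1", unfolded cp2] by simp
    qed
  qed
  have ineq: "(\<Prod>x\<in>B. rho C.W (C.T (x, False))) * 2 ^ (card B + card D1 + card D2)
      \<le> rho C.W UNIV * 2 ^ (card E1 + card E2 + 1)"
  proof (rule rank_ineq[of "pos K1 c" "pos K2 c" "\<lambda>x. C.T (x, False)" C.W, OF _ _ _ _ C.W_def])
    show "range (pos K1 c) \<subseteq> D1"
    proof (rule image_subsetI)
      fix i show "pos K1 c i \<in> D1"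
      proof (cases "snd (cyc c i)")
        case True
        then show ?thesis
          using e1[of "pos K1 c (i + 1)" "fst (cyc c i)"] cr1[of i, unfolded cp1] C.a_back[of i]
          by (simp add: letter_val_def)
      next
        case False
        then show ?thesis using e1[of "pos K1 c i" "fst (cyc c i)"] cr1[of i, unfolded cp1] by simp
      qed
    qed
    show "range (pos K2 c) \<subseteq> D2"
    proof (rule image_subsetI)
      fix i show "pos K2 c i \<in> D2"
      proof (cases "snd (cyc c i)")
        case True
        then show ?thesis
          using e2[of "pos K2 c (i + 1)" "fst (cyc c i)"] cr2[of i, unfolded cp2] C.b_back[of i]
          by (simp add: letter_val_def)
      next
        case False
        then show ?thesis using e2[of "pos K2 c i" "fst (cyc c i)"] cr2[of i, unfolded cp2] by simp
      qed
    qed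
    fix i x assume ix: "i \<in> C.T (x, False)"
    show "(pos K1 c i, x) \<in> E1 \<and> (pos K2 c i, x) \<in> E2" using edge[OF ix] .
    show "\<exists>j. pos K1 c j = pos K1 c i #> x \<and> pos K2 c j = pos K2 c i #> x"
      using C.a_move[OF ix] C.b_move[OF ix] by (auto simp: letter_val_def)
  qed
  define P where "P = (\<Prod>x\<in>B. rho C.W (C.T (x, False)))"
  have le: "rho C.W UNIV \<le> P" unfolding P_def by (rule C.rho_UNIV_le)
  have pos: "rho C.W UNIV > 0" by (rule C.rho_pos)
  have inj: "inj_on f (carrier F1) \<and> inj_on g (carrier F2)"
  proof (rule ccontr)
    assume "\<not> ?thesis"
    \<comment> \<open>One improved Euler bound gives a factor 2 in \<open>ineq\<close>, which
      contradicts \<open>le\<close>.\<close>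
    then have "Suc (card E1 + card E2 + 1) \<le> card B + card D1 + card D2"
      using euler1 euler2 rank by fastforce
    then have "(2::nat) ^ Suc (card E1 + card E2 + 1) \<le> 2 ^ (card B + card D1 + card D2)"
      by (intro power_increasing) auto
    then have "P * 2 ^ Suc (card E1 + card E2 + 1) \<le> rho C.W UNIV * 2 ^ (card E1 + card E2 + 1)"
      using ineq[folded P_def] by (meson le_trans mult_le_mono2)
    then have "2 * P \<le> rho C.W UNIV" by simp
    then show False using le pos by linarith
  qed
  have "card E1 + card E2 + 1 \<le> card B + card D1 + card D2" using euler1(1) euler2(1) rank by linarith
  then have "(2::nat) ^ (card E1 + card E2 + 1) \<le> 2 ^ (card B + card D1 + card D2)"
    by (intro power_increasing) auto
  then have "P * 2 ^ (card E1 + card E2 + 1) \<le> rho C.W UNIV * 2 ^ (card E1 + card E2 + 1)"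
    using ineq[folded P_def] by (meson le_trans mult_le_mono2)
  then have tight: "P \<le> rho C.W UNIV" by simp
  interpret C: tight_circle_pair "cyc c" n "pos K1 c" "pos K2 c" "\<lambda>v l. v #> letter_val G l" "\<lambda>v l. v #> letter_val G l" B
    by unfold_locales (rule tight[unfolded P_def])
  \<comment> \<open>Only roots inside the image of a factor lift to the factor, which is why
    \<open>pos_no_subperiod\<close> asks for \<open>s \<in> K\<close>.\<close>
  have root_image: "k = 1"
    if F: "group F" and h: "h \<in> hom F G" "inj_on h (carrier F)" and t: "t \<in> carrier F" "h t = word_val G c"
      and r: "\<forall>s\<in>carrier F. \<forall>k::nat. s [^]\<^bsub>F\<^esub> k = t \<longrightarrow> k = 1"
      and s: "s \<in> h ` carrier F" "s [^] k = word_val G c"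
    for F :: "('z, 'n) monoid_scheme" and h t s and k :: nat
  proof -
    interpret h: group_hom F G h using F h(1) is_group by (simp add: group_hom_def group_hom_axioms_def)
    obtain s' where s': "s' \<in> carrier F" "s = h s'" using s(1) by blast
    then have "h (s' [^]\<^bsub>F\<^esub> k) = h t" using s(2) t(2) by (simp add: h.hom_nat_pow)
    then have "s' [^]\<^bsub>F\<^esub> k = t" using h(2) s'(1) t(1) by (simp add: inj_on_eq_iff)
    then show ?thesis using r s'(1) by blast
  qed
  have "C.no_subperiod (pos K1 c) \<or> C.no_subperiod (pos K2 c)"
    using root
  proof
    assume r: "\<forall>s\<in>carrier F1. \<forall>k::nat. s [^]\<^bsub>F1\<^esub> k = t1 \<longrightarrow> k = 1"
    have "k = 1" if "s \<in> K1" "s [^] k = word_val G c" for s and k :: nat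
      using root_image[OF F1(1) f conjunct1[OF inj] t1(1,3) r] that unfolding K1_def by blast
    then have "C.no_subperiod (pos K1 c)"
      unfolding C.no_subperiod_def unfolding n_def using pos_no_subperiod[OF K1 c_ne cG cK(1)] by blast
    then show ?thesis ..
  next
    assume r: "\<forall>s\<in>carrier F2. \<forall>k::nat. s [^]\<^bsub>F2\<^esub> k = t2 \<longrightarrow> k = 1"
    have "k = 1" if "s \<in> K2" "s [^] k = word_val G c" for s and k :: nat
      using root_image[OF F2(1) g conjunct2[OF inj] t2(1,3) r] that unfolding K2_def by blast
    then have "C.no_subperiod (pos K2 c)"
      unfolding C.no_subperiod_def unfolding n_def using pos_no_subperiod[OF K2 c_ne cG cK(2)] by blast
    then show ?thesis ..
  qed
  from C.simple_edge[OF this] obtain k where k: "k \<in> {0..<n}"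
    and simple: "(\<forall>k'\<in>{0..<n}. fst (cyc c k') = fst (cyc c k) \<longrightarrow> pos K1 c (C.tail k') = pos K1 c (C.tail k) \<longrightarrow> k' = k) \<or>
      (\<forall>k'\<in>{0..<n}. fst (cyc c k') = fst (cyc c k) \<longrightarrow> pos K2 c (C.tail k') = pos K2 c (C.tail k) \<longrightarrow> k' = k)"
    by blast
  have e1': "v \<in> D1 \<and> x \<in> carrier G \<and> v #> x \<in> D1" if "(v, x) \<in> E1" for v x using e1[OF that] BG by blast
  have e2': "v \<in> D2 \<and> x \<in> carrier G \<and> v #> x \<in> D2" if "(v, x) \<in> E2" for v x using e2[OF that] BG by blast
  have "(\<exists>Y\<subseteq>K1. finite Y \<and> card Y + 1 \<le> card P1 \<and> generate G (insert (word_val G c) Y) = K1) \<or>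
     (\<exists>Y\<subseteq>K2. finite Y \<and> card Y + 1 \<le> card P2 \<and> generate G (insert (word_val G c) Y) = K2)"
    using simple
  proof
    assume s: "\<forall>k'\<in>{0..<n}. fst (cyc c k') = fst (cyc c k) \<longrightarrow> pos K1 c (C.tail k') = pos K1 c (C.tail k) \<longrightarrow> k' = k"
    have "k' = k" if "k' \<in> {0..<int (length c)}" "cross (pos K1 c k') (cyc c k') = cross (pos K1 c k) (cyc c k)" for k'
      using s that by (simp add: cp1 C.tail_def n_def)
    from simple_crossing_split[OF K1 c_ne cG cK(1) k[unfolded n_def] this]
    obtain u l v where "c = u @ l # v" "cross (K1 #> word_val G u) l \<notin> path_edges K1 u"
      "cross (K1 #> word_val G u) l \<notin> path_edges (K1 #> word_val G (u @ [l])) v" by blast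
    from simple_edge_generators[OF K1 D1 E1 e1' c1 Ws1(4) w1 this(1) cG cK(1) conjunct2[OF w1[OF Ws1(3)]] this(2,3)]
    obtain Y where "Y \<subseteq> K1" "finite Y" "card Y + card D1 \<le> card E1" "generate G (insert (word_val G c) Y) = K1" by blast
    moreover from this have "card Y + 1 \<le> card P1" using euler1(1) by linarith
    ultimately show ?thesis by blast
  next
    assume s: "\<forall>k'\<in>{0..<n}. fst (cyc c k') = fst (cyc c k) \<longrightarrow> pos K2 c (C.tail k') = pos K2 c (C.tail k) \<longrightarrow> k' = k"
    have "k' = k" if "k' \<in> {0..<int (length c)}" "cross (pos K2 c k') (cyc c k') = cross (pos K2 c k) (cyc c k)" for k'
      using s that by (simp add: cp2 C.tail_def n_def)
    from simple_crossing_split[OF K2 c_ne cG cK(2) k[unfolded n_def] this]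
    obtain u l v where "c = u @ l # v" "cross (K2 #> word_val G u) l \<notin> path_edges K2 u"
      "cross (K2 #> word_val G u) l \<notin> path_edges (K2 #> word_val G (u @ [l])) v" by blast
    from simple_edge_generators[OF K2 D2 E2 e2' c2 Ws2(4) w2 this(1) cG cK(2) conjunct2[OF w2[OF Ws2(3)]] this(2,3)]
    obtain Y where "Y \<subseteq> K2" "finite Y" "card Y + card D2 \<le> card E2" "generate G (insert (word_val G c) Y) = K2" by blast
    moreover from this have "card Y + 1 \<le> card P2" using euler2(1) by linarith
    ultimately show ?thesis by blast
  qed
  then show ?thesis using inj unfolding K1_def K2_def by blast
qed

end

section \<open>From the free target back to the amalgam\<close>

text \<open>In \<open>G\<close> the element \<open>t1\<close> comes from the second factor and needs
  no generator of its own. So the lift of \<open>Y\<close> and \<open>P2\<close> together generate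
  \<open>G\<close>, with at most \<open>card B\<close> elements, and
  \<open>free_basis_of_surjection\<close> applies.\<close>

lemma amalgam_free:
  fixes F1 :: "('f, 'm1) monoid_scheme" and F2 :: "('g, 'm2) monoid_scheme"
    and G :: "('a, 'm3) monoid_scheme" and H :: "('h, 'm4) monoid_scheme"
  assumes groups: "group F1" "group F2" "group G" "group H"
    and i1: "i1 \<in> hom F1 G" and i2: "i2 \<in> hom F2 G" and t: "t1 \<in> carrier F1" "t2 \<in> carrier F2" "i1 t1 = i2 t2"
    and gen: "generate G (i1 ` carrier F1 \<union> i2 ` carrier F2) = carrier G"
    and F2: "free_basis F2 P2" "finite P2"
    and h: "h \<in> hom G H" "h ` carrier G = carrier H" and B: "free_basis H B" "finite B"
    and inj: "inj_on (h \<circ> i1) (carrier F1)"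
    and Y: "Y \<subseteq> (h \<circ> i1) ` carrier F1" "finite Y" "card Y + card P2 \<le> card B"
    and genY: "generate H (insert ((h \<circ> i1) t1) Y) = (h \<circ> i1) ` carrier F1"
  shows "is_free_group G"
proof -
  interpret G: group G by fact
  interpret i1: group_hom F1 G i1 using groups i1 by (simp add: group_hom_def group_hom_axioms_def)
  interpret i2: group_hom F2 G i2 using groups i2 by (simp add: group_hom_def group_hom_axioms_def)
  define f where "f = h \<circ> i1"
  have f: "f \<in> hom F1 H" unfolding f_def using i1 h(1) by (rule hom_compose)
  interpret f: group_hom F1 H f using groups f by (simp add: group_hom_def group_hom_axioms_def)
  \<comment> \<open>Generation is known only for the image in \<open>H\<close>; injectivity lifts it
    to \<open>F1\<close>.\<close>
  obtain Y' where Y': "Y' \<subseteq> carrier F1" "inj_on f Y'" "Y = f ` Y'"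
    using Y(1) unfolding f_def[symmetric] subset_image_inj by blast
  have finY': "finite Y'" "card Y' = card Y"
    using Y(2) Y'(3) finite_image_iff[OF Y'(2)] card_image[OF Y'(2)] by simp_all
  have ins: "insert t1 Y' \<subseteq> carrier F1" using t(1) Y'(1) by blast
  have "f ` generate F1 (insert t1 Y') = f ` carrier F1"
    using f.generate_img[OF ins] genY Y'(3) by (simp add: f_def)
  moreover have sub: "generate F1 (insert t1 Y') \<subseteq> carrier F1" using group.generate_incl[OF groups(1) ins] .
  ultimately have genF1: "generate F1 (insert t1 Y') = carrier F1"
    using inj inj_on_image_eq_iff[of f "carrier F1"] by (simp add: f_def)
  have P2: "P2 \<subseteq> carrier F2" "generate F2 P2 = carrier F2" using F2 by (auto simp: free_basis_def)
  define Z where "Z = i1 ` Y' \<union> i2 ` P2"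
  have ZG: "Z \<subseteq> carrier G" using Y'(1) P2(1) by (auto simp: Z_def)
  have Zsub: "subgroup (generate G Z) G" using ZG by (rule G.generate_is_subgroup)
  have "i2 ` carrier F2 = generate G (i2 ` P2)" using i2.generate_img[OF P2(1)] P2(2) by simp
  then have s2: "i2 ` carrier F2 \<subseteq> generate G Z"
    using G.mono_generate[of "i2 ` P2" Z] by (simp add: Z_def)
  have "i1 ` carrier F1 = generate G (i1 ` insert t1 Y')" using i1.generate_img[OF ins] genF1 by simp
  also have "\<dots> \<subseteq> generate G Z"
  proof (rule G.generate_subgroup_incl[OF _ Zsub])
    have "i1 t1 \<in> generate G Z" using s2 t(2,3) by auto
    moreover have "i1 ` Y' \<subseteq> generate G Z" by (auto simp: Z_def intro: generate.incl)
    ultimately show "i1 ` insert t1 Y' \<subseteq> generate G Z" by simp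
  qed
  finally have "generate G (i1 ` carrier F1 \<union> i2 ` carrier F2) \<subseteq> generate G Z"
    using s2 by (intro G.generate_subgroup_incl[OF _ Zsub]) simp
  then have genZ: "generate G Z = carrier G" using gen G.generate_incl[OF ZG] by simp
  have finZ: "finite Z" using finY'(1) F2(2) by (simp add: Z_def)
  have "card Z \<le> card (i1 ` Y') + card (i2 ` P2)" unfolding Z_def by (rule card_Un_le)
  also have "\<dots> \<le> card Y' + card P2" using finY'(1) F2(2) by (intro add_mono card_image_le)
  finally have "card Z \<le> card B" using Y(3) finY'(2) by simp
  then have "free_basis G Z"
    using free_basis_of_surjection[OF groups(3,4) ZG finZ genZ B _ h] by simp
  then show ?thesis using groups(3) by (auto simp: is_free_group_def)
qed

lemma indivisible_root:
  assumes "indivisible F t" "s \<in> carrier F" "s [^]\<^bsub>F\<^esub> (k::nat) = t" shows "k = 1"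
proof -
  have "s [^]\<^bsub>F\<^esub> int k = t" using assms(3) by (simp add: int_pow_int)
  then have "int k = 1 \<or> int k = -1" using assms(1,2) unfolding indivisible_def by blast
  then show ?thesis by simp
qed

theorem theorem1p2:
  fixes F1 :: "'a monoid" and F2 :: "'b monoid" and G :: "'c monoid"
    and n m :: nat and t1 :: 'a and t2 :: 'b and i1 :: "'a \<Rightarrow> 'c" and i2 :: "'b \<Rightarrow> 'c"
  assumes "free_of_rank F1 n" and "free_of_rank F2 m"
    and "t1 \<in> carrier F1" and "t1 \<noteq> \<one>\<^bsub>F1\<^esub>"
    and "t2 \<in> carrier F2" and "t2 \<noteq> \<one>\<^bsub>F2\<^esub>"
    and "amalgamated_product F1 F2 t1 t2 G i1 i2"
    and "indivisible F1 t1 \<or> indivisible F2 t2"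
    and "has_corank G (n + m - 1)"
  shows "is_free_group G"
proof -
  obtain P1 where F1: "group F1" "free_basis F1 P1" "finite P1" "card P1 = n"
    using assms(1) by (auto simp: free_of_rank_def)
  obtain P2 where F2: "group F2" "free_basis F2 P2" "finite P2" "card P2 = m"
    using assms(2) by (auto simp: free_of_rank_def)
  have G: "group G" "i1 \<in> hom F1 G" "i2 \<in> hom F2 G" "i1 t1 = i2 t2"
    "generate G (i1 ` carrier F1 \<union> i2 ` carrier F2) = carrier G"
    using assms(7) unfolding amalgamated_product_def by - (elim conjE, assumption)+
  obtain H :: "nat monoid" and h0 B where H: "group H" "free_basis H B" "finite B" "card B = n + m - 1"
    and h0: "h0 \<in> hom G H" "h0 ` carrier G = carrier H"
    using assms(9) by (auto simp: has_corank_def surjects_onto_free_def free_of_rank_def)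
  interpret H: group H by fact
  interpret h0: group_hom G H h0 using G(1) H(1) h0(1) by (simp add: group_hom_def group_hom_axioms_def)
  interpret i1: group_hom F1 G i1 using F1(1) G by (simp add: group_hom_def group_hom_axioms_def)
  interpret i2: group_hom F2 G i2 using F2(1) G by (simp add: group_hom_def group_hom_axioms_def)
  have BH: "B \<subseteq> carrier H" "generate H B = carrier H" using H(2) by (auto simp: free_basis_def)
  \<comment> \<open>Natural subtraction truncates in \<open>n + m - 1\<close>; a nontrivial
    \<open>t1\<close> excludes rank 0.\<close>
  have npos: "n \<ge> 1"
  proof (rule ccontr)
    assume "\<not> n \<ge> 1"
    then have "card P1 = 0" using F1(4) by simp
    then have "P1 = {}" using F1(3) by simp
    then have "carrier F1 = {\<one>\<^bsub>F1\<^esub>}"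
      using F1(2) group.generate_empty[OF F1(1)] by (simp add: free_basis_def)
    then show False using assms(3,4) by simp
  qed
  have "h0 (i1 t1) \<in> word_val H ` words_over B"
    using H.generate_eq_words[OF BH(1)] BH(2) assms(3) by auto
  then obtain w0 where w0: "w0 \<in> words_over B" "h0 (i1 t1) = word_val H w0" by blast
  obtain w where w: "w \<in> words_over B" "reduced_word w" "h0 (i1 t1) = word_val H w"
    using H.reduced_word_exists[OF BH(1) w0(1)] w0(2) by metis
  obtain u c where uc: "w = u @ c @ winv u" "reduced_word c" "c \<noteq> [] \<longrightarrow> hd c \<noteq> linv (last c)"
    using cyclic_reduction[OF w(2)] by blast
  have cB: "c \<in> words_over B" "u \<in> words_over B" using w(1) by (auto simp: uc(1))
  have cH: "fst ` set c \<subseteq> carrier H" "fst ` set u \<subseteq> carrier H" using cB BH(1) by auto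
  define y where "y = word_val H u"
  have yH: "y \<in> carrier H" using cH by (simp add: y_def H.word_val_closed)
  \<comment> \<open>Conjugating the surjection instead of \<open>t\<close> leaves the factors and
    the roots of \<open>t\<close> untouched.\<close>
  define h where "h g = inv\<^bsub>H\<^esub> y \<otimes>\<^bsub>H\<^esub> h0 g \<otimes>\<^bsub>H\<^esub> y" for g
  have h: "h \<in> hom G H"
  proof (rule homI)
    show "h x \<in> carrier H" if "x \<in> carrier G" for x using that yH by (simp add: h_def)
    show "h (x \<otimes>\<^bsub>G\<^esub> x') = h x \<otimes>\<^bsub>H\<^esub> h x'" if "x \<in> carrier G" "x' \<in> carrier G" for x x'
      using that yH by (simp add: h_def H.m_assoc H.inv_cancel_left)
  qed
  have hsurj: "h ` carrier G = carrier H"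
  proof
    show "carrier H \<subseteq> h ` carrier G"
    proof
      fix z assume z: "z \<in> carrier H"
      then have "y \<otimes>\<^bsub>H\<^esub> z \<otimes>\<^bsub>H\<^esub> inv\<^bsub>H\<^esub> y \<in> h0 ` carrier G" using yH h0(2) by simp
      then obtain x where x: "x \<in> carrier G" "h0 x = y \<otimes>\<^bsub>H\<^esub> z \<otimes>\<^bsub>H\<^esub> inv\<^bsub>H\<^esub> y" by (metis imageE)
      then have "h x = z" using yH z by (simp add: h_def H.m_assoc H.inv_cancel_left)
      then show "z \<in> h ` carrier G" using x(1) by blast
    qed
  qed (use hom_in_carrier[OF h] in blast)
  have ht: "h (i1 t1) = word_val H c"
    using cH yH by (simp add: h_def w(3) uc(1) H.word_val_append H.word_val_winv image_Un y_def[symmetric]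
        H.word_val_closed H.m_assoc H.inv_cancel_left)
  interpret h: group_hom G H h using G(1) H(1) h by (simp add: group_hom_def group_hom_axioms_def)
  have f: "h \<circ> i1 \<in> hom F1 H" using G(2) h by (rule hom_compose)
  have g: "h \<circ> i2 \<in> hom F2 H" using G(3) h by (rule hom_compose)
  have gen: "generate H ((h \<circ> i1) ` carrier F1 \<union> (h \<circ> i2) ` carrier F2) = carrier H"
  proof -
    have "i1 ` carrier F1 \<union> i2 ` carrier F2 \<subseteq> carrier G" by auto
    from h.generate_img[OF this] show ?thesis using G(5) hsurj by (simp add: image_Un image_comp)
  qed
  have root: "(\<forall>s\<in>carrier F1. \<forall>k::nat. s [^]\<^bsub>F1\<^esub> k = t1 \<longrightarrow> k = 1) \<or>
      (\<forall>s\<in>carrier F2. \<forall>k::nat. s [^]\<^bsub>F2\<^esub> k = t2 \<longrightarrow> k = 1)"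
    using assms(8) indivisible_root by metis
  have rank: "card B + 1 = card P1 + card P2" using H(4) F1(4) F2(4) npos by simp
  have t1: "(h \<circ> i1) t1 = word_val H c" and t2: "(h \<circ> i2) t2 = word_val H c"
    using ht G(4) by simp_all
  have core: "inj_on (h \<circ> i1) (carrier F1) \<and> inj_on (h \<circ> i2) (carrier F2) \<and>
    ((\<exists>Y\<subseteq>(h \<circ> i1) ` carrier F1. finite Y \<and> card Y + 1 \<le> card P1 \<and>
        generate H (insert (word_val H c) Y) = (h \<circ> i1) ` carrier F1) \<or>
     (\<exists>Y\<subseteq>(h \<circ> i2) ` carrier F2. finite Y \<and> card Y + 1 \<le> card P2 \<and>
        generate H (insert (word_val H c) Y) = (h \<circ> i2) ` carrier F2))"
    using H.amalgam_core[OF H(2,3) F1(1-3) F2(1-3) f g gen rank assms(3,4) t1 assms(5,6) t2 cB(1) uc(2) _ root] uc(3)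
    by blast
  then have inj: "inj_on (h \<circ> i1) (carrier F1)" "inj_on (h \<circ> i2) (carrier F2)" by blast+
  from core consider
    (1) Y where "Y \<subseteq> (h \<circ> i1) ` carrier F1" "finite Y" "card Y + 1 \<le> card P1"
      "generate H (insert (word_val H c) Y) = (h \<circ> i1) ` carrier F1"
  | (2) Y where "Y \<subseteq> (h \<circ> i2) ` carrier F2" "finite Y" "card Y + 1 \<le> card P2"
      "generate H (insert (word_val H c) Y) = (h \<circ> i2) ` carrier F2" by blast
  then show ?thesis
  proof cases
    case 1
    have "card Y + card P2 \<le> card B" using 1(3) rank by linarith
    then show ?thesis
      using amalgam_free[OF F1(1) F2(1) G(1) H(1) G(2,3) assms(3,5) G(4,5) F2(2,3) h hsurj H(2,3) inj(1) 1(1,2)]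
        1(4) t1 by simp
  next
    case 2
    have "card Y + card P1 \<le> card B" using 2(3) rank by linarith
    moreover have "generate G (i2 ` carrier F2 \<union> i1 ` carrier F1) = carrier G" using G(5) by (simp add: Un_commute)
    ultimately show ?thesis
      using amalgam_free[OF F2(1) F1(1) G(1) H(1) G(3,2) assms(5,3) G(4)[symmetric] _ F1(2,3) h hsurj H(2,3) inj(2) 2(1,2)]
        2(4) t2 by simp
  qed
qed

end
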